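(* Let $s\ge0$, let $\tilde A^{(s)}$ be the periodic atmospheric tomography operator, and for $j,k\in\mathbb{Z}$ let $\big(\sigma^{(s)}_{jk,n},u^{(s)}_{jk,n},v^{(s)}_{jk,n}\big)_{n=1}^{r^{(s)}_{jk}}$ be the singular systems of the matrices $\tilde A^{(s)}_{jk}$, so that $$(\tilde A^{(s)}\phi)(x,y)=\sum_{j,k\in\mathbb{Z}}\left(\sum_{n=1}^{r^{(s)}_{jk}}\sigma^{(s)}_{jk,n}\big((v^{(s)}_{jk,n})^H\phi_{jk}\big)u^{(s)}_{jk,n}\right)w_{jk}(x,y).$$ Let $\varphi=(\varphi_g)_{g=1}^G\in L_2(\Omega_T)^G$ with $$\varphi=\sum_{j,k\in\mathbb{Z}}\varphi_{jk}w_{jk},\qquad \varphi_{jk}=\big(\langle\varphi_g,w_{jk}\rangle_{L_2(\Omega_T)}\big)_{g=1}^G\in\mathbb{C}^G.$$ Then the best approximate solution of the equation $\tilde A^{(s)}\phi=\varphi$ is given by $$\big((\tilde A^{(s)})^\dagger\varphi\big)_\ell(x,y)=\sum_{j,k\in\mathbb{Z}}\left(\sum_{n=1}^{r^{(s)}_{jk}}\frac{(u^{(s)}_{jk,n})^H\varphi_{jk}}{\sigma^{(s)}_{jk,n}}\,v^{(s)}_{jk,n}\right)_\ell w^{(s)}_{jk,\ell}(x,y),\qquad \ell=1,\dots,L,$$ which is well-defined if and only if the following Picard condition holds: $$\sum_{j,k\in\mathbb{Z}}\sum_{n=1}^{r^{(s)}_{jk}}\frac{\big|(u^{(s)}_{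jk,n})^H\varphi_{jk}\big|^2}{(\sigma^{(s)}_{jk,n})^2}<\infty.$$
   Context: Let $G,L\in\mathbb{N}$, let $\alpha_g=(\alpha_g^x,\alpha_g^y)\in\mathbb{R}^2$ for $g=1,\dots,G$ (guide star directions), let $0\le h_1<\dots<h_L$ (layer heights), and let $\gamma_\ell>0$ with $\sum_{\ell=1}^L\gamma_\ell=1$ (turbulence weights). The setting is that of guide stars of one type only: either $c_\ell=1$ for all $\ell$ (only natural guide stars, NGS), or $c_\ell=1-h_\ell/h_{\mathrm{LGS}}$ for all $\ell$ (only laser guide stars, LGS), where $h_{\mathrm{LGS}}>h_\ell$ for all $\ell$; so $c_\ell\in(0,1]$. Let $\Omega_A\subset\mathbb{R}^2$ be the telescope aperture, and $\Omega_T=[-T,T]^2$ with $T>0$ so large that $\Omega_A+\alpha_gh_\ell\subset c_\ell\Omega_T$ for all $g,\ell$. For a domain $\Omega\subset\mathbb{R}^2$ and $\gamma>0$, $L_2(\Omega,\gamma)$ denotes the (complex) space $L_2(\Omega)$ with inner product $\langle u,v\rangle_{L_2(\Omega,\gamma)}=\frac1\gamma\int_\Omega u\overline v\,\mathrm{d}r$. For $j,k\in\mathbb{Z}$ define $$w_{jk}(x,y):=\frac{1}{2T}e^{i\omega(jx+ky)},\ \ \omega=\frac{\pi}{T},\qquad w_{jk,\ell}(x,y):=\frac{\gamma_\ell^{1/2}}{c_\ell}\,w_{jk}\big((x,y)/c_\ell\big),$$ $$\beta_{\ell,T}:=\pi^2(c_\ell T)^{-2},\qquad w^{(s)}_{jk,\ell}:=\left(1+\beta_{\ell,T}|(j,k)|^2\right)^{-s/2}w_{jk,\ell},\qquad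 |(j,k)|^2=j^2+k^2.$$ For $s\ge0$, the periodic Sobolev space $H^s(c_\ell\Omega_T,\gamma_\ell)$ is the space of $u\in L_2(c_\ell\Omega_T,\gamma_\ell)$ with finite norm induced by $$\langle u,v\rangle_{H^s(c_\ell\Omega_T,\gamma_\ell)}:=\sum_{j,k\in\mathbb{Z}}\left(1+\beta_{\ell,T}|(j,k)|^2\right)^{s}\langle u,w_{jk,\ell}\rangle_{L_2(c_\ell\Omega_T,\gamma_\ell)}\overline{\langle v,w_{jk,\ell}\rangle_{L_2(c_\ell\Omega_T,\gamma_\ell)}}.$$ Its elements are regarded as functions on $\mathbb{R}^2$ that are $2c_\ell T$-periodic in each variable. The functions $w^{(s)}_{jk,\ell}$, $j,k\in\mathbb{Z}$, form an orthonormal basis of $H^s(c_\ell\Omega_T,\gamma_\ell)$. The periodic atmospheric tomography operator is $$\tilde A^{(s)}:\mathcal{D}(\tilde A^{(s)}):=\prod_{\ell=1}^LH^s(c_\ell\Omega_T,\gamma_\ell)\to L_2(\Omega_T)^G,\qquad \tilde A^{(s)}\phi=(\tilde A^{(s)}_g\phi)_{g=1}^G,\qquad(\tilde A_g^{(s)}\phi)(r):=\sum_{\ell=1}^L\phi_\ell(c_\ell r+\alpha_gh_\ell),$$ where the product spaces carry the canonical inner products (sums of the componentwise inner products). For $\phi\in\mathcal{D}(\tilde A^{(s)})$ put $\phi_{jk}:=\big(\langle\phi_\ell,w^{(s)}_{jk,\ell}\rangle_{H^s(c_\ell\Omega_T,\gamma_\ell)}\big)_{\ell=1}^L\in\mathbb{C}^L$.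 For $j,k\in\mathbb{Z}$ define $\tilde A^{(s)}_{jk}:=\big((2T)w^{(s)}_{jk,\ell}(\alpha_g^xh_\ell,\alpha_g^yh_\ell)\big)_{g,\ell=1}^{G,L}\in\mathbb{C}^{G\times L}$, and let $r^{(s)}_{jk}$ be its rank. The singular system of this matrix consists of $\sigma^{(s)}_{jk,1}\ge\dots\ge\sigma^{(s)}_{jk,r^{(s)}_{jk}}>0$ and orthonormal vectors $u^{(s)}_{jk,n}\in\mathbb{C}^G$, $v^{(s)}_{jk,n}\in\mathbb{C}^L$ (i.e. $(u^{(s)}_{jk,m})^Hu^{(s)}_{jk,n}=\delta_{mn}=(v^{(s)}_{jk,m})^Hv^{(s)}_{jk,n}$) such that $\tilde A^{(s)}_{jk}z=\sum_{n=1}^{r^{(s)}_{jk}}\sigma^{(s)}_{jk,n}\big((v^{(s)}_{jk,n})^Hz\big)u^{(s)}_{jk,n}$ for all $z\in\mathbb{C}^L$. The superscript $H$ denotes the conjugate transpose. The best approximate solution of $\tilde A^{(s)}\phi=\varphi$ is the least-squares solution of minimal norm in $\mathcal{D}(\tilde A^{(s)})$, i.e. $(\tilde A^{(s)})^\dagger\varphi$ with $(\tilde A^{(s)})^\dagger$ the Moore-Penrose inverse, whose domain is $\mathcal{R}(\tilde A^{(s)})\oplus\mathcal{R}(\tilde A^{(s)})^\perp$. "Well-defined" means that the best approximate solution exists, i.e. $\varphi$ belongs to this domain (equivalently, the series converge in $H^s(c_\ell\Omega_T,\gamma_\ell)$). *)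

theory Defs
  imports "HOL-Analysis.Analysis"
begin

type_synonym plane = "real \<times> real"

text \<open>
  Elements of the function spaces below are represented by functions on the whole plane; two
  functions represent the same element iff they agree almost everywhere on the domain in question.
\<close>

(* square (c * T) is the scaled domain c Omega_T *)
definition square :: "real \<Rightarrow> plane set" where
  "square a = {-a..a} \<times> {-a..a}"

definition L2 :: "plane set \<Rightarrow> (plane \<Rightarrow> complex) set" where
  "L2 \<Omega> = {u. u \<in> borel_measurable (lebesgue_on \<Omega>) \<and>
             integrable (lebesgue_on \<Omega>) (\<lambda>r. (cmod (u r))\<^sup>2)}"

definition L2_inner :: "plane set \<Rightarrow> real \<Rightarrow> (plane \<Rightarrow> complex) \<Rightarrow> (plane \<Rightarrow> complex) \<Rightarrow> complex" where
  "L2_inner \<Omega> \<gamma> u v = complex_of_real (1 / \<gamma>) * (LINT r|lebesgue_on \<Omega>. u r * cnj (v r))"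

definition L2_norm :: "plane set \<Rightarrow> real \<Rightarrow> (plane \<Rightarrow> complex) \<Rightarrow> real" where
  "L2_norm \<Omega> \<gamma> u = sqrt (Re (L2_inner \<Omega> \<gamma> u u))"

definition w :: "real \<Rightarrow> int \<times> int \<Rightarrow> plane \<Rightarrow> complex" where
  "w T = (\<lambda>(j, k) (x, y).
     complex_of_real (1 / (2 * T)) *
     exp (\<i> * complex_of_real (pi / T * (of_int j * x + of_int k * y))))"

definition w_layer :: "real \<Rightarrow> real \<Rightarrow> real \<Rightarrow> int \<times> int \<Rightarrow> plane \<Rightarrow> complex" where
  "w_layer T \<gamma> c p r = complex_of_real (sqrt \<gamma> / c) * w T p (r /\<^sub>R c)"

definition sobolev_weight :: "real \<Rightarrow> real \<Rightarrow> int \<times> int \<Rightarrow> real" where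
  "sobolev_weight T c = (\<lambda>(j, k). 1 + pi\<^sup>2 / (c * T)\<^sup>2 * ((of_int j)\<^sup>2 + (of_int k)\<^sup>2))"

definition w_sob :: "real \<Rightarrow> real \<Rightarrow> real \<Rightarrow> real \<Rightarrow> int \<times> int \<Rightarrow> plane \<Rightarrow> complex" where
  "w_sob T \<gamma> c s p r =
     complex_of_real (sobolev_weight T c p powr (- s / 2)) * w_layer T \<gamma> c p r"

definition periodic2 :: "real \<Rightarrow> (plane \<Rightarrow> complex) \<Rightarrow> bool" where
  "periodic2 a u \<longleftrightarrow> (\<forall>x y. u (x + a, y) = u (x, y) \<and> u (x, y + a) = u (x, y))"

definition Hs :: "real \<Rightarrow> real \<Rightarrow> real \<Rightarrow> real \<Rightarrow> (plane \<Rightarrow> complex) set" where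
  "Hs T \<gamma> c s = {u. periodic2 (2 * c * T) u \<and> u \<in> L2 (square (c * T)) \<and>
     (\<lambda>p. sobolev_weight T c p powr s * (cmod (L2_inner (square (c * T)) \<gamma> u (w_layer T \<gamma> c p)))\<^sup>2)
       summable_on UNIV}"

definition Hs_inner ::
  "real \<Rightarrow> real \<Rightarrow> real \<Rightarrow> real \<Rightarrow> (plane \<Rightarrow> complex) \<Rightarrow> (plane \<Rightarrow> complex) \<Rightarrow> complex" where
  "Hs_inner T \<gamma> c s u v = (\<Sum>\<^sub>\<infinity>p\<in>UNIV. complex_of_real (sobolev_weight T c p powr s) *
      L2_inner (square (c * T)) \<gamma> u (w_layer T \<gamma> c p) *
      cnj (L2_inner (square (c * T)) \<gamma> v (w_layer T \<gamma> c p)))"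

definition Hs_norm :: "real \<Rightarrow> real \<Rightarrow> real \<Rightarrow> real \<Rightarrow> (plane \<Rightarrow> complex) \<Rightarrow> real" where
  "Hs_norm T \<gamma> c s u = sqrt (Re (Hs_inner T \<gamma> c s u u))"

definition L2_has_sum ::
  "plane set \<Rightarrow> (int \<times> int \<Rightarrow> plane \<Rightarrow> complex) \<Rightarrow> (plane \<Rightarrow> complex) \<Rightarrow> bool" where
  "L2_has_sum \<Omega> f S \<longleftrightarrow> S \<in> L2 \<Omega> \<and> (\<forall>p. f p \<in> L2 \<Omega>) \<and>
     ((\<lambda>F. L2_norm \<Omega> 1 (\<lambda>r. S r - (\<Sum>p\<in>F. f p r))) \<longlongrightarrow> 0) (finite_subsets_at_top UNIV)"

definition Hs_has_sum ::
  "real \<Rightarrow> real \<Rightarrow> real \<Rightarrow> real \<Rightarrow> (int \<times> int \<Rightarrow> plane \<Rightarrow> complex) \<Rightarrow> (plane \<Rightarrow> complex) \<Rightarrow> bool" where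
  "Hs_has_sum T \<gamma> c s f S \<longleftrightarrow> S \<in> Hs T \<gamma> c s \<and> (\<forall>p. f p \<in> Hs T \<gamma> c s) \<and>
     ((\<lambda>F. Hs_norm T \<gamma> c s (\<lambda>r. S r - (\<Sum>p\<in>F. f p r))) \<longlongrightarrow> 0) (finite_subsets_at_top UNIV)"

definition tomo_domain ::
  "real \<Rightarrow> ('l \<Rightarrow> real) \<Rightarrow> ('l \<Rightarrow> real) \<Rightarrow> real \<Rightarrow> ('l \<Rightarrow> plane \<Rightarrow> complex) set" where
  "tomo_domain T \<gamma> c s = {\<phi>. \<forall>l. \<phi> l \<in> Hs T (\<gamma> l) (c l) s}"

definition tomo_domain_norm ::
  "real \<Rightarrow> ('l::finite \<Rightarrow> real) \<Rightarrow> ('l \<Rightarrow> real) \<Rightarrow> real \<Rightarrow> ('l \<Rightarrow> plane \<Rightarrow> complex) \<Rightarrow> real" where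
  "tomo_domain_norm T \<gamma> c s \<phi> =
     sqrt (Re (\<Sum>l\<in>UNIV. Hs_inner T (\<gamma> l) (c l) s (\<phi> l) (\<phi> l)))"

definition data_space :: "real \<Rightarrow> ('g \<Rightarrow> plane \<Rightarrow> complex) set" where
  "data_space T = {f. \<forall>g. f g \<in> L2 (square T)}"

definition data_inner ::
  "real \<Rightarrow> ('g::finite \<Rightarrow> plane \<Rightarrow> complex) \<Rightarrow> ('g \<Rightarrow> plane \<Rightarrow> complex) \<Rightarrow> complex" where
  "data_inner T f f' = (\<Sum>g\<in>UNIV. L2_inner (square T) 1 (f g) (f' g))"

definition data_norm :: "real \<Rightarrow> ('g::finite \<Rightarrow> plane \<Rightarrow> complex) \<Rightarrow> real" where
  "data_norm T f = sqrt (Re (data_inner T f f))"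

definition tomo_op ::
  "('g \<Rightarrow> plane) \<Rightarrow> ('l::finite \<Rightarrow> real) \<Rightarrow> ('l \<Rightarrow> real) \<Rightarrow> ('l \<Rightarrow> plane \<Rightarrow> complex) \<Rightarrow>
     'g \<Rightarrow> plane \<Rightarrow> complex" where
  "tomo_op \<alpha> h c \<phi> g r = (\<Sum>l\<in>UNIV. \<phi> l (c l *\<^sub>R r + h l *\<^sub>R \<alpha> g))"

definition least_squares_solution ::
  "real \<Rightarrow> ('g::finite \<Rightarrow> plane) \<Rightarrow> ('l::finite \<Rightarrow> real) \<Rightarrow> ('l \<Rightarrow> real) \<Rightarrow> ('l \<Rightarrow> real) \<Rightarrow> real \<Rightarrow>
     ('g \<Rightarrow> plane \<Rightarrow> complex) \<Rightarrow> ('l \<Rightarrow> plane \<Rightarrow> complex) \<Rightarrow> bool" where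
  "least_squares_solution T \<alpha> h \<gamma> c s f \<phi> \<longleftrightarrow> \<phi> \<in> tomo_domain T \<gamma> c s \<and>
     (\<forall>\<psi> \<in> tomo_domain T \<gamma> c s.
        data_norm T (\<lambda>g r. tomo_op \<alpha> h c \<phi> g r - f g r)
          \<le> data_norm T (\<lambda>g r. tomo_op \<alpha> h c \<psi> g r - f g r))"

(* the functions phi that represent the value of the Moore-Penrose inverse at f *)
definition best_approximate_solution ::
  "real \<Rightarrow> ('g::finite \<Rightarrow> plane) \<Rightarrow> ('l::finite \<Rightarrow> real) \<Rightarrow> ('l \<Rightarrow> real) \<Rightarrow> ('l \<Rightarrow> real) \<Rightarrow> real \<Rightarrow>
     ('g \<Rightarrow> plane \<Rightarrow> complex) \<Rightarrow> ('l \<Rightarrow> plane \<Rightarrow> complex) \<Rightarrow> bool" where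
  "best_approximate_solution T \<alpha> h \<gamma> c s f \<phi> \<longleftrightarrow> least_squares_solution T \<alpha> h \<gamma> c s f \<phi> \<and>
     (\<forall>\<psi>. least_squares_solution T \<alpha> h \<gamma> c s f \<psi> \<longrightarrow>
        tomo_domain_norm T \<gamma> c s \<phi> \<le> tomo_domain_norm T \<gamma> c s \<psi>)"

definition pinv_domain ::
  "real \<Rightarrow> ('g::finite \<Rightarrow> plane) \<Rightarrow> ('l::finite \<Rightarrow> real) \<Rightarrow> ('l \<Rightarrow> real) \<Rightarrow> ('l \<Rightarrow> real) \<Rightarrow> real \<Rightarrow>
     ('g \<Rightarrow> plane \<Rightarrow> complex) set" where
  "pinv_domain T \<alpha> h \<gamma> c s = {f \<in> data_space T.
     \<exists>\<phi> \<in> tomo_domain T \<gamma> c s. \<exists>q \<in> data_space T.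
       (\<forall>\<psi> \<in> tomo_domain T \<gamma> c s. data_inner T (tomo_op \<alpha> h c \<psi>) q = 0) \<and>
       (\<forall>g. AE r in lebesgue_on (square T). f g r = tomo_op \<alpha> h c \<phi> g r + q g r)}"

(* the Hermitian product conjugate-linear in the first argument, i.e. u^H z *)
definition hdot :: "complex ^ 'n \<Rightarrow> complex ^ 'n \<Rightarrow> complex" where
  "hdot u z = (\<Sum>i\<in>UNIV. cnj (u $ i) * z $ i)"

definition singular_system ::
  "complex ^ 'l ^ 'g \<Rightarrow> (nat \<Rightarrow> real) \<Rightarrow> (nat \<Rightarrow> complex ^ 'g) \<Rightarrow> (nat \<Rightarrow> complex ^ 'l) \<Rightarrow> bool" where
  "singular_system A \<sigma> u v \<longleftrightarrow>
     (\<forall>n\<in>{1..rank A}. \<sigma> n > 0) \<and>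
     (\<forall>m\<in>{1..rank A}. \<forall>n\<in>{1..rank A}. m \<le> n \<longrightarrow> \<sigma> n \<le> \<sigma> m) \<and>
     (\<forall>m\<in>{1..rank A}. \<forall>n\<in>{1..rank A}.
        hdot (u m) (u n) = (if m = n then 1 else 0) \<and>
        hdot (v m) (v n) = (if m = n then 1 else 0)) \<and>
     (\<forall>z. A *v z = (\<Sum>n=1..rank A. (complex_of_real (\<sigma> n) * hdot (v n) z) *s u n))"

definition tomo_matrix ::
  "real \<Rightarrow> ('g::finite \<Rightarrow> plane) \<Rightarrow> ('l::finite \<Rightarrow> real) \<Rightarrow> ('l \<Rightarrow> real) \<Rightarrow> ('l \<Rightarrow> real) \<Rightarrow> real \<Rightarrow>
     int \<times> int \<Rightarrow> complex ^ 'l ^ 'g" where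
  "tomo_matrix T \<alpha> h \<gamma> c s p =
     (\<chi> g l. complex_of_real (2 * T) * w_sob T (\<gamma> l) (c l) s p (h l *\<^sub>R \<alpha> g))"

definition layer_coeffs ::
  "real \<Rightarrow> ('l::finite \<Rightarrow> real) \<Rightarrow> ('l \<Rightarrow> real) \<Rightarrow> real \<Rightarrow> ('l \<Rightarrow> plane \<Rightarrow> complex) \<Rightarrow> int \<times> int \<Rightarrow>
     complex ^ 'l" where
  "layer_coeffs T \<gamma> c s \<phi> p =
     (\<chi> l. Hs_inner T (\<gamma> l) (c l) s (\<phi> l) (w_sob T (\<gamma> l) (c l) s p))"

definition data_coeffs ::
  "real \<Rightarrow> ('g::finite \<Rightarrow> plane \<Rightarrow> complex) \<Rightarrow> int \<times> int \<Rightarrow> complex ^ 'g" where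
  "data_coeffs T f p = (\<chi> g. L2_inner (square T) 1 (f g) (w T p))"

end

theory Submission
  imports Defs
begin

text \<open>
  The operator is diagonalised by Fourier series. Expand the layers in the orthonormal bases
  \<open>w_sob\<close> and the data in the exponentials \<open>w\<close>. Dilating a layer by \<open>c l\<close> turns it into a
  \<open>2T\<close>-periodic function on the common square, and translating a periodic function multiplies its
  Fourier coefficients by a phase. Hence \<open>tomo_op\<close> acts on the coefficients of one frequency \<open>p\<close>
  by the finite matrix \<open>tomo_matrix\<close> at \<open>p\<close>, with no interaction between frequencies
  (\<open>data_coeffs_tomo_op\<close>).

  Passing to coefficients loses nothing: the exponentials are orthonormal (\<open>w_orthonormal\<close>) and
  total (\<open>w_total\<close>), and every square-summable family is a family of Fourier coefficients
  (\<open>riesz_fischer\<close>). So data spaces and Sobolev spaces are isometric to spaces of square-summable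
  families of vectors, and a coefficient vector at a single frequency can be changed at will without
  leaving the space (\<open>tomo_domain_update\<close>).

  The squared residual and the squared norm of the unknown are therefore sums over \<open>p\<close> of the
  squared norms belonging to the matrices, and both minimisations split into independent finite
  ones. By Pythagoras in the singular bases, the residual at \<open>p\<close> is minimal iff
  \<open>\<sigma>\<^sub>n v\<^sub>n\<^sup>H x = u\<^sub>n\<^sup>H f\<close> for all \<open>n\<close>, and among these \<open>x\<close> the shortest one is
  \<open>\<Sum>\<^sub>n (u\<^sub>n\<^sup>H f / \<sigma>\<^sub>n) v\<^sub>n\<close>. A minimiser in function space must be minimal at each
  frequency, since otherwise a change at one frequency would improve it; conversely, being minimal at
  each frequency suffices by summation. What remains is whether the vectors so determined form a
  square-summable family, and the sum of their squared norms is the Picard series. The same orthogonality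
  relations at each frequency describe the orthogonal complement of the range, which gives the domain
  of the Moore-Penrose inverse.
\<close>

section \<open>Unconditional sums\<close>

text \<open>
  The Cauchy criterion for unconditional sums of nonnegative terms: all finite sums that avoid a
  suitable finite set are small.
\<close>
lemma summable_on_small_tail:
  fixes f :: "'a \<Rightarrow> real"
  assumes f: "f summable_on UNIV" and nonneg: "\<And>x. f x \<ge> 0" and e: "e > 0"
  shows "\<exists>F. finite F \<and> (\<forall>G. finite G \<longrightarrow> G \<inter> F = {} \<longrightarrow> sum f G \<le> e)"
proof -
  obtain F where F: "finite F" "dist (sum f F) (infsum f UNIV) \<le> e"
    using infsum_finite_approximation[OF f e] by auto
  have "sum f G \<le> e" if G: "finite G" "G \<inter> F = {}" for G
  proof -
    have "sum f F + sum f G = sum f (F \<union> G)" using F(1) G by (subst sum.union_disjoint) auto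
    also have "\<dots> \<le> infsum f UNIV" using F(1) G nonneg by (intro finite_sum_le_infsum f) auto
    finally show ?thesis using F(2) by (simp add: dist_real_def)
  qed
  with F(1) show ?thesis by blast
qed

lemma infsum_of_real_complex:
  fixes f :: "'i \<Rightarrow> real"
  shows "(\<Sum>\<^sub>\<infinity>x\<in>A. complex_of_real (f x)) = complex_of_real (\<Sum>\<^sub>\<infinity>x\<in>A. f x)"
proof (cases "f summable_on A")
  case True
  then show ?thesis by (intro infsumI has_sum_of_real has_sum_infsum)
next
  case False
  moreover have "\<not> (\<lambda>x. complex_of_real (f x)) summable_on A"
    using False summable_on_Re[of "\<lambda>x. complex_of_real (f x)" A] by auto
  ultimately show ?thesis by (simp add: infsum_not_exists)
qed

lemma has_sum_diff:
  fixes f g :: "'i \<Rightarrow> 'b::{topological_ab_group_add, t2_space}"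
  assumes "(f has_sum a) A" "(g has_sum b) A"
  shows "((\<lambda>x. f x - g x) has_sum (a - b)) A"
  using has_sum_add[OF assms(1), of "\<lambda>x. - g x" "- b"] assms(2) by (simp add: has_sum_uminus)

lemma square_summable_diff:
  fixes a b :: "'i \<Rightarrow> complex"
  assumes "(\<lambda>p. (cmod (a p))\<^sup>2) summable_on UNIV" "(\<lambda>p. (cmod (b p))\<^sup>2) summable_on UNIV"
  shows "(\<lambda>p. (cmod (a p - b p))\<^sup>2) summable_on UNIV"
proof (rule summable_on_comparison_test)
  show "(\<lambda>p. 2 * (cmod (a p))\<^sup>2 + 2 * (cmod (b p))\<^sup>2) summable_on UNIV"
    by (intro summable_on_add summable_on_cmult_right assms)
  show "(cmod (a p - b p))\<^sup>2 \<le> 2 * (cmod (a p))\<^sup>2 + 2 * (cmod (b p))\<^sup>2" for p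
  proof -
    have "(cmod (a p - b p))\<^sup>2 \<le> (cmod (a p) + cmod (b p))\<^sup>2"
      by (intro power_mono norm_triangle_ineq4) auto
    also have "\<dots> \<le> 2 * (cmod (a p))\<^sup>2 + 2 * (cmod (b p))\<^sup>2"
      using sum_squares_bound[of "cmod (a p)" "cmod (b p)"] by (simp add: power2_sum)
    finally show ?thesis .
  qed
qed auto

lemma has_sum_finite_sum:
  fixes f :: "'i \<Rightarrow> 'a \<Rightarrow> 'b::{topological_comm_monoid_add, t2_space}"
  assumes "finite I" "\<And>i. i \<in> I \<Longrightarrow> (f i has_sum S i) A"
  shows "((\<lambda>x. \<Sum>i\<in>I. f i x) has_sum (\<Sum>i\<in>I. S i)) A"
  using assms by (induction I rule: finite_induct) (auto intro!: has_sum_add)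

text \<open>
  Comparing two families that differ at one frequency reduces a statement about an infinite sum to
  one about a single term.
\<close>
lemma has_sum_update:
  fixes F :: "'i \<Rightarrow> real"
  assumes "(F has_sum S) UNIV"
  shows "((\<lambda>p. if p = p0 then y else F p) has_sum (S - F p0 + y)) UNIV"
proof -
  have "((\<lambda>p. F p + (if p = p0 then y - F p0 else 0)) has_sum (S + (y - F p0))) UNIV"
    by (intro has_sum_add assms has_sum_finite_neutralI[of "{p0}"]) auto
  moreover have "F p + (if p = p0 then y - F p0 else 0) = (if p = p0 then y else F p)" for p by simp
  ultimately show ?thesis by (simp add: algebra_simps)
qed

section \<open>Square-integrable functions\<close>

lemma L2_measurable: "u \<in> L2 \<Omega> \<Longrightarrow> u \<in> borel_measurable (lebesgue_on \<Omega>)"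
  by (simp add: L2_def)

lemma L2_integrable_mult_cnj:
  assumes "u \<in> L2 \<Omega>" "v \<in> L2 \<Omega>"
  shows "integrable (lebesgue_on \<Omega>) (\<lambda>r. u r * cnj (v r))"
proof (rule Bochner_Integration.integrable_bound)
  show "integrable (lebesgue_on \<Omega>) (\<lambda>r. (cmod (u r))\<^sup>2 + (cmod (v r))\<^sup>2)"
    using assms by (auto simp: L2_def)
  have [measurable]: "u \<in> borel_measurable (lebesgue_on \<Omega>)" "v \<in> borel_measurable (lebesgue_on \<Omega>)"
    using assms by (auto simp: L2_def)
  have [measurable]: "cnj \<in> borel_measurable borel"
    by (intro borel_measurable_continuous_onI continuous_intros)
  show "(\<lambda>r. u r * cnj (v r)) \<in> borel_measurable (lebesgue_on \<Omega>)"
    by measurable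
  have "cmod (u r * cnj (v r)) \<le> (cmod (u r))\<^sup>2 + (cmod (v r))\<^sup>2" for r
    using sum_squares_bound[of "cmod (u r)" "cmod (v r)"]
      mult_nonneg_nonneg[OF norm_ge_zero norm_ge_zero, of "u r" "v r"]
    unfolding norm_mult complex_mod_cnj by linarith
  then show "AE r in lebesgue_on \<Omega>. norm (u r * cnj (v r))
               \<le> norm ((cmod (u r))\<^sup>2 + (cmod (v r))\<^sup>2)"
    by (auto simp: norm_mult)
qed

lemma L2_add:
  assumes "u \<in> L2 \<Omega>" "v \<in> L2 \<Omega>"
  shows "(\<lambda>r. u r + v r) \<in> L2 \<Omega>"
proof -
  have m [measurable]: "u \<in> borel_measurable (lebesgue_on \<Omega>)" "v \<in> borel_measurable (lebesgue_on \<Omega>)"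
    using assms by (auto simp: L2_def)
  have "integrable (lebesgue_on \<Omega>) (\<lambda>r. (cmod (u r + v r))\<^sup>2)"
  proof (rule Bochner_Integration.integrable_bound)
    show "integrable (lebesgue_on \<Omega>) (\<lambda>r. 2 * (cmod (u r))\<^sup>2 + 2 * (cmod (v r))\<^sup>2)"
      using assms by (auto simp: L2_def)
    have "(cmod (u r + v r))\<^sup>2 \<le> 2 * (cmod (u r))\<^sup>2 + 2 * (cmod (v r))\<^sup>2" for r
    proof -
      have "(cmod (u r + v r))\<^sup>2 \<le> (cmod (u r) + cmod (v r))\<^sup>2"
        by (intro power_mono norm_triangle_ineq) auto
      also have "\<dots> \<le> 2 * (cmod (u r))\<^sup>2 + 2 * (cmod (v r))\<^sup>2"
        using sum_squares_bound[of "cmod (u r)" "cmod (v r)"] by (simp add: power2_sum)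
      finally show ?thesis .
    qed
    then show "AE r in lebesgue_on \<Omega>. norm ((cmod (u r + v r))\<^sup>2)
               \<le> norm (2 * (cmod (u r))\<^sup>2 + 2 * (cmod (v r))\<^sup>2)"
      by auto
  qed measurable
  then show ?thesis by (simp add: L2_def)
qed

lemma L2_scale: "u \<in> L2 \<Omega> \<Longrightarrow> (\<lambda>r. a * u r) \<in> L2 \<Omega>"
  by (auto simp: L2_def norm_mult power_mult_distrib)

lemma L2_diff: "u \<in> L2 \<Omega> \<Longrightarrow> v \<in> L2 \<Omega> \<Longrightarrow> (\<lambda>r. u r - v r) \<in> L2 \<Omega>"
  using L2_add[of u \<Omega> "\<lambda>r. (-1) * v r"] L2_scale[of v \<Omega> "-1"] by simp

lemma L2_zero: "(\<lambda>r. 0) \<in> L2 \<Omega>"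
  by (simp add: L2_def)

lemma L2_sum: "(\<And>i. i \<in> F \<Longrightarrow> u i \<in> L2 \<Omega>) \<Longrightarrow> (\<lambda>r. \<Sum>i\<in>F. u i r) \<in> L2 \<Omega>"
  by (induction F rule: infinite_finite_induct) (auto simp: L2_zero intro!: L2_add)

lemma L2_inner_cnj: "cnj (L2_inner \<Omega> \<gamma> u v) = L2_inner \<Omega> \<gamma> v u"
  by (simp add: L2_inner_def mult.commute flip: Bochner_Integration.integral_cnj)

lemma L2_inner_add_left:
  assumes "u \<in> L2 \<Omega>" "u' \<in> L2 \<Omega>" "v \<in> L2 \<Omega>"
  shows "L2_inner \<Omega> \<gamma> (\<lambda>r. u r + u' r) v = L2_inner \<Omega> \<gamma> u v + L2_inner \<Omega> \<gamma> u' v"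
  by (simp add: L2_inner_def ring_distribs L2_integrable_mult_cnj assms)

lemma L2_inner_scale_left: "L2_inner \<Omega> \<gamma> (\<lambda>r. a * u r) v = a * L2_inner \<Omega> \<gamma> u v"
  by (simp add: L2_inner_def mult.assoc)

lemma L2_inner_diff_left:
  assumes "u \<in> L2 \<Omega>" "u' \<in> L2 \<Omega>" "v \<in> L2 \<Omega>"
  shows "L2_inner \<Omega> \<gamma> (\<lambda>r. u r - u' r) v = L2_inner \<Omega> \<gamma> u v - L2_inner \<Omega> \<gamma> u' v"
  by (simp add: L2_inner_def ring_distribs L2_integrable_mult_cnj assms)

lemma L2_inner_sum_left:
  assumes "\<And>i. i \<in> F \<Longrightarrow> u i \<in> L2 \<Omega>" "v \<in> L2 \<Omega>"
  shows "L2_inner \<Omega> \<gamma> (\<lambda>r. \<Sum>i\<in>F. u i r) v = (\<Sum>i\<in>F. L2_inner \<Omega> \<gamma> (u i) v)"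
  using assms(1)
proof (induction F rule: infinite_finite_induct)
  case (insert x F)
  then show ?case by (simp add: L2_inner_add_left L2_sum assms(2))
qed (simp_all add: L2_inner_def)

lemma L2_inner_diff_right:
  assumes "u \<in> L2 \<Omega>" "u' \<in> L2 \<Omega>" "v \<in> L2 \<Omega>"
  shows "L2_inner \<Omega> \<gamma> v (\<lambda>r. u r - u' r) = L2_inner \<Omega> \<gamma> v u - L2_inner \<Omega> \<gamma> v u'"
  using arg_cong[OF L2_inner_diff_left[OF assms], where f=cnj] by (simp add: L2_inner_cnj)

lemma L2_inner_scale_right: "L2_inner \<Omega> \<gamma> v (\<lambda>r. a * u r) = cnj a * L2_inner \<Omega> \<gamma> v u"
  using arg_cong[OF L2_inner_scale_left, where f=cnj] by (simp add: L2_inner_cnj)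

lemma L2_inner_sum_right:
  assumes "\<And>i. i \<in> F \<Longrightarrow> u i \<in> L2 \<Omega>" "v \<in> L2 \<Omega>"
  shows "L2_inner \<Omega> \<gamma> v (\<lambda>r. \<Sum>i\<in>F. u i r) = (\<Sum>i\<in>F. L2_inner \<Omega> \<gamma> v (u i))"
  using arg_cong[OF L2_inner_sum_left[OF assms], where f=cnj] by (simp add: L2_inner_cnj)

lemma L2_inner_cong_AE:
  assumes "u \<in> L2 \<Omega>" "u' \<in> L2 \<Omega>" "v \<in> L2 \<Omega>" "AE r in lebesgue_on \<Omega>. u r = u' r"
  shows "L2_inner \<Omega> \<gamma> u v = L2_inner \<Omega> \<gamma> u' v"
  unfolding L2_inner_def
  using assms by (intro arg_cong2[where f="(*)"] refl integral_cong_AE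
      borel_measurable_integrable L2_integrable_mult_cnj) auto

lemma L2_inner_self: "L2_inner \<Omega> 1 u u = complex_of_real (LINT r|lebesgue_on \<Omega>. (cmod (u r))\<^sup>2)"
  unfolding L2_inner_def complex_norm_square[symmetric] by (simp del: of_real_power)

lemma L2_norm_eq: "L2_norm \<Omega> 1 u = sqrt (LINT r|lebesgue_on \<Omega>. (cmod (u r))\<^sup>2)"
  by (simp add: L2_norm_def L2_inner_self)

lemma L2_norm_nonneg: "L2_norm \<Omega> 1 u \<ge> 0"
  by (simp add: L2_norm_eq)

lemma L2_norm_square: "(L2_norm \<Omega> 1 u)\<^sup>2 = (LINT r|lebesgue_on \<Omega>. (cmod (u r))\<^sup>2)"
  by (simp add: L2_norm_eq)

lemma L2_inner_self_norm: "L2_inner \<Omega> 1 u u = complex_of_real ((L2_norm \<Omega> 1 u)\<^sup>2)"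
  by (simp add: L2_inner_self L2_norm_square del: of_real_power)

text \<open>
  The usual discriminant argument for the squared norm of \<open>u - t z v\<close> with \<open>z\<close> the inner
  product and real \<open>t\<close>, which is a nonnegative quadratic polynomial in \<open>t\<close>.
\<close>
lemma L2_Cauchy_Schwarz:
  assumes u: "u \<in> L2 \<Omega>" and v: "v \<in> L2 \<Omega>"
  shows "cmod (L2_inner \<Omega> 1 u v) \<le> L2_norm \<Omega> 1 u * L2_norm \<Omega> 1 v"
proof -
  define z a b where "z = L2_inner \<Omega> 1 u v" and "a = (L2_norm \<Omega> 1 u)\<^sup>2" and "b = (L2_norm \<Omega> 1 v)\<^sup>2"
  have ab: "a \<ge> 0" "b \<ge> 0" by (auto simp: a_def b_def)
  have expand: "0 \<le> a - 2 * t * (cmod z)\<^sup>2 + t\<^sup>2 * (cmod z)\<^sup>2 * b" for t :: real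
  proof -
    define x where "x = complex_of_real t * z"
    have xv: "(\<lambda>r. x * v r) \<in> L2 \<Omega>" by (rule L2_scale[OF v])
    have d: "(\<lambda>r. u r - x * v r) \<in> L2 \<Omega>" by (rule L2_diff[OF u xv])
    have "complex_of_real ((L2_norm \<Omega> 1 (\<lambda>r. u r - x * v r))\<^sup>2) =
        L2_inner \<Omega> 1 u u - cnj x * z - (x * cnj z - x * cnj x * L2_inner \<Omega> 1 v v)"
      unfolding L2_inner_self_norm[symmetric]
      by (simp add: L2_inner_diff_left[OF u xv d] L2_inner_diff_right[OF u xv u]
          L2_inner_diff_right[OF u xv v] L2_inner_scale_left L2_inner_scale_right z_def L2_inner_cnj
          mult.assoc right_diff_distrib)
    also have "\<dots> = complex_of_real (a - 2 * t * (cmod z)\<^sup>2 + t\<^sup>2 * (cmod z)\<^sup>2 * b)"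
    proof -
      have "complex_of_real a - cnj x * z - (x * cnj z - x * cnj x * complex_of_real b) =
          complex_of_real a - 2 * complex_of_real t * (z * cnj z)
            + (complex_of_real t)\<^sup>2 * (z * cnj z) * complex_of_real b"
        unfolding x_def by (simp add: algebra_simps power2_eq_square)
      also have "\<dots> = complex_of_real (a - 2 * t * (cmod z)\<^sup>2 + t\<^sup>2 * (cmod z)\<^sup>2 * b)"
        unfolding complex_norm_square[symmetric] by simp
      finally show ?thesis
        unfolding L2_inner_self_norm a_def[symmetric] b_def[symmetric] .
    qed
    finally have "a - 2 * t * (cmod z)\<^sup>2 + t\<^sup>2 * (cmod z)\<^sup>2 * b = (L2_norm \<Omega> 1 (\<lambda>r. u r - x * v r))\<^sup>2"
      by (metis of_real_eq_iff)
    then show ?thesis by simp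
  qed
  have "(cmod z)\<^sup>2 \<le> a * b"
  proof (cases "b = 0")
    case True
    show ?thesis
    proof (rule ccontr)
      assume "\<not> ?thesis"
      then have pos: "(cmod z)\<^sup>2 > 0" using True by auto
      (* With b = 0 the quadratic is affine in t; this t makes it equal to -1. *)
      have "0 \<le> a - 2 * ((a + 1) / (2 * (cmod z)\<^sup>2)) * (cmod z)\<^sup>2"
        using expand[of "(a + 1) / (2 * (cmod z)\<^sup>2)"] True by simp
      also have "\<dots> = - 1" using pos by (simp add: field_simps)
      finally show False by simp
    qed
  next
    case False
    then have "b > 0" using ab by simp
    have "0 \<le> a - 2 * (1 / b) * (cmod z)\<^sup>2 + (1 / b)\<^sup>2 * (cmod z)\<^sup>2 * b" by (rule expand)
    also have "\<dots> = a - (cmod z)\<^sup>2 / b" using \<open>b > 0\<close> by (simp add: field_simps power2_eq_square)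
    finally show ?thesis using \<open>b > 0\<close> by (simp add: field_simps)
  qed
  then have "(cmod z)\<^sup>2 \<le> (L2_norm \<Omega> 1 u * L2_norm \<Omega> 1 v)\<^sup>2"
    by (simp add: a_def b_def power_mult_distrib)
  then show ?thesis
    unfolding z_def by (rule power2_le_imp_le) (simp add: L2_norm_nonneg)
qed

section \<open>Dilations and translations of the square\<close>

lemma square_eq_cbox: "square T = cbox (-T, -T) (T, T)"
  by (auto simp: square_def cbox_Pair_eq)

lemma square_sets_lebesgue [measurable, simp]: "square T \<in> sets lebesgue"
  by (simp add: square_eq_cbox)

lemma finite_measure_square: "finite_measure (lebesgue_on (square T))"
  by (intro finite_measureI) (simp add: emeasure_restrict_space square_eq_cbox emeasure_lborel_cbox_eq)

lemma measure_square:
  assumes "T > 0" shows "measure lebesgue (square T) = (2 * T)\<^sup>2"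
  using assms by (simp add: square_eq_cbox measure_lborel_cbox_eq Basis_prod_def power2_eq_square)

lemma lebesgue_dilation:
  fixes d :: plane
  assumes "c > 0"
  shows dilation_measurable: "(\<lambda>x. d + c *\<^sub>R x) \<in> lebesgue \<rightarrow>\<^sub>M lebesgue"
    and lebesgue_eq_dilation:
      "lebesgue = density (distr lebesgue lebesgue (\<lambda>x. d + c *\<^sub>R x)) (\<lambda>_. ennreal (c\<^sup>2))"
proof -
  have *: "d + (\<Sum>j\<in>Basis. (c * (x \<bullet> j)) *\<^sub>R j) = d + c *\<^sub>R x" for x :: plane
    by (simp add: euclidean_representation flip: scaleR_scaleR scaleR_sum_right)
  have **: "(\<Prod>j\<in>(Basis :: plane set). \<bar>c\<bar>) = c\<^sup>2" using assms by (simp add: power2_eq_square)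
  show "(\<lambda>x. d + c *\<^sub>R x) \<in> lebesgue \<rightarrow>\<^sub>M lebesgue"
    using lebesgue_affine_measurable[of "\<lambda>_. c" d] assms unfolding * by simp
  show "lebesgue = density (distr lebesgue lebesgue (\<lambda>x. d + c *\<^sub>R x)) (\<lambda>_. ennreal (c\<^sup>2))"
    using lebesgue_affine_euclidean[of "\<lambda>_. c" d] assms unfolding * ** by simp
qed

lemma translation_measurable: "(\<lambda>x::plane. x + d) \<in> lebesgue \<rightarrow>\<^sub>M lebesgue"
  using dilation_measurable[of 1 d] by (simp add: add.commute)

lemma nn_integral_translation:
  fixes F :: "plane \<Rightarrow> ennreal"
  assumes [measurable]: "F \<in> borel_measurable lebesgue"
  shows "(\<integral>\<^sup>+x. F (x + d) \<partial>lebesgue) = (\<integral>\<^sup>+x. F x \<partial>lebesgue)"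
proof -
  note [measurable] = dilation_measurable[of 1 d, simplified]
  have "(\<integral>\<^sup>+x. F x \<partial>lebesgue) = (\<integral>\<^sup>+x. F (d + 1 *\<^sub>R x) \<partial>lebesgue)"
    by (subst lebesgue_eq_dilation[of 1 d])
      (simp_all add: nn_integral_density nn_integral_distr)
  then show ?thesis by (simp add: add.commute)
qed

lemma integral_dilation:
  fixes F :: "plane \<Rightarrow> 'b::{banach, second_countable_topology}"
  assumes c: "c > 0" and [measurable]: "F \<in> borel_measurable lebesgue"
  shows "integrable lebesgue F \<longleftrightarrow> integrable lebesgue (\<lambda>x. F (c *\<^sub>R x))"
    and "(LINT x|lebesgue. F x) = c\<^sup>2 *\<^sub>R (LINT x|lebesgue. F (c *\<^sub>R x))"
proof -
  note [measurable] = dilation_measurable[OF c, of 0]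
  show "integrable lebesgue F \<longleftrightarrow> integrable lebesgue (\<lambda>x. F (c *\<^sub>R x))"
  proof -
    have "integrable lebesgue F \<longleftrightarrow> integrable lebesgue (\<lambda>x. c\<^sup>2 *\<^sub>R F (c *\<^sub>R x))"
      using c by (subst lebesgue_eq_dilation[OF c, of 0]) (simp add: integrable_density integrable_distr_eq)
    also have "\<dots> \<longleftrightarrow> integrable lebesgue (\<lambda>x. F (c *\<^sub>R x))"
      using integrable_scaleR_right[of "inverse (c\<^sup>2)" lebesgue "\<lambda>x. c\<^sup>2 *\<^sub>R F (c *\<^sub>R x)"] c by auto
    finally show ?thesis .
  qed
  show "(LINT x|lebesgue. F x) = c\<^sup>2 *\<^sub>R (LINT x|lebesgue. F (c *\<^sub>R x))"
    using c by (subst lebesgue_eq_dilation[OF c, of 0])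
      (simp add: integral_density integral_distr)
qed

lemma mem_square_scale: "c > 0 \<Longrightarrow> c *\<^sub>R r \<in> square (c * T) \<longleftrightarrow> r \<in> square T"
  using mult_le_cancel_left_pos[of c "- T"] by (cases r) (simp add: square_def)

lemma measurable_square_dilation:
  assumes c: "c > 0" and f: "f \<in> borel_measurable (lebesgue_on (square (c * T)))"
  shows "(\<lambda>r. f (c *\<^sub>R r)) \<in> borel_measurable (lebesgue_on (square T))"
proof (rule measurable_compose[OF _ f])
  show "(\<lambda>r. c *\<^sub>R r) \<in> lebesgue_on (square T) \<rightarrow>\<^sub>M lebesgue_on (square (c * T))"
    using dilation_measurable[OF c, of 0] mem_square_scale[OF c, of _ T]
    by (intro measurable_restrict_space3) auto
qed

lemma integral_square_dilation:
  fixes f :: "plane \<Rightarrow> 'b::{banach, second_countable_topology}"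
  assumes c: "c > 0" and f: "f \<in> borel_measurable (lebesgue_on (square (c * T)))"
  shows "integrable (lebesgue_on (square (c * T))) f \<longleftrightarrow>
           integrable (lebesgue_on (square T)) (\<lambda>r. f (c *\<^sub>R r))"
    and "(LINT r|lebesgue_on (square (c * T)). f r) =
           c\<^sup>2 *\<^sub>R (LINT r|lebesgue_on (square T). f (c *\<^sub>R r))"
proof -
  have m: "(\<lambda>r. indicator (square (c * T)) r *\<^sub>R f r) \<in> borel_measurable lebesgue"
    using f by (simp add: borel_measurable_restrict_space_iff)
  have ind: "indicator (square (c * T)) (c *\<^sub>R r) = (indicator (square T) r :: real)" for r
    by (simp add: indicator_def mem_square_scale[OF c])
  show "integrable (lebesgue_on (square (c * T))) f \<longleftrightarrow>
           integrable (lebesgue_on (square T)) (\<lambda>r. f (c *\<^sub>R r))"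
    using integral_dilation(1)[OF c m] by (simp add: integrable_restrict_space ind)
  show "(LINT r|lebesgue_on (square (c * T)). f r) =
           c\<^sup>2 *\<^sub>R (LINT r|lebesgue_on (square T). f (c *\<^sub>R r))"
    using integral_dilation(2)[OF c m] by (simp add: integral_restrict_space ind)
qed

lemma L2_dilation:
  assumes c: "c > 0" and u: "u \<in> L2 (square (c * T))"
  shows "(\<lambda>r. u (c *\<^sub>R r)) \<in> L2 (square T)"
  using u measurable_square_dilation[OF c, of u] integral_square_dilation(1)[OF c, of "\<lambda>r. (cmod (u r))\<^sup>2"]
  by (auto simp: L2_def)

lemma L2_dilation_iff:
  assumes c: "c > 0"
  shows "(\<lambda>r. u (c *\<^sub>R r)) \<in> L2 (square T) \<longleftrightarrow> u \<in> L2 (square (c * T))"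
proof
  assume "(\<lambda>r. u (c *\<^sub>R r)) \<in> L2 (square T)"
  then show "u \<in> L2 (square (c * T))"
    using L2_dilation[of "1 / c" "\<lambda>r. u (c *\<^sub>R r)" "c * T"] c by simp
qed (rule L2_dilation[OF c])

section \<open>Periodic functions and shifts\<close>

definition lattice_point :: "real \<Rightarrow> int \<times> int \<Rightarrow> plane" where
  "lattice_point T p = (2 * T * of_int (fst p), 2 * T * of_int (snd p))"

lemma periodic2_lattice:
  assumes "periodic2 (2 * T) f"
  shows "f (r + lattice_point T p) = f r"
proof -
  have x: "f (x + 2 * T * of_nat n, y) = f (x, y)" for x y n
  proof (induction n)
    case (Suc n)
    have "f (x + 2 * T * of_nat (Suc n), y) = f ((x + 2 * T * of_nat n) + 2 * T, y)"
      by (simp add: algebra_simps)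
    with Suc assms show ?case by (simp only: periodic2_def)
  qed simp
  have y: "f (x, y + 2 * T * of_nat n) = f (x, y)" for x y n
  proof (induction n)
    case (Suc n)
    have "f (x, y + 2 * T * of_nat (Suc n)) = f (x, (y + 2 * T * of_nat n) + 2 * T)"
      by (simp add: algebra_simps)
    with Suc assms show ?case by (simp only: periodic2_def)
  qed simp
  have x': "f (x + 2 * T * of_int j, y) = f (x, y)" for x y j
    using x[of x "nat j" y] x[of "x + 2 * T * of_int j" "nat (- j)" y] by (cases "j \<ge> 0") auto
  have y': "f (x, y + 2 * T * of_int j) = f (x, y)" for x y j
    using y[of x y "nat j"] y[of x "y + 2 * T * of_int j" "nat (- j)"] by (cases "j \<ge> 0") auto
  show ?thesis by (cases r) (simp add: lattice_point_def x' y')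
qed

text \<open>
  The closed square meets its own translates by the period lattice; the half-open one is a
  fundamental domain, and it differs from the closed one by a null set only.
\<close>
definition half_open_cell :: "real \<Rightarrow> plane set" where
  "half_open_cell T = {-T..<T} \<times> {-T..<T}"

lemma half_open_cell_borel [measurable]: "half_open_cell T \<in> sets borel"
  unfolding half_open_cell_def by (intro borel_Times) auto

lemma half_open_cell_sets [measurable]: "half_open_cell T \<in> sets lebesgue"
  using half_open_cell_borel by auto

lemma ex1_period:
  fixes x :: real
  assumes "T > 0" shows "\<exists>!k::int. x - 2 * T * of_int k \<in> {-T..<T}"
proof (rule ex1I[of _ "\<lfloor>(x + T) / (2 * T)\<rfloor>"])
  define m where "m = real_of_int \<lfloor>(x + T) / (2 * T)\<rfloor>"
  have "m \<le> (x + T) / (2 * T)" "(x + T) / (2 * T) < m + 1" unfolding m_def by linarith+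
  then have "x - 2 * T * m \<in> {-T..<T}"
    using assms by (simp add: field_simps)
  then show "x - 2 * T * of_int \<lfloor>(x + T) / (2 * T)\<rfloor> \<in> {-T..<T}"
    by (simp add: m_def)
next
  fix k :: int assume "x - 2 * T * of_int k \<in> {-T..<T}"
  then show "k = \<lfloor>(x + T) / (2 * T)\<rfloor>"
    using assms by (intro floor_unique[symmetric]) (auto simp: field_simps)
qed

lemma ex1_lattice_point:
  assumes "T > 0" shows "\<exists>!p. r - lattice_point T p \<in> half_open_cell T"
proof -
  obtain x y where r: "r = (x, y)" by (cases r)
  obtain j where j: "x - 2 * T * of_int j \<in> {-T..<T}"
    "\<And>j'. x - 2 * T * of_int j' \<in> {-T..<T} \<Longrightarrow> j' = j"
    using ex1_period[OF assms, of x] by blast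
  obtain k where k: "y - 2 * T * of_int k \<in> {-T..<T}"
    "\<And>k'. y - 2 * T * of_int k' \<in> {-T..<T} \<Longrightarrow> k' = k"
    using ex1_period[OF assms, of y] by blast
  show ?thesis
  proof (rule ex1I[of _ "(j, k)"])
    show "r - lattice_point T (j, k) \<in> half_open_cell T"
      using j(1) k(1) by (simp add: r lattice_point_def half_open_cell_def)
  next
    fix p assume p: "r - lattice_point T p \<in> half_open_cell T"
    have "fst p = j" by (rule j(2)) (use p in \<open>simp add: r lattice_point_def half_open_cell_def\<close>)
    moreover have "snd p = k" by (rule k(2)) (use p in \<open>simp add: r lattice_point_def half_open_cell_def\<close>)
    ultimately show "p = (j, k)" by (simp add: prod_eq_iff)
  qed
qed

lemma lattice_partition_of_unity:
  assumes "T > 0"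
  shows "(\<integral>\<^sup>+p. indicator (half_open_cell T) (r - lattice_point T p) \<partial>count_space UNIV) = (1::ennreal)"
proof -
  obtain p where p: "r - lattice_point T p \<in> half_open_cell T"
      "\<And>q. r - lattice_point T q \<in> half_open_cell T \<Longrightarrow> q = p"
    using ex1_lattice_point[OF assms, of r] by auto
  have "r - lattice_point T q \<in> half_open_cell T \<longleftrightarrow> q \<in> {p}" for q
    using p by blast
  then have "indicator (half_open_cell T) (r - lattice_point T q) = (indicator {p} q :: ennreal)" for q
    by (simp add: indicator_def)
  then show ?thesis by simp
qed

lemma lattice_point_uminus: "lattice_point T (- p) = - lattice_point T p"
  by (cases p) (simp add: lattice_point_def)

text \<open>
  Both cells are fundamental domains of the period lattice. Cut the shifted cell into its
  intersections with the lattice translates of the cell and move each piece back by a lattice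
  vector, which does not change \<open>F\<close>; the pieces then tile the cell.
\<close>
lemma nn_integral_cell_shift:
  fixes F :: "plane \<Rightarrow> ennreal"
  assumes T: "T > 0" and F [measurable]: "F \<in> borel_measurable lebesgue"
    and per: "\<And>r p. F (r + lattice_point T p) = F r"
  shows "(\<integral>\<^sup>+r. F (r + d) * indicator (half_open_cell T) r \<partial>lebesgue)
       = (\<integral>\<^sup>+r. F r * indicator (half_open_cell T) r \<partial>lebesgue)"
proof -
  let ?Q = "half_open_cell T"
  have ind [measurable]: "(\<lambda>r. indicator ?Q (r + a) :: ennreal) \<in> borel_measurable lebesgue" for a
    using measurable_compose[OF translation_measurable[of a] borel_measurable_indicator[OF half_open_cell_sets[of T]]]
    by simp
  have ind' [measurable]: "(\<lambda>r. indicator ?Q (r - a) :: ennreal) \<in> borel_measurable lebesgue" for a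
    using ind[of "- a"] by simp
  have "(\<integral>\<^sup>+r. F (r + d) * indicator ?Q r \<partial>lebesgue)
      = (\<integral>\<^sup>+r. F r * indicator ?Q (r - d) \<partial>lebesgue)"
    using nn_integral_translation[of "\<lambda>r. F r * indicator ?Q (r - d)" d] by simp
  also have "\<dots> = (\<integral>\<^sup>+r. \<integral>\<^sup>+p. F r * indicator ?Q (r - d) * indicator ?Q (r - lattice_point T p)
                   \<partial>count_space UNIV \<partial>lebesgue)"
    by (simp add: nn_integral_cmult lattice_partition_of_unity[OF T])
  also have "\<dots> = (\<integral>\<^sup>+p. \<integral>\<^sup>+r. F r * indicator ?Q (r - d) * indicator ?Q (r - lattice_point T p)
                   \<partial>lebesgue \<partial>count_space UNIV)"
    by (rule nn_integral_count_space_nn_integral) auto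
  also have "\<dots> = (\<integral>\<^sup>+p. \<integral>\<^sup>+r. F r * indicator ?Q (r - (d - lattice_point T p)) * indicator ?Q r
                   \<partial>lebesgue \<partial>count_space UNIV)"
  proof (rule nn_integral_cong)
    fix p
    show "(\<integral>\<^sup>+r. F r * indicator ?Q (r - d) * indicator ?Q (r - lattice_point T p) \<partial>lebesgue)
        = (\<integral>\<^sup>+r. F r * indicator ?Q (r - (d - lattice_point T p)) * indicator ?Q r \<partial>lebesgue)"
      using nn_integral_translation[of "\<lambda>r. F r * indicator ?Q (r - d) * indicator ?Q (r - lattice_point T p)"
          "lattice_point T p"]
      by (simp add: per algebra_simps)
  qed
  also have "\<dots> = (\<integral>\<^sup>+r. \<integral>\<^sup>+p. F r * indicator ?Q (r - (d - lattice_point T p)) * indicator ?Q r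
                   \<partial>count_space UNIV \<partial>lebesgue)"
    by (rule nn_integral_count_space_nn_integral[symmetric]) auto
  also have "\<dots> = (\<integral>\<^sup>+r. F r * indicator ?Q r \<partial>lebesgue)"
  proof (rule nn_integral_cong)
    fix r :: plane
    have "(\<integral>\<^sup>+p. indicator ?Q (r - (d - lattice_point T p)) \<partial>count_space UNIV)
        = (\<integral>\<^sup>+p. indicator ?Q (r - d - lattice_point T p) \<partial>count_space UNIV)"
      by (subst nn_integral_bij_count_space[of uminus UNIV UNIV, symmetric])
        (auto simp: lattice_point_uminus bij_uminus algebra_simps)
    also have "\<dots> = (1::ennreal)" by (rule lattice_partition_of_unity[OF T])
    finally show "(\<integral>\<^sup>+p. F r * indicator ?Q (r - (d - lattice_point T p)) * indicator ?Q r
                   \<partial>count_space UNIV) = F r * indicator ?Q r"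
      by (simp add: nn_integral_cmult nn_integral_multc)
  qed
  finally show ?thesis .
qed

lemma nn_integral_square_eq_cell:
  fixes F :: "plane \<Rightarrow> ennreal"
  shows "(\<integral>\<^sup>+r. F r \<partial>lebesgue_on (square T)) = (\<integral>\<^sup>+r. F r * indicator (half_open_cell T) r \<partial>lebesgue)"
proof -
  have "AE r in lebesgue. F r * indicator (square T) r = F r * indicator (half_open_cell T) r"
  proof (rule AE_I')
    show "square T - box (-T, -T) (T, T) \<in> null_sets lebesgue"
      using negligible_frontier_interval[of "(-T, -T)" "(T, T)"]
      by (simp add: negligible_iff_null_sets square_eq_cbox)
    show "{r \<in> space lebesgue. \<not> F r * indicator (square T) r = F r * indicator (half_open_cell T) r}
          \<subseteq> square T - box (-T, -T) (T, T)"
      by (auto simp: square_def half_open_cell_def mem_box Basis_prod_def indicator_def split: if_splits)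
  qed
  then show ?thesis
    unfolding nn_integral_restrict_space[of "square T" lebesgue, simplified]
    by (rule nn_integral_cong_AE)
qed

text \<open>
  A preimage is the union of countably many lattice translates of its part in the square. This is
  needed because the elements of \<open>Hs\<close> are only assumed to be measurable on one period square, whereas the
  operator evaluates them on shifted squares.
\<close>
lemma periodic2_measurable:
  fixes f :: "plane \<Rightarrow> complex"
  assumes T: "T > 0" and per: "periodic2 (2 * T) f"
    and f: "f \<in> borel_measurable (lebesgue_on (square T))"
  shows "f \<in> borel_measurable lebesgue"
proof (rule measurableI)
  fix U :: "complex set" assume U: "U \<in> sets borel"
  have "f -` U \<inter> square T \<in> sets (lebesgue_on (square T))"
    using measurable_sets[OF f U] by simp
  then have A: "f -` U \<inter> square T \<in> sets lebesgue"
    by (simp add: sets_restrict_space_iff)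
  have "f -` U = (\<Union>p. (\<lambda>r. lattice_point T p + r) ` (f -` U \<inter> square T))"
  proof (intro set_eqI iffI)
    fix r assume r: "r \<in> f -` U"
    obtain p where p: "r - lattice_point T p \<in> half_open_cell T" using ex1_lattice_point[OF T, of r] by blast
    then have "r - lattice_point T p \<in> square T" by (auto simp: square_def half_open_cell_def)
    moreover have "f (r - lattice_point T p) = f r"
      using periodic2_lattice[OF per, of "r - lattice_point T p" p] by simp
    ultimately have "r - lattice_point T p \<in> f -` U \<inter> square T" using r by simp
    then have "lattice_point T p + (r - lattice_point T p) \<in> (\<lambda>r. lattice_point T p + r) ` (f -` U \<inter> square T)"
      by (rule imageI)
    then have "r \<in> (\<lambda>r. lattice_point T p + r) ` (f -` U \<inter> square T)"
      by (simp only: add_diff_eq add_diff_cancel_left')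
    then show "r \<in> (\<Union>p. (\<lambda>r. lattice_point T p + r) ` (f -` U \<inter> square T))"
      by (rule UN_I[OF UNIV_I])
  next
    fix r assume "r \<in> (\<Union>p. (\<lambda>r. lattice_point T p + r) ` (f -` U \<inter> square T))"
    then show "r \<in> f -` U" using periodic2_lattice[OF per] by (auto simp: add.commute)
  qed
  also have "\<dots> \<in> sets lebesgue"
    by (intro sets.countable_UN') (auto intro: lebesgue_sets_translation[OF A])
  finally show "f -` U \<inter> space lebesgue \<in> sets lebesgue" by simp
qed auto

text \<open>
  The factor \<open>H\<close> selects a nonnegative quantity such as the norm, or the positive part of the real
  part, to which \<open>nn_integral_cell_shift\<close> applies.
\<close>
lemma nn_integral_square_shift:
  fixes f :: "plane \<Rightarrow> complex" and H :: "complex \<Rightarrow> ennreal"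
  assumes T: "T > 0" and per: "periodic2 (2 * T) f"
    and f: "f \<in> borel_measurable (lebesgue_on (square T))" and H: "H \<in> borel_measurable borel"
  shows "(\<integral>\<^sup>+r. H (f (r + d)) \<partial>lebesgue_on (square T)) = (\<integral>\<^sup>+r. H (f r) \<partial>lebesgue_on (square T))"
  unfolding nn_integral_square_eq_cell
  by (rule nn_integral_cell_shift[OF T, of "\<lambda>r. H (f r)"])
    (use measurable_compose[OF periodic2_measurable[OF T per f] H] periodic2_lattice[OF per] in auto)

text \<open>
  The real and imaginary parts of \<open>f\<close> are differences of nonnegative functions, for which the
  invariance is \<open>nn_integral_square_shift\<close>.
\<close>
lemma integral_square_shift:
  fixes f :: "plane \<Rightarrow> complex"
  assumes T: "T > 0" and per: "periodic2 (2 * T) f"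
    and int: "integrable (lebesgue_on (square T)) f"
  shows "integrable (lebesgue_on (square T)) (\<lambda>r. f (r + d))"
    and "(LINT r|lebesgue_on (square T). f (r + d)) = (LINT r|lebesgue_on (square T). f r)"
proof -
  have f: "f \<in> borel_measurable (lebesgue_on (square T))" using int by auto
  note fL = periodic2_measurable[OF T per f]
  have fd: "(\<lambda>r. f (r + d)) \<in> borel_measurable lebesgue"
    by (rule measurable_compose[OF translation_measurable fL])
  note shift = nn_integral_square_shift[OF T per f, of _ d]
  show int': "integrable (lebesgue_on (square T)) (\<lambda>r. f (r + d))"
    using int shift[of "\<lambda>z. ennreal (norm z)"] measurable_restrict_space1[OF fd]
    by (simp add: integrable_iff_bounded)
  have real_part: "(LINT r|lebesgue_on (square T). l (f (r + d))) = (LINT r|lebesgue_on (square T). l (f r))"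
    if l: "bounded_linear l" for l :: "complex \<Rightarrow> real"
  proof -
    have [measurable]: "l \<in> borel_measurable borel"
      using l by (intro borel_measurable_continuous_onI linear_continuous_on)
    show ?thesis
      using integrable_bounded_linear[OF l int] integrable_bounded_linear[OF l int']
        shift[of "\<lambda>z. ennreal (l z)"] shift[of "\<lambda>z. ennreal (- l z)"]
      by (simp add: real_lebesgue_integral_def)
  qed
  show "(LINT r|lebesgue_on (square T). f (r + d)) = (LINT r|lebesgue_on (square T). f r)"
    using real_part[OF bounded_linear_Re] real_part[OF bounded_linear_Im] int int'
    by (intro complex_eqI) (simp_all flip: integral_Re integral_Im)
qed

lemma L2_shift:
  assumes T: "T > 0" and per: "periodic2 (2 * T) f" and f: "f \<in> L2 (square T)"
  shows "(\<lambda>r. f (r + d)) \<in> L2 (square T)"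
proof -
  have m: "f \<in> borel_measurable (lebesgue_on (square T))" using f by (simp add: L2_def)
  have fd: "(\<lambda>r. f (r + d)) \<in> borel_measurable (lebesgue_on (square T))"
    by (intro measurable_restrict_space1 measurable_compose[OF translation_measurable]
        periodic2_measurable[OF T per m])
  have "integrable (lebesgue_on (square T)) (\<lambda>r. f r * cnj (f r))"
    by (rule L2_integrable_mult_cnj[OF f f])
  moreover have "periodic2 (2 * T) (\<lambda>r. f r * cnj (f r))" using per by (simp add: periodic2_def)
  ultimately have "integrable (lebesgue_on (square T)) (\<lambda>r. f (r + d) * cnj (f (r + d)))"
    using integral_square_shift(1)[OF T] by blast
  then have "integrable (lebesgue_on (square T)) (\<lambda>r. Re (f (r + d) * cnj (f (r + d))))"
    by (rule integrable_Re)
  then show ?thesis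
    using fd by (simp add: L2_def complex_norm_square[symmetric] del: of_real_power)
qed

section \<open>The exponentials are orthonormal\<close>

lemma w_add: "T > 0 \<Longrightarrow> w T p (r + d) = complex_of_real (2 * T) * w T p r * w T p d"
  by (cases p; cases r; cases d) (simp add: w_def exp_add[symmetric] algebra_simps add_divide_distrib)

lemma cmod_w: "T > 0 \<Longrightarrow> cmod (w T p r) = 1 / (2 * T)"
  by (cases p; cases r) (simp add: w_def norm_mult norm_divide)

lemma cnj_w: "cnj (w T p r) = w T (- p) r"
proof -
  obtain j k x y where p: "p = (j, k)" "r = (x, y)" by (cases p; cases r)
  have "pi / T * (of_int (- j) * x + of_int (- k) * y) = - (pi / T * (of_int j * x + of_int k * y))"
    by (simp add: algebra_simps)
  moreover define \<theta> where "\<theta> = pi / T * (of_int j * x + of_int k * y)"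
  ultimately have "w T p r = complex_of_real (1 / (2 * T)) * exp (\<i> * complex_of_real \<theta>)"
      "w T (- p) r = complex_of_real (1 / (2 * T)) * exp (\<i> * complex_of_real (- \<theta>))"
    by (simp_all only: p uminus_Pair w_def prod.case)
  then show ?thesis by (simp add: exp_cnj)
qed

lemma w_mult: "T > 0 \<Longrightarrow> w T p r * w T q r = complex_of_real (1 / (2 * T)) * w T (p + q) r"
  by (cases p; cases q; cases r)
    (simp add: w_def exp_add[symmetric] algebra_simps add_divide_distrib)

lemma w_zero: "w T 0 r = complex_of_real (1 / (2 * T))"
  by (cases r) (simp add: w_def zero_prod_def)

lemma periodic2_w:
  assumes "T > 0" shows "periodic2 (2 * T) (w T p)"
proof -
  obtain j k where p: "p = (j, k)" by (cases p)
  have e: "exp (\<i> * complex_of_real (pi / T * (of_int m * (2 * T)))) = 1" for m :: int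
  proof -
    have "exp (\<i> * complex_of_real (pi / T * (of_int m * (2 * T)))) = exp ((2 * of_int m * pi) * \<i>)"
      using assms by (simp add: field_simps)
    also have "\<dots> = 1" by (rule exp_integer_2pi) simp
    finally show ?thesis .
  qed
  have "w T p (2 * T, 0) = complex_of_real (1 / (2 * T))" "w T p (0, 2 * T) = complex_of_real (1 / (2 * T))"
    unfolding p w_def using e[of j] e[of k] assms by simp_all
  then show ?thesis
    using w_add[OF assms, of p "(x, y)" "(2 * T, 0)" for x y] w_add[OF assms, of p "(x, y)" "(0, 2 * T)" for x y] assms
    by (simp add: periodic2_def)
qed

lemma continuous_on_w: "continuous_on S (w T p)"
  unfolding w_def case_prod_unfold by (intro continuous_intros)

lemma continuous_imp_L2_square:
  assumes "continuous_on UNIV f" shows "f \<in> L2 (square T)"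
proof -
  have m: "f \<in> borel_measurable (lebesgue_on (square T))"
    using assms by (intro continuous_imp_measurable_on_sets_lebesgue) (auto intro: continuous_on_subset)
  have "compact (f ` square T)"
    using assms by (intro compact_continuous_image) (auto intro: continuous_on_subset simp: square_eq_cbox)
  then obtain B where B: "\<And>r. r \<in> square T \<Longrightarrow> norm (f r) \<le> B"
    by (meson bounded_iff compact_imp_bounded imageI)
  have "integrable (lebesgue_on (square T)) (\<lambda>r. (cmod (f r))\<^sup>2)"
  proof (rule finite_measure.integrable_const_bound[OF finite_measure_square, where B = "B\<^sup>2"])
    show "AE r in lebesgue_on (square T). norm ((cmod (f r))\<^sup>2) \<le> B\<^sup>2"
      by (rule AE_I2) (use B in \<open>auto intro!: power_mono\<close>)
  qed (use m in measurable)
  with m show ?thesis by (simp add: L2_def)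
qed

lemma w_L2: "w T p \<in> L2 (square T)"
  by (rule continuous_imp_L2_square[OF continuous_on_w])

text \<open>
  Shifting by a \<open>d\<close> with \<open>exp (\<i> \<pi>/T (p \<bullet> d)) = -1\<close> reverses the sign of a nonconstant exponential,
  while the integral over a period square is invariant under shifts; so the integral vanishes.
\<close>
lemma integral_w:
  assumes T: "T > 0"
  shows "(LINT r|lebesgue_on (square T). w T p r) = (if p = 0 then complex_of_real (2 * T) else 0)"
proof (cases "p = 0")
  case True
  then show ?thesis
    using T by (simp add: w_zero measure_restrict_space measure_square power2_eq_square scaleR_conv_of_real)
next
  case False
  interpret finite_measure "lebesgue_on (square T)" by (rule finite_measure_square)
  have int: "integrable (lebesgue_on (square T)) (w T p)"
    by (rule integrable_const_bound[where B = "1 / (2 * T)"])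
      (use L2_measurable[OF w_L2] cmod_w[OF T] in auto)
  obtain d where d: "w T p d = - complex_of_real (1 / (2 * T))"
  proof -
    obtain j k where p: "p = (j, k)" by (cases p)
    have jk: "j \<noteq> 0 \<or> k \<noteq> 0" using False p by (auto simp: zero_prod_def)
    show ?thesis
    proof (cases "j = 0")
      case False
      then show ?thesis using T by (intro that[of "(T / of_int j, 0)"]) (simp add: p w_def mult.commute[of \<i>])
    next
      case True
      with jk show ?thesis using T by (intro that[of "(0, T / of_int k)"]) (simp add: p w_def mult.commute[of \<i>])
    qed
  qed
  have "(LINT r|lebesgue_on (square T). w T p r) = (LINT r|lebesgue_on (square T). w T p (r + d))"
    by (rule integral_square_shift(2)[OF T periodic2_w[OF T] int, symmetric])
  also have "\<dots> = - (LINT r|lebesgue_on (square T). w T p r)"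
    using T by (simp add: w_add[OF T] d)
  finally show ?thesis using False by simp
qed

lemma w_orthonormal:
  assumes T: "T > 0"
  shows "L2_inner (square T) 1 (w T p) (w T q) = (if p = q then 1 else 0)"
proof -
  have "w T p r * cnj (w T q r) = complex_of_real (1 / (2 * T)) * w T (p - q) r" for r
    using w_mult[OF T, of p r "- q"] by (simp add: cnj_w)
  then have "L2_inner (square T) 1 (w T p) (w T q) =
      complex_of_real (1 / (2 * T)) * (LINT r|lebesgue_on (square T). w T (p - q) r)"
    by (simp add: L2_inner_def)
  then show ?thesis using T integral_w[OF T, of "p - q"] by simp
qed

section \<open>The exponentials are total\<close>

text \<open>
  Closure under products makes this class contain every polynomial in the two coordinate functions
  \<open>exp (\<i> \<pi> x/T)\<close>, \<open>exp (\<i> \<pi> y/T)\<close> of the torus and their conjugates, to which the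
  Stone-Weierstrass theorem on the torus applies.
\<close>
inductive trigonometric_polynomial :: "real \<Rightarrow> (plane \<Rightarrow> complex) \<Rightarrow> bool" for T where
  monomial: "trigonometric_polynomial T (\<lambda>r. a * w T p r)"
| add: "trigonometric_polynomial T f \<Longrightarrow> trigonometric_polynomial T g \<Longrightarrow>
          trigonometric_polynomial T (\<lambda>r. f r + g r)"

lemma trigonometric_polynomial_scale:
  "trigonometric_polynomial T f \<Longrightarrow> trigonometric_polynomial T (\<lambda>r. a * f r)"
proof (induction rule: trigonometric_polynomial.induct)
  case (monomial b p)
  then show ?case using trigonometric_polynomial.monomial[of T "a * b" p] by (simp add: mult.assoc)
next
  case (add f g)
  then show ?case using trigonometric_polynomial.add by (fastforce simp: ring_distribs)
qed

lemma trigonometric_polynomial_const: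
  assumes "T > 0" shows "trigonometric_polynomial T (\<lambda>r. a)"
  using trigonometric_polynomial.monomial[of T "a * complex_of_real (2 * T)" 0] assms
  by (simp add: w_zero)

lemma trigonometric_polynomial_mult:
  assumes T: "T > 0" and f: "trigonometric_polynomial T f" and g: "trigonometric_polynomial T g"
  shows "trigonometric_polynomial T (\<lambda>r. f r * g r)"
  using f
proof (induction rule: trigonometric_polynomial.induct)
  case (monomial a p)
  show ?case using g
  proof (induction rule: trigonometric_polynomial.induct)
    case (monomial b q)
    have "(a * w T p r) * (b * w T q r) = (a * b * complex_of_real (1 / (2 * T))) * w T (p + q) r" for r
      using w_mult[OF T, of p r q] by (metis (no_types, lifting) mult.assoc mult.left_commute)
    then show ?case using trigonometric_polynomial.monomial[of T _ "p + q"] by presburger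
  next
    case (add f g)
    then show ?case using trigonometric_polynomial.add by (fastforce simp: ring_distribs)
  qed
next
  case (add f1 f2)
  then show ?case using trigonometric_polynomial.add by (fastforce simp: ring_distribs)
qed

definition torus_map :: "real \<Rightarrow> plane \<Rightarrow> complex \<times> complex" where
  "torus_map T r = (cis (pi / T * fst r), cis (pi / T * snd r))"

lemma torus_map_eq_w:
  "T > 0 \<Longrightarrow> torus_map T r =
     (complex_of_real (2 * T) * w T (1, 0) r, complex_of_real (2 * T) * w T (0, 1) r)"
  by (cases r) (simp add: torus_map_def w_def cis_conv_exp)

lemma trigonometric_polynomial_real_polynomial:
  assumes T: "T > 0" and q: "real_polynomial_function q"
  shows "trigonometric_polynomial T (\<lambda>r. complex_of_real (q (torus_map T r)))"
  using q
proof (induction rule: real_polynomial_function.induct)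
  case (linear f)
  define z1 z2 where "z1 r = complex_of_real (2 * T) * w T (1, 0) r"
    and "z2 r = complex_of_real (2 * T) * w T (0, 1) r" for r
  have z: "trigonometric_polynomial T z1" "trigonometric_polynomial T z2"
    unfolding z1_def z2_def by (intro trigonometric_polynomial.monomial)+
  have z': "trigonometric_polynomial T (\<lambda>r. cnj (z1 r))" "trigonometric_polynomial T (\<lambda>r. cnj (z2 r))"
    unfolding z1_def z2_def complex_cnj_mult cnj_w by (intro trigonometric_polynomial.monomial)+
  interpret bounded_linear f by fact
  have lin: "f (a, b) = Re a * f (1, 0) + Im a * f (\<i>, 0) + (Re b * f (0, 1) + Im b * f (0, \<i>))" for a b
  proof -
    have "(a, b) = Re a *\<^sub>R (1, 0) + Im a *\<^sub>R (\<i>, 0) + (Re b *\<^sub>R (0, 1) + Im b *\<^sub>R (0, \<i>))"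
      by (simp add: complex_eq_iff)
    then show ?thesis by (simp only: add scaleR) simp
  qed
  have eq: "complex_of_real (f (torus_map T r)) =
      (complex_of_real (f (1, 0)) / 2 * (z1 r + cnj (z1 r)) + complex_of_real (f (\<i>, 0)) / (2 * \<i>) * (z1 r + (-1) * cnj (z1 r))) +
      (complex_of_real (f (0, 1)) / 2 * (z2 r + cnj (z2 r)) + complex_of_real (f (0, \<i>)) / (2 * \<i>) * (z2 r + (-1) * cnj (z2 r)))" for r
  proof -
    have "torus_map T r = (z1 r, z2 r)" by (simp add: torus_map_eq_w[OF T] z1_def z2_def)
    moreover have "complex_of_real (Re a * b) = complex_of_real b / 2 * (a + cnj a)" for a b
      by (simp add: complex_add_cnj)
    moreover have "complex_of_real (Im a * b) = complex_of_real b / (2 * \<i>) * (a + (-1) * cnj a)" for a b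
    proof -
      have "a + (-1) * cnj a = (2 * \<i>) * complex_of_real (Im a)" by (simp add: complex_eq_iff)
      moreover have cancel: "c / d * (d * y) = c * y" if "d \<noteq> 0" for c d y :: complex using that by simp
      have "complex_of_real b / (2 * \<i>) * ((2 * \<i>) * complex_of_real (Im a)) =
          complex_of_real b * complex_of_real (Im a)" by (rule cancel) simp
      ultimately show ?thesis by (metis of_real_mult mult.commute)
    qed
    ultimately show ?thesis using lin[of "z1 r" "z2 r"] by (simp only: of_real_add)
  qed
  show ?case
    unfolding eq
    by (intro trigonometric_polynomial.add trigonometric_polynomial_scale z z')
next
  case (const c)
  show ?case by (rule trigonometric_polynomial_const[OF T])
next
  case (add f g)
  then show ?case using trigonometric_polynomial.add by fastforce
next
  case (mult f g)
  then show ?case using trigonometric_polynomial_mult[OF T] by fastforce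
qed

lemma trigonometric_polynomial_polynomial_function:
  fixes g :: "complex \<times> complex \<Rightarrow> complex"
  assumes T: "T > 0" and g: "polynomial_function g"
  shows "trigonometric_polynomial T (\<lambda>r. g (torus_map T r))"
proof -
  have "real_polynomial_function (\<lambda>z. Re (g z))" "real_polynomial_function (\<lambda>z. Im (g z))"
    using g bounded_linear_Re bounded_linear_Im by (auto simp: polynomial_function_def o_def)
  then have "trigonometric_polynomial T
      (\<lambda>r. complex_of_real (Re (g (torus_map T r))) + \<i> * complex_of_real (Im (g (torus_map T r))))"
    by (intro trigonometric_polynomial.add trigonometric_polynomial_scale
        trigonometric_polynomial_real_polynomial[OF T])
  then show ?thesis by (simp flip: complex_eq)
qed

text \<open>
  The torus map glues points of the boundary of the square and no others, so a function on the square
  that vanishes on the boundary is compatible with the gluing.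
\<close>
lemma torus_map_eq_imp:
  assumes T: "T > 0" and r: "r \<in> square T" and r': "r' \<in> square T" and eq: "torus_map T r = torus_map T r'"
  shows "r = r' \<or> (\<forall>q\<in>{r, r'}. \<bar>fst q\<bar> = T \<or> \<bar>snd q\<bar> = T)"
proof -
  have *: "x = x' \<or> \<bar>x\<bar> = T \<and> \<bar>x'\<bar> = T"
    if c: "cis (pi / T * x) = cis (pi / T * x')" and x: "-T \<le> x" "x \<le> T" "-T \<le> x'" "x' \<le> T" for x x'
  proof -
    have "cis (pi / T * x - pi / T * x') = 1"
      using c by (simp flip: cis_divide)
    then have "cos (pi / T * x - pi / T * x') = 1" by (metis cis.simps(1) one_complex.simps(1))
    then obtain n :: int where n: "pi / T * x - pi / T * x' = of_int n * 2 * pi"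
      by (auto simp: cos_one_2pi_int)
    then have "pi * (x - x') = pi * (of_int n * 2 * T)"
      using T by (simp add: field_simps)
    then have d: "x - x' = of_int n * (2 * T)" by simp
    have "\<bar>x - x'\<bar> \<le> 2 * T" using x by linarith
    then have "\<bar>of_int n\<bar> * (2 * T) \<le> 1 * (2 * T)"
      using T unfolding d by (simp add: abs_mult)
    then have "\<bar>of_int n :: real\<bar> \<le> 1" using T by (simp add: mult_le_cancel_right)
    then have "\<bar>n\<bar> \<le> 1" by linarith
    then have "n = 0 \<or> n = 1 \<or> n = -1" by linarith
    then show ?thesis using d x T by auto
  qed
  obtain x y x' y' where rr: "r = (x, y)" "r' = (x', y')" by (cases r; cases r')
  have "x = x' \<or> \<bar>x\<bar> = T \<and> \<bar>x'\<bar> = T" "y = y' \<or> \<bar>y\<bar> = T \<and> \<bar>y'\<bar> = T"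
    by (rule *; use eq r r' in \<open>simp add: rr torus_map_def square_def\<close>)+
  then show ?thesis by (auto simp: rr)
qed

lemma L2_square_imp_integrable:
  assumes "f \<in> L2 (square T)" shows "integrable (lebesgue_on (square T)) f"
  using L2_integrable_mult_cnj[OF assms continuous_imp_L2_square[of "\<lambda>_. 1"]] by simp

text \<open>
  Such an \<open>h\<close> descends to a continuous function \<open>G\<close> on the compact torus, the torus being a
  topological quotient of the square. By Stone-Weierstrass \<open>G\<close> is a uniform limit of polynomials,
  hence \<open>h\<close> is on the square a uniform limit of trigonometric polynomials, and these are
  annihilated by \<open>f\<close>.
\<close>
lemma integral_mult_continuous_eq_0:
  assumes T: "T > 0" and f: "f \<in> L2 (square T)"
    and coeffs: "\<And>p. L2_inner (square T) 1 f (w T p) = 0"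
    and h: "continuous_on UNIV h"
    and bd: "\<And>r. r \<in> square T \<Longrightarrow> \<bar>fst r\<bar> = T \<or> \<bar>snd r\<bar> = T \<Longrightarrow> h r = 0"
  shows "(LINT r|lebesgue_on (square T). f r * h r) = 0"
proof -
  let ?M = "lebesgue_on (square T)"
  have mult: "integrable ?M (\<lambda>r. f r * t r)" if "continuous_on UNIV t" for t
    using L2_integrable_mult_cnj[OF f continuous_imp_L2_square[of "\<lambda>r. cnj (t r)"]] that
    by (simp add: continuous_intros)
  have trig: "continuous_on UNIV t \<and> (LINT r|?M. f r * t r) = 0" if "trigonometric_polynomial T t" for t
    using that
  proof (induction rule: trigonometric_polynomial.induct)
    case (monomial a p)
    have "(LINT r|?M. f r * (a * w T p r)) = a * L2_inner (square T) 1 f (w T (- p))"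
      by (simp add: L2_inner_def cnj_w mult.left_commute)
    then show ?case by (auto simp: coeffs intro!: continuous_intros continuous_on_w)
  next
    case (add t1 t2)
    then show ?case by (auto simp: ring_distribs mult intro!: continuous_intros)
  qed
  define S where "S = torus_map T ` square T"
  have cont: "continuous_on (square T) (torus_map T)"
    unfolding torus_map_def by (intro continuous_intros)
  have "compact (square T)" by (simp add: square_eq_cbox)
  then have S: "compact S" unfolding S_def using cont by (intro compact_continuous_image)
  have "quotient_map (top_of_set (square T)) (top_of_set S) (torus_map T)"
    using cont \<open>compact (square T)\<close>
    by (intro T1_Spaces.continuous_imp_quotient_map)
      (auto simp: S_def compact_space_subtopology compactin_euclidean_iff Hausdorff_space_subtopology)
  moreover have "continuous_map (top_of_set (square T)) euclidean h"
    using h by (auto intro: continuous_on_subset)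
  ultimately obtain G where G: "continuous_map (top_of_set S) euclidean G"
    "\<And>r. r \<in> square T \<Longrightarrow> G (torus_map T r) = h r"
  proof (rule quotient_map_lift_exists)
    fix x y
    assume "x \<in> topspace (top_of_set (square T))" "y \<in> topspace (top_of_set (square T))"
      "torus_map T x = torus_map T y"
    then show "h x = h y"
      using torus_map_eq_imp[OF T, of x y] bd[of x] bd[of y] by auto
  qed auto
  let ?I = "LINT r|?M. norm (f r)"
  have fi: "integrable ?M (\<lambda>r. norm (f r))" using L2_square_imp_integrable[OF f] by simp
  have "cmod (LINT r|?M. f r * h r) \<le> e * ?I" if e: "e > 0" for e
  proof -
    obtain g where g: "polynomial_function g" "\<And>z. z \<in> S \<Longrightarrow> norm (G z - g z) < e"
      using Stone_Weierstrass_polynomial_function[OF S _ e, of G] G(1) by auto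
    let ?t = "\<lambda>r. g (torus_map T r)"
    have t: "continuous_on UNIV ?t" "(LINT r|?M. f r * ?t r) = 0"
      using trig[OF trigonometric_polynomial_polynomial_function[OF T g(1)]] by auto
    have "(LINT r|?M. f r * h r) = (LINT r|?M. f r * (h r - ?t r))"
      using t(2) by (simp add: ring_distribs mult[OF h] mult[OF t(1)])
    also have "cmod \<dots> \<le> (LINT r|?M. norm (f r * (h r - ?t r)))"
      by (rule integral_norm_bound)
    also have "\<dots> \<le> (LINT r|?M. e * norm (f r))"
    proof (rule integral_mono)
      show "integrable ?M (\<lambda>r. norm (f r * (h r - ?t r)))"
        by (intro integrable_norm mult continuous_on_diff h t(1))
      show "integrable ?M (\<lambda>r. e * norm (f r))" using fi by simp
      fix r assume "r \<in> space ?M"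
      then have "r \<in> square T" by simp
      then have "norm (h r - ?t r) \<le> e" using g(2)[of "torus_map T r"] G(2)[of r] by (simp add: S_def less_imp_le)
      then show "norm (f r * (h r - ?t r)) \<le> e * norm (f r)"
        unfolding norm_mult by (subst mult.commute) (rule mult_right_mono, auto)
    qed
    also have "\<dots> = e * ?I" by simp
    finally show ?thesis .
  qed
  moreover have "?I \<ge> 0" by simp
  ultimately have "cmod (LINT r|?M. f r * h r) \<le> 0 + e" if "e > 0" for e
  proof -
    have frac: "x \<ge> 0 \<Longrightarrow> e / (x + 1) * x \<le> e" for x :: real
      using that by (simp add: field_simps)
    have "cmod (LINT r|?M. f r * h r) \<le> e / (?I + 1) * ?I"
      using \<open>?I \<ge> 0\<close> by (intro \<open>\<And>e. e > 0 \<Longrightarrow> cmod (LINT r|?M. f r * h r) \<le> e * ?I\<close> divide_pos_pos that add_nonneg_pos zero_less_one)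
    also have "\<dots> \<le> e" by (rule frac) fact
    finally show ?thesis by simp
  qed
  then have "cmod (LINT r|?M. f r * h r) \<le> 0" by (rule field_le_epsilon)
  then show ?thesis by simp
qed

text \<open>
  A measurable \<open>f\<close> is almost everywhere a limit of continuous functions \<open>g n\<close>. The test functions
  \<open>h n\<close> approximate the conjugate of \<open>f / max 1 \<bar>f\<bar>\<close>: the factor \<open>\<kappa>\<close> is a continuous
  cutoff that makes them vanish on the boundary, and dividing by \<open>max 1 \<bar>f\<bar>\<close> keeps them bounded by
  1, so that dominated convergence applies. In the limit the integral of \<open>\<bar>f\<bar>\<^sup>2 / max 1 \<bar>f\<bar>\<close>
  vanishes.
\<close>
lemma w_total:
  assumes T: "T > 0" and f: "f \<in> L2 (square T)"
    and coeffs: "\<And>p. L2_inner (square T) 1 f (w T p) = 0"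
  shows "AE r in lebesgue_on (square T). f r = 0"
proof -
  let ?M = "lebesgue_on (square T)"
  have fm [measurable]: "f \<in> borel_measurable ?M" using f by (simp add: L2_def)
  obtain N g where N: "negligible N" and g: "\<And>n::nat. continuous_on UNIV (g n)"
      and lim: "\<And>r. r \<notin> N \<Longrightarrow> (\<lambda>n. g n r) \<longlonglongrightarrow> (if r \<in> square T then f r else 0)"
    using fm measurable_on_iff_borel_measurable[OF square_sets_lebesgue, of f T]
    unfolding measurable_on_def by metis
  define \<kappa> where "\<kappa> n x = min 1 (real n * max 0 (T - \<bar>x\<bar>))" for n :: nat and x
  define \<eta> where "\<eta> z = cnj z / complex_of_real (max 1 (cmod z))" for z
  define h where "h n r = complex_of_real (\<kappa> n (fst r) * \<kappa> n (snd r)) * \<eta> (g n r)" for n r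
  have \<eta>_cont: "continuous_on UNIV \<eta>"
    unfolding \<eta>_def by (intro continuous_intros) (auto simp: max_def)
  have h_cont: "continuous_on UNIV (h n)" for n
    unfolding h_def \<kappa>_def
    by (intro continuous_intros continuous_on_compose2[OF \<eta>_cont] g) auto
  have \<eta>_bd: "cmod (\<eta> z) \<le> 1" for z
    by (simp add: \<eta>_def norm_divide field_simps max_def)
  have \<kappa>_bd: "0 \<le> \<kappa> n x \<and> \<kappa> n x \<le> 1" for n x by (simp add: \<kappa>_def)
  have h_bd: "cmod (h n r) \<le> 1" for n r
    using \<kappa>_bd[of n "fst r"] \<kappa>_bd[of n "snd r"] \<eta>_bd[of "g n r"]
    by (simp add: h_def norm_mult abs_mult mult_le_one)
  have \<kappa>_lim: "(\<lambda>n. \<kappa> n x) \<longlonglongrightarrow> 1" if "\<bar>x\<bar> < T" for x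
  proof (rule tendsto_eventually)
    obtain n0 :: nat where n0: "1 / (T - \<bar>x\<bar>) \<le> real n0" using real_arch_simple by blast
    have "\<kappa> n x = 1" if "n \<ge> n0" for n
    proof -
      have "1 / (T - \<bar>x\<bar>) \<le> real n" using n0 that by simp
      then have "1 \<le> real n * (T - \<bar>x\<bar>)" using \<open>\<bar>x\<bar> < T\<close> by (simp add: field_simps)
      then show ?thesis using \<open>\<bar>x\<bar> < T\<close> by (simp add: \<kappa>_def)
    qed
    then show "\<forall>\<^sub>F n in sequentially. \<kappa> n x = 1" by (auto simp: eventually_sequentially)
  qed
  have zero: "(LINT r|?M. f r * h n r) = 0" for n
    by (rule integral_mult_continuous_eq_0[OF T f coeffs h_cont]) (auto simp: h_def \<kappa>_def)
  have null: "N \<union> (square T - box (-T, -T) (T, T)) \<in> null_sets lebesgue"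
    using N negligible_frontier_interval[of "(-T, -T)" "(T, T)"]
    by (intro null_sets.Un) (simp_all add: negligible_iff_null_sets square_eq_cbox)
  have AE_lim: "AE r in ?M. (\<lambda>n. f r * h n r) \<longlonglongrightarrow> f r * \<eta> (f r)"
  proof -
    have "AE r in lebesgue. r \<in> square T \<longrightarrow> (\<lambda>n. f r * h n r) \<longlonglongrightarrow> f r * \<eta> (f r)"
    proof (rule AE_I'[OF null], rule subsetI, rule ccontr)
      fix r
      assume bad: "r \<in> {r \<in> space lebesgue. \<not> (r \<in> square T \<longrightarrow> (\<lambda>n. f r * h n r) \<longlonglongrightarrow> f r * \<eta> (f r))}"
        and good: "r \<notin> N \<union> (square T - box (-T, -T) (T, T))"
      then have r: "r \<in> square T" "r \<notin> N" "r \<in> box (-T, -T) (T, T)" by auto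
      then have b: "\<bar>fst r\<bar> < T" "\<bar>snd r\<bar> < T" by (cases r; auto simp: mem_box Basis_prod_def)+
      have "(\<lambda>n. g n r) \<longlonglongrightarrow> f r" using lim[OF r(2)] r(1) by simp
      then have "(\<lambda>n. \<eta> (g n r)) \<longlonglongrightarrow> \<eta> (f r)"
        by (rule continuous_on_tendsto_compose[OF \<eta>_cont]) auto
      then have "(\<lambda>n. f r * h n r) \<longlonglongrightarrow> f r * (complex_of_real (1 * 1) * \<eta> (f r))"
        unfolding h_def by (intro tendsto_intros \<kappa>_lim b)
      with bad show False by simp
    qed
    then show ?thesis by (simp add: AE_restrict_space_iff)
  qed
  have [measurable]: "\<eta> \<in> borel_measurable borel" by (rule borel_measurable_continuous_onI[OF \<eta>_cont])
  have [measurable]: "h n \<in> borel_measurable ?M" for n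
    using L2_measurable[OF continuous_imp_L2_square[OF h_cont]] .
  have fi: "integrable ?M (\<lambda>r. norm (f r))" using L2_square_imp_integrable[OF f] by simp
  have dom: "AE r in ?M. norm (f r * h n r) \<le> norm (f r)" for n
    by (rule AE_I2) (simp add: norm_mult mult_left_le h_bd)
  have "(\<lambda>n. LINT r|?M. f r * h n r) \<longlonglongrightarrow> (LINT r|?M. f r * \<eta> (f r))"
    by (rule integral_dominated_convergence[OF _ _ fi AE_lim dom]) measurable
  then have "(LINT r|?M. f r * \<eta> (f r)) = 0" by (simp add: zero LIMSEQ_const_iff)
  moreover have int: "integrable ?M (\<lambda>r. f r * \<eta> (f r))"
    by (rule integrable_dominated_convergence[OF _ _ fi AE_lim dom]) measurable
  ultimately have Re_int: "(LINT r|?M. Re (f r * \<eta> (f r))) = 0" by (subst integral_Re) simp_all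
  have re: "Re (f r * \<eta> (f r)) = (cmod (f r))\<^sup>2 / max 1 (cmod (f r))" for r
  proof -
    have "f r * \<eta> (f r) = complex_of_real ((cmod (f r))\<^sup>2 / max 1 (cmod (f r)))"
      unfolding of_real_divide complex_norm_square by (simp add: \<eta>_def)
    then show ?thesis by (metis Re_complex_of_real)
  qed
  have "AE r in ?M. 0 \<le> Re (f r * \<eta> (f r))" unfolding re by (intro AE_I2 divide_nonneg_nonneg) auto
  with Re_int have "AE r in ?M. Re (f r * \<eta> (f r)) = 0"
    using integral_nonneg_eq_0_iff_AE[OF integrable_Re[OF int]] by blast
  then show ?thesis
    unfolding re by (rule AE_mp) (intro AE_I2, auto simp: max_def split: if_splits)
qed

section \<open>Riesz-Fischer and Parseval\<close>

lemma L2_inner_trig_sum: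
  assumes T: "T > 0" and F: "finite F"
  shows "L2_inner (square T) 1 (\<lambda>r. \<Sum>p\<in>F. a p * w T p r) (w T q) = (if q \<in> F then a q else 0)"
proof -
  have "L2_inner (square T) 1 (\<lambda>r. \<Sum>p\<in>F. a p * w T p r) (w T q) = (\<Sum>p\<in>F. if p = q then a p else 0)"
    by (subst L2_inner_sum_left)
      (auto intro!: sum.cong L2_scale w_L2 simp: L2_inner_scale_left w_orthonormal[OF T])
  then show ?thesis using F by (simp add: sum.delta')
qed

lemma L2_norm_diff_trig_sum:
  assumes T: "T > 0" and F: "finite F" and f: "f \<in> L2 (square T)"
  shows "(L2_norm (square T) 1 (\<lambda>r. f r - (\<Sum>p\<in>F. a p * w T p r)))\<^sup>2 =
    (L2_norm (square T) 1 f)\<^sup>2 - (\<Sum>p\<in>F. (cmod (L2_inner (square T) 1 f (w T p)))\<^sup>2)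
      + (\<Sum>p\<in>F. (cmod (L2_inner (square T) 1 f (w T p) - a p))\<^sup>2)"
proof -
  let ?S = "square T" and ?c = "\<lambda>p. L2_inner (square T) 1 f (w T p)"
  let ?g = "\<lambda>r. \<Sum>p\<in>F. a p * w T p r"
  have g: "?g \<in> L2 ?S" by (intro L2_sum L2_scale w_L2)
  have d: "(\<lambda>r. f r - ?g r) \<in> L2 ?S" by (rule L2_diff[OF f g])
  have fg: "L2_inner ?S 1 f ?g = (\<Sum>p\<in>F. cnj (a p) * ?c p)"
    by (subst L2_inner_sum_right) (auto intro!: L2_scale w_L2 f simp: L2_inner_scale_right)
  have gh: "L2_inner ?S 1 ?g h = (\<Sum>p\<in>F. a p * cnj (L2_inner ?S 1 h (w T p)))" if "h \<in> L2 ?S" for h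
    by (subst L2_inner_sum_left) (auto intro!: L2_scale w_L2 that simp: L2_inner_scale_left L2_inner_cnj)
  have dc: "L2_inner ?S 1 (\<lambda>r. f r - ?g r) (w T p) = ?c p - a p" if "p \<in> F" for p
    using that by (simp add: L2_inner_diff_left[OF f g w_L2] L2_inner_trig_sum[OF T F])
  have "complex_of_real ((L2_norm ?S 1 (\<lambda>r. f r - ?g r))\<^sup>2) =
      L2_inner ?S 1 f f - L2_inner ?S 1 f ?g - L2_inner ?S 1 ?g (\<lambda>r. f r - ?g r)"
    unfolding L2_inner_self_norm[symmetric]
    by (simp add: L2_inner_diff_left[OF f g d] L2_inner_diff_right[OF f g f])
  also have "\<dots> = L2_inner ?S 1 f f - (\<Sum>p\<in>F. cnj (a p) * ?c p + a p * cnj (?c p - a p))"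
    by (simp add: fg gh[OF d] dc sum.distrib cong: sum.cong)
  also have "(\<Sum>p\<in>F. cnj (a p) * ?c p + a p * cnj (?c p - a p)) =
      (\<Sum>p\<in>F. complex_of_real ((cmod (?c p))\<^sup>2 - (cmod (?c p - a p))\<^sup>2))"
    unfolding of_real_diff complex_norm_square by (intro sum.cong) (simp_all add: algebra_simps)
  finally have "complex_of_real ((L2_norm ?S 1 (\<lambda>r. f r - ?g r))\<^sup>2) =
      complex_of_real ((L2_norm ?S 1 f)\<^sup>2 - (\<Sum>p\<in>F. (cmod (?c p))\<^sup>2 - (cmod (?c p - a p))\<^sup>2))"
    by (simp add: L2_inner_self_norm)
  then show ?thesis
    unfolding of_real_eq_iff by (simp add: sum_subtractf)
qed

lemma L2_norm_trig_sum:
  assumes T: "T > 0" and F: "finite F"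
  shows "(L2_norm (square T) 1 (\<lambda>r. \<Sum>p\<in>F. a p * w T p r))\<^sup>2 = (\<Sum>p\<in>F. (cmod (a p))\<^sup>2)"
proof -
  have "L2_norm (square T) 1 (\<lambda>r. 0 - (\<Sum>p\<in>F. a p * w T p r)) = L2_norm (square T) 1 (\<lambda>r. \<Sum>p\<in>F. a p * w T p r)"
    by (simp add: L2_norm_eq)
  moreover have "L2_norm (square T) 1 (\<lambda>r. 0) = 0" by (simp add: L2_norm_eq)
  moreover have "L2_inner (square T) 1 (\<lambda>r. 0) (w T p) = 0" for p by (simp add: L2_inner_def)
  ultimately show ?thesis
    using L2_norm_diff_trig_sum[OF T F L2_zero, of a] by (simp add: norm_minus_commute)
qed

lemma bessel_inequality:
  assumes T: "T > 0" and F: "finite F" and f: "f \<in> L2 (square T)"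
  shows "(\<Sum>p\<in>F. (cmod (L2_inner (square T) 1 f (w T p)))\<^sup>2) \<le> (L2_norm (square T) 1 f)\<^sup>2"
  using L2_norm_diff_trig_sum[OF T F f, of "\<lambda>p. L2_inner (square T) 1 f (w T p)"]
    zero_le_power2[of "L2_norm (square T) 1 (\<lambda>r. f r - (\<Sum>p\<in>F. L2_inner (square T) 1 f (w T p) * w T p r))"]
  by simp

lemma fourier_coeffs_square_summable:
  assumes T: "T > 0" and f: "f \<in> L2 (square T)"
  shows "(\<lambda>p. (cmod (L2_inner (square T) 1 f (w T p)))\<^sup>2) summable_on UNIV"
  by (rule nonneg_bdd_above_summable_on)
    (use bessel_inequality[OF T _ f] in \<open>auto intro!: bdd_aboveI[where M="(L2_norm (square T) 1 f)\<^sup>2"]\<close>)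

lemma L2_if_norm_bound:
  assumes m: "f \<in> borel_measurable (lebesgue_on \<Omega>)"
    and b: "(\<integral>\<^sup>+r. ennreal ((cmod (f r))\<^sup>2) \<partial>lebesgue_on \<Omega>) \<le> ennreal e" and e: "e \<ge> 0"
  shows "f \<in> L2 \<Omega>" and "(L2_norm \<Omega> 1 f)\<^sup>2 \<le> e"
proof -
  have int: "integrable (lebesgue_on \<Omega>) (\<lambda>r. (cmod (f r))\<^sup>2)"
    using m b by (intro integrableI_bounded) (auto intro: le_less_trans)
  then show "f \<in> L2 \<Omega>" using m by (simp add: L2_def)
  have "ennreal (LINT r|lebesgue_on \<Omega>. (cmod (f r))\<^sup>2) \<le> ennreal e"
    using b nn_integral_eq_integral[OF int] by simp
  then show "(L2_norm \<Omega> 1 f)\<^sup>2 \<le> e" using e by (simp add: L2_norm_square)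
qed

lemma nn_integral_cmod_square:
  "f \<in> L2 \<Omega> \<Longrightarrow> (\<integral>\<^sup>+r. ennreal ((cmod (f r))\<^sup>2) \<partial>lebesgue_on \<Omega>) = ennreal ((L2_norm \<Omega> 1 f)\<^sup>2)"
  by (subst nn_integral_eq_integral) (auto simp: L2_def L2_norm_square)

lemma integral_cmod_le_L2_norm:
  assumes T: "T > 0" and f: "f \<in> L2 (square T)"
  shows "(LINT r|lebesgue_on (square T). cmod (f r)) \<le> 2 * T * L2_norm (square T) 1 f"
proof -
  have one: "(\<lambda>r. 1) \<in> L2 (square T)" by (intro continuous_imp_L2_square continuous_intros)
  have abs: "(\<lambda>r. complex_of_real (cmod (f r))) \<in> L2 (square T)"
    using f by (auto simp: L2_def)
  have "L2_norm (square T) 1 (\<lambda>r. 1) = 2 * T"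
    using T by (simp add: L2_norm_eq measure_restrict_space measure_square real_sqrt_mult)
  moreover have "L2_norm (square T) 1 (\<lambda>r. complex_of_real (cmod (f r))) = L2_norm (square T) 1 f"
    by (simp add: L2_norm_eq)
  moreover have "L2_inner (square T) 1 (\<lambda>r. complex_of_real (cmod (f r))) (\<lambda>r. 1) =
      complex_of_real (LINT r|lebesgue_on (square T). cmod (f r))"
    by (simp add: L2_inner_def)
  ultimately show ?thesis using L2_Cauchy_Schwarz[OF abs one] by (simp add: mult.commute)
qed

text \<open>
  By monotone convergence the sum has finite integral, hence is finite almost everywhere.
\<close>
lemma AE_summable_if_integrals_geometric:
  fixes D :: "nat \<Rightarrow> 'a \<Rightarrow> real"
  assumes int: "\<And>k. integrable M (D k)" and nonneg: "\<And>k r. D k r \<ge> 0"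
    and b: "\<And>k. (LINT r|M. D k r) \<le> c * (1/2) ^ k"
  shows "AE r in M. summable (\<lambda>k. D k r)"
proof -
  have [measurable]: "D k \<in> borel_measurable M" for k using int by auto
  have "0 \<le> (LINT r|M. D 0 r)" by (intro integral_nonneg_AE AE_I2 nonneg)
  then have c: "c \<ge> 0" using b[of 0] by simp
  have "(\<integral>\<^sup>+r. (\<Sum>k. ennreal (D k r)) \<partial>M) = (\<Sum>k. \<integral>\<^sup>+r. ennreal (D k r) \<partial>M)"
    by (rule nn_integral_suminf) measurable
  also have "\<dots> = (\<Sum>k. ennreal (LINT r|M. D k r))"
    by (simp add: nn_integral_eq_integral int nonneg)
  also have "\<dots> \<le> (\<Sum>k. ennreal (c * (1/2) ^ k))"
    by (intro suminf_le ennreal_leI b) auto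
  also have "\<dots> = ennreal (\<Sum>k. c * (1/2) ^ k)"
    using c by (intro suminf_ennreal2) (auto intro!: summable_mult summable_geometric)
  finally have "(\<integral>\<^sup>+r. (\<Sum>k. ennreal (D k r)) \<partial>M) \<noteq> \<infinity>" by (auto simp: top_unique)
  then have "AE r in M. (\<Sum>k. ennreal (D k r)) \<noteq> \<infinity>"
    by (intro nn_integral_PInf_AE) auto
  then show ?thesis
    by eventually_elim (auto intro!: summable_suminf_not_top nonneg)
qed

text \<open>
  Choose finite sets \<open>F k\<close> outside of which the squares sum to at most \<open>4\<^sup>-\<^sup>k\<close>. The partial sums
  \<open>s k\<close> over them have increments of norm at most \<open>2\<^sup>-\<^sup>k\<close>, also in \<open>L\<^sub>1\<close> up to a constant because the square
  has finite measure; so they converge almost everywhere, and Fatou's lemma bounds the distance of the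
  limit from \<open>s k\<close>. The conclusion is periodicity at every point rather than almost everywhere: \<open>g r\<close>
  depends on the sequence of the values \<open>s k r\<close> only, and that sequence is periodic in \<open>r\<close>, even where it
  diverges and \<open>lim\<close> is an unspecified value.
\<close>
lemma riesz_fischer:
  fixes a :: "int \<times> int \<Rightarrow> complex"
  assumes T: "T > 0" and a: "(\<lambda>p. (cmod (a p))\<^sup>2) summable_on UNIV"
  obtains g where "g \<in> L2 (square T)" "periodic2 (2 * T) g"
    "\<And>p. L2_inner (square T) 1 g (w T p) = a p"
    "\<And>e. e > 0 \<Longrightarrow> \<exists>F. finite F \<and> L2_norm (square T) 1 (\<lambda>r. g r - (\<Sum>p\<in>F. a p * w T p r)) \<le> e"
proof -
  let ?M = "lebesgue_on (square T)"
  have "\<exists>F. finite F \<and> (\<forall>G. finite G \<longrightarrow> G \<inter> F = {} \<longrightarrow> (\<Sum>p\<in>G. (cmod (a p))\<^sup>2) \<le> ((1/2) ^ k)\<^sup>2)"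
    for k :: nat
    by (rule summable_on_small_tail[OF a]) auto
  then obtain F' where F': "\<And>k::nat. finite (F' k)"
    "\<And>k G. finite G \<Longrightarrow> G \<inter> F' k = {} \<Longrightarrow> (\<Sum>p\<in>G. (cmod (a p))\<^sup>2) \<le> ((1/2) ^ k)\<^sup>2"
    by metis
  define F where "F k = (\<Union>i\<le>k. F' i)" for k
  have F: "finite (F k)" for k by (simp add: F_def F'(1))
  have F_tail: "(\<Sum>p\<in>G. (cmod (a p))\<^sup>2) \<le> ((1/2) ^ k)\<^sup>2" if "finite G" "G \<inter> F k = {}" for G k
    using that by (intro F'(2)) (auto simp: F_def)
  have F_mono: "F k \<subseteq> F m" if "k \<le> m" for k m
    using that unfolding F_def by (intro UN_mono) auto
  define s where "s k r = (\<Sum>p\<in>F k. a p * w T p r)" for k r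
  have s_cont: "continuous_on UNIV (s k)" for k
    unfolding s_def by (intro continuous_intros continuous_on_w)
  have sL: "s k \<in> L2 (square T)" for k by (rule continuous_imp_L2_square[OF s_cont])
  note [measurable] = L2_measurable[OF sL]
  have s_diff: "(L2_norm (square T) 1 (\<lambda>r. s m r - s k r))\<^sup>2 \<le> ((1/2) ^ k)\<^sup>2" if "k \<le> m" for k m
  proof -
    have "s m r - s k r = (\<Sum>p\<in>F m - F k. a p * w T p r)" for r
      unfolding s_def by (rule sum_diff[OF F F_mono[OF that], symmetric])
    then have "(L2_norm (square T) 1 (\<lambda>r. s m r - s k r))\<^sup>2 = (\<Sum>p\<in>F m - F k. (cmod (a p))\<^sup>2)"
      using F by (simp add: L2_norm_trig_sum[OF T])
    also have "\<dots> \<le> ((1/2) ^ k)\<^sup>2" using F by (intro F_tail) auto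
    finally show ?thesis .
  qed
  define g where "g r = lim (\<lambda>k. s k r)" for r
  have g_meas [measurable]: "g \<in> borel_measurable ?M"
    unfolding g_def by measurable
  have "AE r in ?M. summable (\<lambda>k. cmod (s (Suc k) r - s k r))"
  proof (rule AE_summable_if_integrals_geometric)
    fix k
    have d: "(\<lambda>r. s (Suc k) r - s k r) \<in> L2 (square T)" by (rule L2_diff[OF sL sL])
    show "integrable ?M (\<lambda>r. cmod (s (Suc k) r - s k r))"
      using L2_square_imp_integrable[OF d] by simp
    have "L2_norm (square T) 1 (\<lambda>r. s (Suc k) r - s k r) \<le> (1/2) ^ k"
      by (rule power2_le_imp_le[OF s_diff]) simp_all
    then show "(LINT r|?M. cmod (s (Suc k) r - s k r)) \<le> 2 * T * (1/2) ^ k"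
      using T by (intro order_trans[OF integral_cmod_le_L2_norm[OF T d]] mult_left_mono) auto
  qed auto
  then have lim: "AE r in ?M. (\<lambda>k. s k r) \<longlonglongrightarrow> g r"
  proof eventually_elim
    case (elim r)
    then have "summable (\<lambda>k. s (Suc k) r - s k r)" by (rule summable_norm_cancel)
    then have "convergent (\<lambda>n. \<Sum>k<n. s (Suc k) r - s k r)" by (simp add: summable_iff_convergent)
    then have "convergent (\<lambda>n. s n r - s 0 r)" by (simp add: sum_lessThan_telescope[of "\<lambda>n. s n r"])
    then have "convergent (\<lambda>n. s n r)"
      using convergent_add[OF _ convergent_const[of "s 0 r"]] by fastforce
    then show ?case by (simp add: g_def convergent_LIMSEQ_iff)
  qed
  have approx: "(\<lambda>r. g r - s k r) \<in> L2 (square T) \<and> (L2_norm (square T) 1 (\<lambda>r. g r - s k r))\<^sup>2 \<le> ((1/2) ^ k)\<^sup>2" for k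
  proof -
    have "(\<integral>\<^sup>+r. ennreal ((cmod (g r - s k r))\<^sup>2) \<partial>?M) = (\<integral>\<^sup>+r. liminf (\<lambda>m. ennreal ((cmod (s m r - s k r))\<^sup>2)) \<partial>?M)"
    proof (rule nn_integral_cong_AE)
      show "AE r in ?M. ennreal ((cmod (g r - s k r))\<^sup>2) = liminf (\<lambda>m. ennreal ((cmod (s m r - s k r))\<^sup>2))"
        using lim
      proof eventually_elim
        case (elim r)
        then have "(\<lambda>m. ennreal ((cmod (s m r - s k r))\<^sup>2)) \<longlonglongrightarrow> ennreal ((cmod (g r - s k r))\<^sup>2)"
          by (intro tendsto_ennrealI tendsto_intros)
        then show ?case by (intro lim_imp_Liminf[symmetric]) simp_all
      qed
    qed
    also have "\<dots> \<le> liminf (\<lambda>m. \<integral>\<^sup>+r. ennreal ((cmod (s m r - s k r))\<^sup>2) \<partial>?M)"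
      by (rule nn_integral_liminf) measurable
    also have "\<dots> \<le> liminf (\<lambda>m. ennreal (((1/2) ^ k)\<^sup>2))"
    proof (rule Liminf_mono)
      show "\<forall>\<^sub>F m in sequentially. (\<integral>\<^sup>+r. ennreal ((cmod (s m r - s k r))\<^sup>2) \<partial>?M) \<le> ennreal (((1/2) ^ k)\<^sup>2)"
        using eventually_ge_at_top[of k]
      proof eventually_elim
        case (elim m)
        then show ?case
          by (simp only: nn_integral_cmod_square[OF L2_diff[OF sL sL]] ennreal_leI s_diff)
      qed
    qed
    also have "\<dots> = ennreal (((1/2) ^ k)\<^sup>2)" by (simp add: Liminf_const)
    finally have b: "(\<integral>\<^sup>+r. ennreal ((cmod (g r - s k r))\<^sup>2) \<partial>?M) \<le> ennreal (((1/2) ^ k)\<^sup>2)" .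
    have m: "(\<lambda>r. g r - s k r) \<in> borel_measurable ?M" by measurable
    show ?thesis using L2_if_norm_bound[OF m b] by simp
  qed
  have gL: "g \<in> L2 (square T)"
    using L2_add[OF conjunct1[OF approx[of 0]] sL[of 0]] by simp
  have approx': "L2_norm (square T) 1 (\<lambda>r. g r - s k r) \<le> (1/2) ^ k" for k
    by (rule power2_le_imp_le[OF conjunct2[OF approx]]) simp
  have pow0: "(\<lambda>k. (1/2) ^ k :: real) \<longlonglongrightarrow> 0" by (rule LIMSEQ_realpow_zero) auto
  show ?thesis
  proof (rule that)
    show "g \<in> L2 (square T)" by fact
    show "periodic2 (2 * T) g"
      using periodic2_w[OF T] by (simp add: periodic2_def g_def s_def)
    show "L2_inner (square T) 1 g (w T p) = a p" for p
    proof -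
      let ?z = "L2_inner (square T) 1 g (w T p) - a p"
      have "cmod ?z \<le> 2 * (1/2) ^ k" for k
      proof -
        have "cmod (L2_inner (square T) 1 (\<lambda>r. g r - s k r) (w T p)) \<le>
            L2_norm (square T) 1 (\<lambda>r. g r - s k r) * L2_norm (square T) 1 (w T p)"
          using approx[of k] by (intro L2_Cauchy_Schwarz w_L2) auto
        also have "L2_norm (square T) 1 (w T p) = 1"
          by (simp add: L2_norm_def w_orthonormal[OF T])
        finally have 1: "cmod (L2_inner (square T) 1 g (w T p) - L2_inner (square T) 1 (s k) (w T p)) \<le> (1/2) ^ k"
          using approx'[of k] by (simp add: L2_inner_diff_left[OF gL sL w_L2])
        have 2: "cmod (L2_inner (square T) 1 (s k) (w T p) - a p) \<le> (1/2) ^ k"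
        proof (cases "p \<in> F k")
          case True
          then show ?thesis unfolding s_def by (simp add: L2_inner_trig_sum[OF T F])
        next
          case False
          then have "(cmod (a p))\<^sup>2 \<le> ((1/2) ^ k)\<^sup>2" using F_tail[of "{p}" k] by simp
          then have "cmod (a p) \<le> (1/2) ^ k" by (rule power2_le_imp_le) simp
          then show ?thesis using False unfolding s_def by (simp add: L2_inner_trig_sum[OF T F])
        qed
        have "cmod ?z \<le> cmod (L2_inner (square T) 1 g (w T p) - L2_inner (square T) 1 (s k) (w T p))
            + cmod (L2_inner (square T) 1 (s k) (w T p) - a p)"
          by (rule order_trans[OF _ norm_triangle_ineq]) simp
        with 1 2 show ?thesis by linarith
      qed
      then have "cmod ?z \<le> 2 * 0"
        by (intro LIMSEQ_le_const[OF tendsto_mult_left[OF pow0]]) auto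
      then show ?thesis by simp
    qed
    show "\<exists>F. finite F \<and> L2_norm (square T) 1 (\<lambda>r. g r - (\<Sum>p\<in>F. a p * w T p r)) \<le> e" if e: "e > 0" for e
    proof -
      obtain k where "(1/2) ^ k < e" using real_arch_pow_inv[of e "1/2"] e by auto
      then show ?thesis using approx'[of k] F[of k] by (intro exI[of _ "F k"]) (simp add: s_def)
    qed
  qed
qed

text \<open>
  The function with the same coefficients given by \<open>riesz_fischer\<close> agrees with \<open>f\<close> almost everywhere
  by totality. It is approximated by some finite partial sum; enlarging the index set only improves the
  approximation, because partial sums with Fourier coefficients are orthogonal projections.
\<close>
lemma L2_has_sum_fourier:
  assumes T: "T > 0" and f: "f \<in> L2 (square T)"
  shows "L2_has_sum (square T) (\<lambda>p r. L2_inner (square T) 1 f (w T p) * w T p r) f"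
proof -
  let ?c = "\<lambda>p. L2_inner (square T) 1 f (w T p)"
  let ?N = "\<lambda>F. L2_norm (square T) 1 (\<lambda>r. f r - (\<Sum>p\<in>F. ?c p * w T p r))"
  obtain g where g: "g \<in> L2 (square T)" "\<And>p. L2_inner (square T) 1 g (w T p) = ?c p"
      and ga: "\<And>e. e > 0 \<Longrightarrow> \<exists>F. finite F \<and> L2_norm (square T) 1 (\<lambda>r. g r - (\<Sum>p\<in>F. ?c p * w T p r)) \<le> e"
    by (rule riesz_fischer[OF T fourier_coeffs_square_summable[OF T f]]) (rule that)
  have "AE r in lebesgue_on (square T). f r - g r = 0"
    by (rule w_total[OF T L2_diff[OF f g(1)]]) (simp add: L2_inner_diff_left[OF f g(1) w_L2] g(2))
  then have ae: "AE r in lebesgue_on (square T). f r = g r" by eventually_elim simp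
  have "(?N \<longlongrightarrow> 0) (finite_subsets_at_top UNIV)"
  proof (rule tendstoI)
    fix e :: real assume "e > 0"
    then obtain F where F: "finite F" "L2_norm (square T) 1 (\<lambda>r. g r - (\<Sum>p\<in>F. ?c p * w T p r)) \<le> e / 2"
      using ga[of "e/2"] by auto
    have "L2_norm (square T) 1 (\<lambda>r. g r - (\<Sum>p\<in>F. ?c p * w T p r)) = ?N F"
      unfolding L2_norm_eq
    proof (intro arg_cong[where f=sqrt] integral_cong_AE)
      show "AE r in lebesgue_on (square T). (cmod (g r - (\<Sum>p\<in>F. ?c p * w T p r)))\<^sup>2 =
          (cmod (f r - (\<Sum>p\<in>F. ?c p * w T p r)))\<^sup>2"
        using ae by eventually_elim simp
    qed (use L2_measurable[OF f] L2_measurable[OF g(1)] L2_measurable[OF w_L2] in measurable)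
    then have NF: "?N F \<le> e / 2" using F(2) by simp
    have "?N G < e" if "F \<subseteq> G" "finite G" for G
    proof -
      have "(?N G)\<^sup>2 \<le> (?N F)\<^sup>2"
        using sum_mono2[OF that(2,1), of "\<lambda>p. (cmod (?c p))\<^sup>2"]
        by (simp add: L2_norm_diff_trig_sum[OF T _ f] F(1) that(2))
      then have "?N G \<le> ?N F" by (rule power2_le_imp_le) (rule L2_norm_nonneg)
      with NF \<open>e > 0\<close> show ?thesis by linarith
    qed
    then show "\<forall>\<^sub>F G in finite_subsets_at_top UNIV. dist (?N G) 0 < e"
      unfolding eventually_finite_subsets_at_top using F(1)
      by (auto simp: L2_norm_nonneg intro!: exI[of _ F])
  qed
  then show ?thesis unfolding L2_has_sum_def using f by (auto intro!: L2_scale w_L2)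
qed

text \<open>
  The inner product with \<open>q\<close> is continuous by Cauchy-Schwarz, so it can be applied to the Fourier
  series of \<open>f\<close> term by term.
\<close>
lemma parseval:
  assumes T: "T > 0" and f: "f \<in> L2 (square T)" and q: "q \<in> L2 (square T)"
  shows "((\<lambda>p. L2_inner (square T) 1 f (w T p) * cnj (L2_inner (square T) 1 q (w T p)))
           has_sum L2_inner (square T) 1 f q) UNIV"
proof -
  let ?c = "\<lambda>p. L2_inner (square T) 1 f (w T p)"
  let ?N = "\<lambda>F. L2_norm (square T) 1 (\<lambda>r. f r - (\<Sum>p\<in>F. ?c p * w T p r))"
  have N: "(?N \<longlongrightarrow> 0) (finite_subsets_at_top UNIV)"
    using L2_has_sum_fourier[OF T f] by (simp add: L2_has_sum_def)
  have b: "norm ((\<Sum>p\<in>F. ?c p * cnj (L2_inner (square T) 1 q (w T p))) - L2_inner (square T) 1 f q)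
      \<le> ?N F * L2_norm (square T) 1 q" for F
  proof -
    have s: "(\<lambda>r. \<Sum>p\<in>F. ?c p * w T p r) \<in> L2 (square T)" by (intro L2_sum L2_scale w_L2)
    have "L2_inner (square T) 1 (\<lambda>r. f r - (\<Sum>p\<in>F. ?c p * w T p r)) q =
        L2_inner (square T) 1 f q - (\<Sum>p\<in>F. ?c p * cnj (L2_inner (square T) 1 q (w T p)))"
      by (simp add: L2_inner_diff_left[OF f s q] L2_inner_sum_left L2_scale w_L2 q L2_inner_scale_left L2_inner_cnj)
    then show ?thesis
      using L2_Cauchy_Schwarz[OF L2_diff[OF f s] q] by (simp add: norm_minus_commute)
  qed
  have "((\<lambda>F. (\<Sum>p\<in>F. ?c p * cnj (L2_inner (square T) 1 q (w T p))) - L2_inner (square T) 1 f q) \<longlongrightarrow> 0)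
      (finite_subsets_at_top UNIV)"
    by (rule Lim_null_comparison[OF always_eventually tendsto_mult_left_zero[OF N]]) (use b in auto)
  then show ?thesis unfolding has_sum_def by (subst Lim_null) 
qed

lemma L2_inner_w_shift:
  assumes T: "T > 0" and per: "periodic2 (2 * T) f" and f: "f \<in> L2 (square T)"
  shows "L2_inner (square T) 1 (\<lambda>r. f (r + d)) (w T p) =
           complex_of_real (2 * T) * w T p d * L2_inner (square T) 1 f (w T p)"
proof -
  let ?e = "complex_of_real (2 * T) * w T p d"
  have e: "?e * cnj ?e = 1"
    unfolding complex_norm_square[symmetric] using T by (simp add: norm_mult cmod_w)
  have eq: "f (r + d) * cnj (w T p r) = ?e * (f (r + d) * cnj (w T p (r + d)))" for r
  proof -
    have "?e * (f (r + d) * cnj (w T p (r + d))) = (?e * cnj ?e) * (f (r + d) * cnj (w T p r))"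
      by (simp add: w_add[OF T])
    then show ?thesis unfolding e mult_1_left by (rule sym)
  qed
  have "(LINT r|lebesgue_on (square T). f (r + d) * cnj (w T p (r + d))) =
      (LINT r|lebesgue_on (square T). f r * cnj (w T p r))"
    using per periodic2_w[OF T, of p] L2_integrable_mult_cnj[OF f w_L2]
    by (intro integral_square_shift(2)[OF T, of "\<lambda>r. f r * cnj (w T p r)"]) (simp add: periodic2_def)
  then show ?thesis
    unfolding L2_inner_def eq integral_mult_right_zero by (simp only: mult.left_commute)
qed

section \<open>Layer functions of one scale\<close>

lemma periodic2_dilation:
  assumes "c > 0" "periodic2 (2 * c * T) f"
  shows "periodic2 (2 * T) (\<lambda>r. f (c *\<^sub>R r))"
  using assms by (simp add: periodic2_def algebra_simps)

lemma w_layer_dilation: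
  "c > 0 \<Longrightarrow> w_layer T \<gamma> c p (c *\<^sub>R r) = complex_of_real (sqrt \<gamma> / c) * w T p r"
  by (simp add: w_layer_def)

lemma w_layer_L2: "c > 0 \<Longrightarrow> w_layer T \<gamma> c p \<in> L2 (square (c * T))"
  by (subst L2_dilation_iff[symmetric]) (simp_all only: w_layer_dilation L2_scale w_L2)

lemma periodic2_rescale:
  assumes c: "c > 0" and f: "periodic2 (2 * T) f"
  shows "periodic2 (2 * c * T) (\<lambda>r. f (r /\<^sub>R c))"
proof -
  have e: "(x, y) /\<^sub>R c = (x / c, y / c)" "(x + 2 * c * T) / c = x / c + 2 * T" for x y
    using c by (simp_all add: field_simps)
  show ?thesis using f unfolding periodic2_def e by blast
qed

lemma periodic2_w_layer:
  assumes T: "T > 0" and c: "c > 0" shows "periodic2 (2 * c * T) (w_layer T \<gamma> c p)"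
  using periodic2_rescale[OF c periodic2_w[OF T, of p]] by (simp add: periodic2_def w_layer_def)

lemma L2_inner_w_layer:
  assumes c: "c > 0" and \<gamma>: "\<gamma> > 0" and f: "f \<in> L2 (square (c * T))"
  shows "L2_inner (square (c * T)) \<gamma> f (w_layer T \<gamma> c p) =
           complex_of_real (c / sqrt \<gamma>) * L2_inner (square T) 1 (\<lambda>r. f (c *\<^sub>R r)) (w T p)"
proof -
  have "(LINT r|lebesgue_on (square (c * T)). f r * cnj (w_layer T \<gamma> c p r)) =
      c\<^sup>2 *\<^sub>R (LINT r|lebesgue_on (square T). f (c *\<^sub>R r) * cnj (w_layer T \<gamma> c p (c *\<^sub>R r)))"
    by (rule integral_square_dilation(2)[OF c])
      (rule borel_measurable_integrable[OF L2_integrable_mult_cnj[OF f w_layer_L2[OF c]]])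
  also have "\<dots> = complex_of_real (c\<^sup>2 * (sqrt \<gamma> / c)) * L2_inner (square T) 1 (\<lambda>r. f (c *\<^sub>R r)) (w T p)"
    by (simp add: w_layer_dilation[OF c] L2_inner_def scaleR_conv_of_real mult.left_commute)
  finally have "L2_inner (square (c * T)) \<gamma> f (w_layer T \<gamma> c p) =
      complex_of_real (1 / \<gamma> * (c\<^sup>2 * (sqrt \<gamma> / c))) * L2_inner (square T) 1 (\<lambda>r. f (c *\<^sub>R r)) (w T p)"
    by (simp add: L2_inner_def mult.assoc)
  also have "1 / \<gamma> * (c\<^sup>2 * (sqrt \<gamma> / c)) = c / sqrt \<gamma>"
    using c \<gamma> real_sqrt_mult_self[of \<gamma>] by (simp add: field_simps power2_eq_square)
  finally show ?thesis .
qed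

lemma w_layer_orthonormal:
  assumes T: "T > 0" and c: "c > 0" and \<gamma>: "\<gamma> > 0"
  shows "L2_inner (square (c * T)) \<gamma> (w_layer T \<gamma> c p) (w_layer T \<gamma> c q) = (if p = q then 1 else 0)"
  unfolding L2_inner_w_layer[OF c \<gamma> w_layer_L2[OF c]] w_layer_dilation[OF c] L2_inner_scale_left
    w_orthonormal[OF T]
  using c \<gamma> by simp

section \<open>Sobolev coefficients\<close>

text \<open>
  The coefficient of \<open>f\<close> in the orthonormal basis \<open>w_sob\<close> of the Sobolev space, see
  \<open>Hs_inner_w_sob\<close>. In these coefficients \<open>Hs\<close> is a plain space of square-summable families.
\<close>
definition sobolev_coeff :: "real \<Rightarrow> real \<Rightarrow> real \<Rightarrow> real \<Rightarrow> (plane \<Rightarrow> complex) \<Rightarrow> int \<times> int \<Rightarrow> complex" where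
  "sobolev_coeff T \<gamma> c s f p = complex_of_real (sobolev_weight T c p powr (s / 2)) *
     L2_inner (square (c * T)) \<gamma> f (w_layer T \<gamma> c p)"

lemma sobolev_weight_ge_1: "sobolev_weight T c p \<ge> 1"
  by (cases p) (simp add: sobolev_weight_def)

lemma sobolev_weight_powr_half: "(sobolev_weight T c p powr (s / 2))\<^sup>2 = sobolev_weight T c p powr s"
  by (simp add: power2_eq_square flip: powr_add)

lemma sobolev_weight_powr_cancel:
  "sobolev_weight T c p powr (s / 2) * sobolev_weight T c p powr (- s / 2) = 1"
  using sobolev_weight_ge_1[of T c p] by (simp flip: powr_add)

lemma cmod_sobolev_coeff_square:
  "(cmod (sobolev_coeff T \<gamma> c s f p))\<^sup>2 =
     sobolev_weight T c p powr s * (cmod (L2_inner (square (c * T)) \<gamma> f (w_layer T \<gamma> c p)))\<^sup>2"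
  by (simp add: sobolev_coeff_def norm_mult power_mult_distrib sobolev_weight_powr_half)

lemma Hs_iff_sobolev_coeff:
  "f \<in> Hs T \<gamma> c s \<longleftrightarrow> periodic2 (2 * c * T) f \<and> f \<in> L2 (square (c * T)) \<and>
     (\<lambda>p. (cmod (sobolev_coeff T \<gamma> c s f p))\<^sup>2) summable_on UNIV"
  by (simp add: Hs_def cmod_sobolev_coeff_square)

lemma Hs_inner_eq_coeffs:
  "Hs_inner T \<gamma> c s f g = (\<Sum>\<^sub>\<infinity>p\<in>UNIV. sobolev_coeff T \<gamma> c s f p * cnj (sobolev_coeff T \<gamma> c s g p))"
proof -
  have "sobolev_coeff T \<gamma> c s f p * cnj (sobolev_coeff T \<gamma> c s g p) =
      complex_of_real ((sobolev_weight T c p powr (s / 2))\<^sup>2) *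
      L2_inner (square (c * T)) \<gamma> f (w_layer T \<gamma> c p) * cnj (L2_inner (square (c * T)) \<gamma> g (w_layer T \<gamma> c p))" for p
    by (simp add: sobolev_coeff_def power2_eq_square)
  then show ?thesis unfolding Hs_inner_def sobolev_weight_powr_half by simp
qed

lemma Hs_inner_self:
  "Hs_inner T \<gamma> c s f f = complex_of_real (\<Sum>\<^sub>\<infinity>p\<in>UNIV. (cmod (sobolev_coeff T \<gamma> c s f p))\<^sup>2)"
  unfolding Hs_inner_eq_coeffs complex_norm_square[symmetric] by (rule infsum_of_real_complex)

lemma Hs_norm_square:
  "(Hs_norm T \<gamma> c s f)\<^sup>2 = (\<Sum>\<^sub>\<infinity>p\<in>UNIV. (cmod (sobolev_coeff T \<gamma> c s f p))\<^sup>2)"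
  by (simp add: Hs_norm_def Hs_inner_self infsum_nonneg)

lemma Hs_norm_nonneg: "Hs_norm T \<gamma> c s f \<ge> 0"
  by (simp add: Hs_norm_def Hs_inner_self infsum_nonneg)

lemma sobolev_coeff_diff:
  assumes "c > 0" "f \<in> L2 (square (c * T))" "g \<in> L2 (square (c * T))"
  shows "sobolev_coeff T \<gamma> c s (\<lambda>r. f r - g r) p = sobolev_coeff T \<gamma> c s f p - sobolev_coeff T \<gamma> c s g p"
  by (simp add: sobolev_coeff_def L2_inner_diff_left assms w_layer_L2 right_diff_distrib)

lemma w_sob_L2: "c > 0 \<Longrightarrow> w_sob T \<gamma> c s p \<in> L2 (square (c * T))"
  unfolding w_sob_def[abs_def] by (intro L2_scale w_layer_L2)

lemma sobolev_coeff_w_sob_sum: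
  assumes T: "T > 0" and c: "c > 0" and \<gamma>: "\<gamma> > 0" and F: "finite F"
  shows "sobolev_coeff T \<gamma> c s (\<lambda>r. \<Sum>q\<in>F. a q * w_sob T \<gamma> c s q r) p = (if p \<in> F then a p else 0)"
proof -
  have "L2_inner (square (c * T)) \<gamma> (\<lambda>r. \<Sum>q\<in>F. a q * w_sob T \<gamma> c s q r) (w_layer T \<gamma> c p) =
      (\<Sum>q\<in>F. if q = p then a p * complex_of_real (sobolev_weight T c p powr (- s / 2)) else 0)"
    by (subst L2_inner_sum_left)
      (auto intro!: sum.cong L2_scale w_sob_L2 w_layer_L2 c
        simp: L2_inner_scale_left w_sob_def[abs_def] w_layer_orthonormal[OF T c \<gamma>])
  also have "\<dots> = (if p \<in> F then a p * complex_of_real (sobolev_weight T c p powr (- s / 2)) else 0)"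
    using F by (simp add: sum.delta')
  finally show ?thesis
    using arg_cong[OF sobolev_weight_powr_cancel[of T c p s], where f=complex_of_real]
    by (simp add: sobolev_coeff_def mult.left_commute)
qed

lemma sobolev_coeff_w_sob:
  assumes "T > 0" "c > 0" "\<gamma> > 0"
  shows "sobolev_coeff T \<gamma> c s (\<lambda>r. a * w_sob T \<gamma> c s q r) p = (if p = q then a else 0)"
  using sobolev_coeff_w_sob_sum[OF assms, of "{q}" s "\<lambda>_. a" p] by simp

lemma w_sob_Hs:
  assumes T: "T > 0" and c: "c > 0" and \<gamma>: "\<gamma> > 0"
  shows "(\<lambda>r. a * w_sob T \<gamma> c s q r) \<in> Hs T \<gamma> c s"
  unfolding Hs_iff_sobolev_coeff sobolev_coeff_w_sob[OF assms]
proof (intro conjI)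
  show "periodic2 (2 * c * T) (\<lambda>r. a * w_sob T \<gamma> c s q r)"
    using periodic2_w_layer[OF T c, of \<gamma> q] by (simp add: periodic2_def w_sob_def)
  show "(\<lambda>r. a * w_sob T \<gamma> c s q r) \<in> L2 (square (c * T))" by (intro L2_scale w_sob_L2 c)
  show "(\<lambda>p. (cmod (if p = q then a else 0))\<^sup>2) summable_on UNIV"
    by (rule finite_nonzero_values_imp_summable_on) (auto intro: finite_subset[of _ "{q}"])
qed

lemma Hs_inner_w_sob:
  assumes "T > 0" "c > 0" "\<gamma> > 0"
  shows "Hs_inner T \<gamma> c s f (w_sob T \<gamma> c s q) = sobolev_coeff T \<gamma> c s f q"
proof -
  have "Hs_inner T \<gamma> c s f (w_sob T \<gamma> c s q) =
      (\<Sum>\<^sub>\<infinity>p\<in>UNIV. sobolev_coeff T \<gamma> c s f p * (if p = q then 1 else 0))"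
    unfolding Hs_inner_eq_coeffs using sobolev_coeff_w_sob[OF assms, of s 1 q]
    by (intro infsum_cong) simp
  also have "\<dots> = (\<Sum>\<^sub>\<infinity>p\<in>{q}. sobolev_coeff T \<gamma> c s f p)"
    by (rule infsum_cong_neutral) auto
  finally show ?thesis by simp
qed

text \<open>
  Since \<open>s \<ge> 0\<close> and the weights are at least 1, division by their powers keeps the family square-summable,
  so that \<open>riesz_fischer\<close> provides a function on the unscaled square with the required coefficients.
\<close>
lemma Hs_with_coeffs_exists:
  assumes T: "T > 0" and c: "c > 0" and \<gamma>: "\<gamma> > 0" and s: "s \<ge> 0"
    and a: "(\<lambda>p. (cmod (a p))\<^sup>2) summable_on UNIV"
  shows "\<exists>f \<in> Hs T \<gamma> c s. \<forall>p. sobolev_coeff T \<gamma> c s f p = a p"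
proof -
  define b where "b p = complex_of_real (sqrt \<gamma> / c * sobolev_weight T c p powr (- s / 2)) * a p" for p
  have "(\<lambda>p. (sqrt \<gamma> / c)\<^sup>2 * (cmod (a p))\<^sup>2) summable_on UNIV"
    by (intro summable_on_cmult_right a)
  moreover have "(cmod (b p))\<^sup>2 \<le> (sqrt \<gamma> / c)\<^sup>2 * (cmod (a p))\<^sup>2" for p
  proof -
    have "sobolev_weight T c p powr (- s / 2) \<le> 1"
      using powr_mono[of "- s / 2" 0 "sobolev_weight T c p"] sobolev_weight_ge_1[of T c p] s by simp
    then have "(sobolev_weight T c p powr (- s / 2))\<^sup>2 \<le> 1" by (intro power_le_one) auto
    then have "(sobolev_weight T c p powr (- s / 2))\<^sup>2 * ((sqrt \<gamma> / c)\<^sup>2 * (cmod (a p))\<^sup>2) \<le> 1 * ((sqrt \<gamma> / c)\<^sup>2 * (cmod (a p))\<^sup>2)"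
      by (rule mult_right_mono) simp
    then show ?thesis by (simp add: b_def norm_mult power_mult_distrib norm_divide power_divide mult_ac)
  qed
  ultimately have "(\<lambda>p. (cmod (b p))\<^sup>2) summable_on UNIV"
    by (rule summable_on_comparison_test) auto
  then obtain g where g: "g \<in> L2 (square T)" "periodic2 (2 * T) g"
      "\<And>p. L2_inner (square T) 1 g (w T p) = b p"
    using riesz_fischer[OF T] by blast
  define f where "f r = g (r /\<^sub>R c)" for r
  have fg: "(\<lambda>r. f (c *\<^sub>R r)) = g" using c by (simp add: f_def)
  have fL: "f \<in> L2 (square (c * T))" using g(1) by (simp add: fg flip: L2_dilation_iff[OF c])
  have per: "periodic2 (2 * c * T) f"
    unfolding f_def by (rule periodic2_rescale[OF c g(2)])
  have coeff: "sobolev_coeff T \<gamma> c s f p = a p" for p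
  proof -
    have "sobolev_coeff T \<gamma> c s f p =
        complex_of_real ((sobolev_weight T c p powr (s / 2) * sobolev_weight T c p powr (- s / 2)) *
          (c / sqrt \<gamma> * (sqrt \<gamma> / c))) * a p"
      unfolding sobolev_coeff_def L2_inner_w_layer[OF c \<gamma> fL] fg g(3) b_def
      by (simp only: of_real_mult mult_ac)
    then show ?thesis using c \<gamma> by (simp only: sobolev_weight_powr_cancel) simp
  qed
  have "f \<in> Hs T \<gamma> c s" using a fL per by (simp add: Hs_iff_sobolev_coeff coeff)
  with coeff show ?thesis by blast
qed

text \<open>
  The coefficients of \<open>f\<close> minus a partial sum over \<open>F\<close> are \<open>x p - a p\<close> for \<open>p\<close> in \<open>F\<close> and \<open>x p\<close>
  elsewhere, where \<open>x\<close> are the coefficients of \<open>f\<close>. A discrepancy at \<open>p\<close> stays in the norm as soon as \<open>F\<close> contains \<open>p\<close>; without any, the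
  norm is the tail of a convergent series.
\<close>
lemma Hs_has_sum_iff:
  assumes T: "T > 0" and c: "c > 0" and \<gamma>: "\<gamma> > 0"
  shows "Hs_has_sum T \<gamma> c s (\<lambda>p r. a p * w_sob T \<gamma> c s p r) f \<longleftrightarrow>
           f \<in> Hs T \<gamma> c s \<and> (\<forall>p. sobolev_coeff T \<gamma> c s f p = a p)"
proof (cases "f \<in> Hs T \<gamma> c s")
  case True
  let ?x = "sobolev_coeff T \<gamma> c s f"
  let ?R = "\<lambda>F r. f r - (\<Sum>p\<in>F. a p * w_sob T \<gamma> c s p r)"
  have fL: "f \<in> L2 (square (c * T))" and x: "(\<lambda>p. (cmod (?x p))\<^sup>2) summable_on UNIV"
    using True by (auto simp: Hs_iff_sobolev_coeff)
  have coeff: "sobolev_coeff T \<gamma> c s (?R F) p = ?x p - (if p \<in> F then a p else 0)" if "finite F" for F p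
    using that by (simp add: sobolev_coeff_diff[OF c fL] L2_sum L2_scale w_sob_L2[OF c]
        sobolev_coeff_w_sob_sum[OF T c \<gamma>])
  have "((\<lambda>F. Hs_norm T \<gamma> c s (?R F)) \<longlongrightarrow> 0) (finite_subsets_at_top UNIV) \<longleftrightarrow> (\<forall>p. ?x p = a p)"
  proof
    assume lim: "((\<lambda>F. Hs_norm T \<gamma> c s (?R F)) \<longlongrightarrow> 0) (finite_subsets_at_top UNIV)"
    show "\<forall>p. ?x p = a p"
    proof
      fix p
      have "\<forall>\<^sub>F F in finite_subsets_at_top UNIV. cmod (?x p - a p) \<le> Hs_norm T \<gamma> c s (?R F)"
        unfolding eventually_finite_subsets_at_top
      proof (intro exI[of _ "{p}"] conjI allI impI)
        fix F :: "(int \<times> int) set" assume F: "finite F \<and> {p} \<subseteq> F \<and> F \<subseteq> UNIV"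
        have "(\<lambda>q. (cmod (?x q - (if q \<in> F then a q else 0)))\<^sup>2) summable_on UNIV"
          using F by (intro square_summable_diff x finite_nonzero_values_imp_summable_on) (auto intro: finite_subset[of _ F])
        from finite_sum_le_infsum[OF this, of "{p}"]
        have "(cmod (?x p - a p))\<^sup>2 \<le> (Hs_norm T \<gamma> c s (?R F))\<^sup>2"
          using F by (simp add: Hs_norm_square coeff)
        then show "cmod (?x p - a p) \<le> Hs_norm T \<gamma> c s (?R F)"
          by (rule power2_le_imp_le) (rule Hs_norm_nonneg)
      qed auto
      then have "cmod (?x p - a p) \<le> 0"
        by (rule tendsto_lowerbound[OF lim]) simp
      then show "?x p = a p" by simp
    qed
  next
    assume eq: "\<forall>p. ?x p = a p"
    let ?S = "\<Sum>\<^sub>\<infinity>p\<in>UNIV. (cmod (?x p))\<^sup>2"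
    have "Hs_norm T \<gamma> c s (?R F) = sqrt (?S - (\<Sum>p\<in>F. (cmod (?x p))\<^sup>2))" if F: "finite F" for F
    proof -
      have "((\<lambda>p. (cmod (?x p))\<^sup>2 - (if p \<in> F then (cmod (?x p))\<^sup>2 else 0)) has_sum
          ?S - (\<Sum>p\<in>F. (cmod (?x p))\<^sup>2)) UNIV"
        using F by (intro has_sum_diff has_sum_infsum x has_sum_finite_neutralI[of F]) auto
      then have total: "(\<Sum>\<^sub>\<infinity>p\<in>UNIV. (cmod (?x p))\<^sup>2 - (if p \<in> F then (cmod (?x p))\<^sup>2 else 0)) =
          ?S - (\<Sum>p\<in>F. (cmod (?x p))\<^sup>2)" by (rule infsumI)
      have "(Hs_norm T \<gamma> c s (?R F))\<^sup>2 = (\<Sum>\<^sub>\<infinity>p\<in>UNIV. (cmod (?x p - (if p \<in> F then a p else 0)))\<^sup>2)"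
        unfolding Hs_norm_square coeff[OF F] ..
      also have "\<dots> = (\<Sum>\<^sub>\<infinity>p\<in>UNIV. (cmod (?x p))\<^sup>2 - (if p \<in> F then (cmod (?x p))\<^sup>2 else 0))"
      proof (rule infsum_cong)
        fix p show "(cmod (?x p - (if p \<in> F then a p else 0)))\<^sup>2 =
            (cmod (?x p))\<^sup>2 - (if p \<in> F then (cmod (?x p))\<^sup>2 else 0)"
          using spec[OF eq, of p] by simp
      qed
      also note total
      finally have "(Hs_norm T \<gamma> c s (?R F))\<^sup>2 = ?S - (\<Sum>p\<in>F. (cmod (?x p))\<^sup>2)" .
      from arg_cong[OF this, where f=sqrt] show ?thesis
        by (simp only: real_sqrt_abs abs_of_nonneg[OF Hs_norm_nonneg])
    qed
    then have "\<forall>\<^sub>F F in finite_subsets_at_top UNIV.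
        sqrt (?S - (\<Sum>p\<in>F. (cmod (?x p))\<^sup>2)) = Hs_norm T \<gamma> c s (?R F)"
      by (intro eventually_finite_subsets_at_top_weakI) simp
    moreover have "((\<lambda>F. sqrt (?S - (\<Sum>p\<in>F. (cmod (?x p))\<^sup>2))) \<longlongrightarrow> sqrt (?S - ?S)) (finite_subsets_at_top UNIV)"
      using has_sum_infsum[OF x] unfolding has_sum_def by (intro tendsto_intros)
    ultimately show "((\<lambda>F. Hs_norm T \<gamma> c s (?R F)) \<longlongrightarrow> 0) (finite_subsets_at_top UNIV)"
      by (simp add: tendsto_cong)
  qed
  with True show ?thesis by (simp add: Hs_has_sum_def w_sob_Hs[OF T c \<gamma>])
qed (simp add: Hs_has_sum_def)

section \<open>The operator on Fourier coefficients\<close>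

lemma layer_coeffs_nth:
  assumes "T > 0" "\<And>l. c l > 0" "\<And>l. \<gamma> l > 0"
  shows "layer_coeffs T \<gamma> c s \<phi> p $ l = sobolev_coeff T (\<gamma> l) (c l) s (\<phi> l) p"
  by (simp add: layer_coeffs_def Hs_inner_w_sob assms)

lemma tomo_op_eq_shifts:
  assumes c: "\<And>l. c l > 0"
  shows "tomo_op \<alpha> h c \<phi> g = (\<lambda>r. \<Sum>l\<in>UNIV. \<phi> l (c l *\<^sub>R (r + (h l *\<^sub>R \<alpha> g) /\<^sub>R c l)))"
proof
  fix r
  have "c l *\<^sub>R (r + (h l *\<^sub>R \<alpha> g) /\<^sub>R c l) = c l *\<^sub>R r + h l *\<^sub>R \<alpha> g" for l
    using c[of l] by (simp add: scaleR_add_right mult.assoc[symmetric])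
  then show "tomo_op \<alpha> h c \<phi> g r = (\<Sum>l\<in>UNIV. \<phi> l (c l *\<^sub>R (r + (h l *\<^sub>R \<alpha> g) /\<^sub>R c l)))"
    by (simp only: tomo_op_def)
qed

lemma tomo_summand_L2:
  assumes T: "T > 0" and c: "c > 0" and f: "f \<in> Hs T \<gamma> c s"
  shows "(\<lambda>r. f (c *\<^sub>R (r + d))) \<in> L2 (square T)"
proof -
  have "periodic2 (2 * T) (\<lambda>r. f (c *\<^sub>R r))" "(\<lambda>r. f (c *\<^sub>R r)) \<in> L2 (square T)"
    using f by (auto simp: Hs_def intro!: periodic2_dilation L2_dilation c)
  then show ?thesis by (rule L2_shift[OF T])
qed

lemma tomo_op_data_space:
  assumes T: "T > 0" and c: "\<And>l. c l > 0" and \<phi>: "\<phi> \<in> tomo_domain T \<gamma> c s"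
  shows "tomo_op \<alpha> h c \<phi> \<in> data_space T"
proof -
  have "(\<lambda>r. \<Sum>l\<in>UNIV. \<phi> l (c l *\<^sub>R (r + (h l *\<^sub>R \<alpha> g) /\<^sub>R c l))) \<in> L2 (square T)" for g
    using \<phi> by (intro L2_sum tomo_summand_L2[OF T c]) (auto simp: tomo_domain_def)
  then show ?thesis unfolding data_space_def tomo_op_eq_shifts[OF c] by blast
qed

text \<open>
  The diagonalisation of the operator. The layer \<open>\<phi> l\<close>, dilated by \<open>c l\<close>, is shifted by
  \<open>h l \<alpha> g / c l\<close>, which multiplies its Fourier coefficient by the phase in the matrix entry. The remaining factors of that
  entry come from the normalisation of \<open>w_sob\<close> and cancel against those by which the coefficient in this
  basis differs from the plain Fourier coefficient.
\<close>
lemma data_coeffs_tomo_op: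
  assumes T: "T > 0" and c: "\<And>l. c l > 0" and \<gamma>: "\<And>l. \<gamma> l > 0"
    and \<phi>: "\<phi> \<in> tomo_domain T \<gamma> c s"
  shows "data_coeffs T (tomo_op \<alpha> h c \<phi>) p = tomo_matrix T \<alpha> h \<gamma> c s p *v layer_coeffs T \<gamma> c s \<phi> p"
proof (rule vec_eq_iff[THEN iffD2, rule_format])
  fix g
  let ?d = "\<lambda>l. (h l *\<^sub>R \<alpha> g) /\<^sub>R c l"
  have \<phi>H: "\<phi> l \<in> Hs T (\<gamma> l) (c l) s" for l using \<phi> by (simp add: tomo_domain_def)
  have \<phi>L: "\<phi> l \<in> L2 (square (c l * T))" and per: "periodic2 (2 * c l * T) (\<phi> l)" for l
    using \<phi>H[of l] by (auto simp: Hs_def)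
  have "L2_inner (square T) 1 (\<lambda>r. \<phi> l (c l *\<^sub>R (r + ?d l))) (w T p) =
      tomo_matrix T \<alpha> h \<gamma> c s p $ g $ l * layer_coeffs T \<gamma> c s \<phi> p $ l" for l
  proof -
    let ?z = "L2_inner (square T) 1 (\<lambda>r. \<phi> l (c l *\<^sub>R r)) (w T p)"
    let ?W = "sobolev_weight T (c l) p"
    have "tomo_matrix T \<alpha> h \<gamma> c s p $ g $ l * layer_coeffs T \<gamma> c s \<phi> p $ l =
        complex_of_real ((?W powr (s / 2) * ?W powr (- s / 2)) * (c l / sqrt (\<gamma> l) * (sqrt (\<gamma> l) / c l))) *
          (complex_of_real (2 * T) * w T p (?d l) * ?z)"
      unfolding layer_coeffs_nth[OF T c \<gamma>] sobolev_coeff_def L2_inner_w_layer[OF c \<gamma> \<phi>L]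
        tomo_matrix_def w_sob_def w_layer_def vec_lambda_beta
      by (simp only: of_real_mult mult_ac)
    also have "\<dots> = complex_of_real (2 * T) * w T p (?d l) * ?z"
      using c[of l] \<gamma>[of l] by (simp only: sobolev_weight_powr_cancel) simp
    finally show ?thesis
      by (simp only: L2_inner_w_shift[OF T periodic2_dilation[OF c per] L2_dilation[OF c \<phi>L]])
  qed
  then have "L2_inner (square T) 1 (tomo_op \<alpha> h c \<phi> g) (w T p) =
      (\<Sum>l\<in>UNIV. tomo_matrix T \<alpha> h \<gamma> c s p $ g $ l * layer_coeffs T \<gamma> c s \<phi> p $ l)"
    unfolding tomo_op_eq_shifts[OF c]
    by (subst L2_inner_sum_left) (auto intro!: tomo_summand_L2[OF T c \<phi>H] w_L2)
  then show "data_coeffs T (tomo_op \<alpha> h c \<phi>) p $ g =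
      (tomo_matrix T \<alpha> h \<gamma> c s p *v layer_coeffs T \<gamma> c s \<phi> p) $ g"
    by (simp add: data_coeffs_def matrix_vector_mult_def)
qed

section \<open>Singular systems of a matrix\<close>

lemma hdot_self: "hdot z z = complex_of_real ((norm z)\<^sup>2)"
proof -
  have "(norm z)\<^sup>2 = (\<Sum>i\<in>UNIV. (cmod (z $ i))\<^sup>2)"
    by (simp add: norm_vec_def L2_set_def sum_nonneg)
  then show ?thesis
    by (simp add: hdot_def complex_norm_square mult.commute del: of_real_power)
qed

lemma hdot_cnj: "cnj (hdot u z) = hdot z u"
  by (simp add: hdot_def mult.commute)

lemma hdot_add_right: "hdot u (x + y) = hdot u x + hdot u y"
  by (simp add: hdot_def ring_distribs sum.distrib)

lemma hdot_diff_right: "hdot u (x - y) = hdot u x - hdot u y"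
  by (simp add: hdot_def ring_distribs sum_subtractf)

lemma hdot_scale_right: "hdot u (a *s x) = a * hdot u x"
  by (simp add: hdot_def sum_distrib_left mult.left_commute)

lemma hdot_sum_right: "hdot u (\<Sum>n\<in>I. f n) = (\<Sum>n\<in>I. hdot u (f n))"
  by (induction I rule: infinite_finite_induct) (simp_all add: hdot_add_right, simp_all add: hdot_def)

lemma hdot_diff_left: "hdot (x - y) u = hdot x u - hdot y u"
  using arg_cong[OF hdot_diff_right[of u x y], where f=cnj] by (simp add: hdot_cnj)

definition orthonormal_family :: "nat set \<Rightarrow> (nat \<Rightarrow> complex ^ 'n) \<Rightarrow> bool" where
  "orthonormal_family I e \<longleftrightarrow> finite I \<and> (\<forall>m\<in>I. \<forall>n\<in>I. hdot (e m) (e n) = (if m = n then 1 else 0))"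

lemma hdot_orthonormal_sum:
  assumes e: "orthonormal_family I e" and m: "m \<in> I"
  shows "hdot (e m) (\<Sum>n\<in>I. b n *s e n) = b m"
proof -
  have "hdot (e m) (\<Sum>n\<in>I. b n *s e n) = (\<Sum>n\<in>I. if m = n then b n else 0)"
    unfolding hdot_sum_right using e m
    by (intro sum.cong) (auto simp: hdot_scale_right orthonormal_family_def)
  then show ?thesis using e m by (simp add: orthonormal_family_def)
qed

text \<open>
  Pythagoras: the part of \<open>z\<close> in the span of the \<open>e n\<close> is compared coefficient by coefficient, and
  the second summand is the squared distance of \<open>z\<close> from the span.
\<close>
lemma norm_orthonormal_sum_diff:
  assumes e: "orthonormal_family I e"
  shows "(norm ((\<Sum>n\<in>I. b n *s e n) - z))\<^sup>2 =
    (\<Sum>n\<in>I. (cmod (b n - hdot (e n) z))\<^sup>2) + ((norm z)\<^sup>2 - (\<Sum>n\<in>I. (cmod (hdot (e n) z))\<^sup>2))"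
proof -
  let ?y = "\<Sum>n\<in>I. b n *s e n"
  have sum_left: "hdot ?y x = (\<Sum>n\<in>I. cnj (b n) * hdot (e n) x)" for x
    using arg_cong[of _ _ cnj, OF hdot_sum_right[of x "\<lambda>n. b n *s e n" I]]
    by (simp add: hdot_cnj hdot_scale_right)
  have "complex_of_real ((norm (?y - z))\<^sup>2) = hdot ?y (?y - z) - hdot z ?y + hdot z z"
    unfolding hdot_self[symmetric] by (simp add: hdot_diff_left hdot_diff_right)
  also have "hdot ?y (?y - z) = (\<Sum>n\<in>I. cnj (b n) * (b n - hdot (e n) z))"
    unfolding sum_left by (intro sum.cong) (simp_all add: hdot_diff_right hdot_orthonormal_sum[OF e])
  also have "hdot z ?y = (\<Sum>n\<in>I. b n * cnj (hdot (e n) z))"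
    by (simp add: hdot_sum_right hdot_scale_right hdot_cnj)
  also have "(\<Sum>n\<in>I. cnj (b n) * (b n - hdot (e n) z)) - (\<Sum>n\<in>I. b n * cnj (hdot (e n) z)) =
      (\<Sum>n\<in>I. complex_of_real ((cmod (b n - hdot (e n) z))\<^sup>2 - (cmod (hdot (e n) z))\<^sup>2))"
    unfolding sum_subtractf[symmetric] of_real_diff complex_norm_square
    by (intro sum.cong) (simp_all add: algebra_simps)
  finally have "complex_of_real ((norm (?y - z))\<^sup>2) =
      complex_of_real ((\<Sum>n\<in>I. (cmod (b n - hdot (e n) z))\<^sup>2 - (cmod (hdot (e n) z))\<^sup>2) + (norm z)\<^sup>2)"
    by (simp add: hdot_self)
  then show ?thesis
    unfolding of_real_eq_iff by (simp add: sum_subtractf)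
qed

lemma norm_orthonormal_sum:
  assumes "orthonormal_family I e"
  shows "(norm (\<Sum>n\<in>I. b n *s e n))\<^sup>2 = (\<Sum>n\<in>I. (cmod (b n))\<^sup>2)"
  using norm_orthonormal_sum_diff[OF assms, of b 0] by (simp add: hdot_def)

lemma norm_projection_residual:
  assumes "orthonormal_family I e"
  shows "(norm z)\<^sup>2 = (\<Sum>n\<in>I. (cmod (hdot (e n) z))\<^sup>2) + (norm ((\<Sum>n\<in>I. hdot (e n) z *s e n) - z))\<^sup>2"
  using norm_orthonormal_sum_diff[OF assms, of "\<lambda>n. hdot (e n) z" z] by simp

text \<open>
  The Moore-Penrose inverse of a matrix with singular system \<open>\<sigma>\<close>, \<open>u\<close>, \<open>v\<close> and rank \<open>k\<close>, applied
  to \<open>f\<close>.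
\<close>
definition pinv_coeffs ::
  "nat \<Rightarrow> (nat \<Rightarrow> real) \<Rightarrow> (nat \<Rightarrow> complex ^ 'g) \<Rightarrow> (nat \<Rightarrow> complex ^ 'l) \<Rightarrow> complex ^ 'g \<Rightarrow> complex ^ 'l" where
  "pinv_coeffs k \<sigma> u v f = (\<Sum>n=1..k. (hdot (u n) f / complex_of_real (\<sigma> n)) *s v n)"

lemma singular_system_orthonormal:
  assumes "singular_system A \<sigma> u v"
  shows "orthonormal_family {1..rank A} u" "orthonormal_family {1..rank A} v"
  using assms by (auto simp: singular_system_def orthonormal_family_def)

lemma singular_system_residual:
  assumes A: "singular_system A \<sigma> u v"
  shows "(norm (A *v x - f))\<^sup>2 =
    (\<Sum>n=1..rank A. (cmod (complex_of_real (\<sigma> n) * hdot (v n) x - hdot (u n) f))\<^sup>2)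
      + ((norm f)\<^sup>2 - (\<Sum>n=1..rank A. (cmod (hdot (u n) f))\<^sup>2))"
proof -
  have "A *v x = (\<Sum>n=1..rank A. (complex_of_real (\<sigma> n) * hdot (v n) x) *s u n)"
    using A by (simp add: singular_system_def)
  then show ?thesis
    by (simp only: norm_orthonormal_sum_diff[OF singular_system_orthonormal(1)[OF A]])
qed

lemma singular_system_apply_v:
  assumes A: "singular_system A \<sigma> u v" and n: "n \<in> {1..rank A}"
  shows "A *v v n = complex_of_real (\<sigma> n) *s u n"
proof -
  have "A *v v n = (\<Sum>m=1..rank A. (complex_of_real (\<sigma> m) * hdot (v m) (v n)) *s u m)"
    using A by (simp add: singular_system_def)
  also have "\<dots> = (\<Sum>m=1..rank A. if m = n then complex_of_real (\<sigma> n) *s u n else 0)"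
    using A n by (intro sum.cong) (auto simp: singular_system_def)
  finally show ?thesis using n by simp
qed

lemma hdot_pinv_coeffs:
  assumes A: "singular_system A \<sigma> u v" and n: "n \<in> {1..rank A}"
  shows "complex_of_real (\<sigma> n) * hdot (v n) (pinv_coeffs (rank A) \<sigma> u v f) = hdot (u n) f"
proof -
  have "\<sigma> n > 0" using A n by (auto simp: singular_system_def)
  then show ?thesis
    unfolding pinv_coeffs_def hdot_orthonormal_sum[OF singular_system_orthonormal(2)[OF A] n] by simp
qed

lemma norm_pinv_coeffs:
  assumes A: "singular_system A \<sigma> u v"
  shows "(norm (pinv_coeffs (rank A) \<sigma> u v f))\<^sup>2 = (\<Sum>n=1..rank A. (cmod (hdot (u n) f))\<^sup>2 / (\<sigma> n)\<^sup>2)"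
  unfolding pinv_coeffs_def norm_orthonormal_sum[OF singular_system_orthonormal(2)[OF A]]
  by (simp add: norm_divide power_divide)

text \<open>
  All solutions of the normal equations have the same components along the \<open>v n\<close>, and
  \<open>pinv_coeffs\<close> is the one without further components.
\<close>
lemma norm_solution_pythagoras:
  assumes A: "singular_system A \<sigma> u v"
    and x: "\<And>n. n \<in> {1..rank A} \<Longrightarrow> complex_of_real (\<sigma> n) * hdot (v n) x = hdot (u n) f"
  shows "(norm x)\<^sup>2 = (norm (pinv_coeffs (rank A) \<sigma> u v f))\<^sup>2
           + (norm (pinv_coeffs (rank A) \<sigma> u v f - x))\<^sup>2"
proof -
  have b: "hdot (u n) f / complex_of_real (\<sigma> n) = hdot (v n) x" if n: "n \<in> {1..rank A}" for n
  proof -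
    have "\<sigma> n > 0" using A n by (auto simp: singular_system_def)
    then show ?thesis using x[OF n] by (simp add: field_simps)
  qed
  then have "pinv_coeffs (rank A) \<sigma> u v f = (\<Sum>n=1..rank A. hdot (v n) x *s v n)"
    unfolding pinv_coeffs_def by (intro sum.cong) auto
  then show ?thesis
    using norm_projection_residual[OF singular_system_orthonormal(2)[OF A], of x]
      norm_orthonormal_sum[OF singular_system_orthonormal(2)[OF A], of "\<lambda>n. hdot (v n) x"] by simp
qed

section \<open>Data space as a space of coefficient families\<close>

lemma data_inner_has_sum:
  assumes T: "T > 0" and f: "f \<in> data_space T" and q: "q \<in> data_space T"
  shows "((\<lambda>p. hdot (data_coeffs T q p) (data_coeffs T f p)) has_sum data_inner T f q) UNIV"
proof -
  have "hdot (data_coeffs T q p) (data_coeffs T f p) = (\<Sum>g\<in>UNIV.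
      L2_inner (square T) 1 (f g) (w T p) * cnj (L2_inner (square T) 1 (q g) (w T p)))" for p
    by (simp add: hdot_def data_coeffs_def mult.commute)
  then show ?thesis
    unfolding data_inner_def using f q
    by (simp only:) (intro has_sum_finite_sum parseval[OF T], auto simp: data_space_def)
qed

lemma data_inner_self_has_sum:
  assumes T: "T > 0" and f: "f \<in> data_space T"
  shows "((\<lambda>p. (norm (data_coeffs T f p))\<^sup>2) has_sum Re (data_inner T f f)) UNIV"
  using has_sum_Re[OF data_inner_has_sum[OF T f f]] by (simp only: hdot_self Re_complex_of_real)

lemma data_inner_self_nonneg:
  assumes "T > 0" "f \<in> data_space T" shows "Re (data_inner T f f) \<ge> 0"
  by (rule has_sum_nonneg[OF data_inner_self_has_sum[OF assms]]) simp

lemma data_norm_has_sum: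
  assumes "T > 0" "f \<in> data_space T"
  shows "((\<lambda>p. (norm (data_coeffs T f p))\<^sup>2) has_sum (data_norm T f)\<^sup>2) UNIV"
  using data_inner_self_has_sum[OF assms] data_inner_self_nonneg[OF assms] by (simp add: data_norm_def)

lemma data_norm_nonneg:
  assumes "T > 0" "f \<in> data_space T" shows "data_norm T f \<ge> 0"
  using data_inner_self_nonneg[OF assms] by (simp add: data_norm_def)

lemma data_space_diff:
  "f \<in> data_space T \<Longrightarrow> q \<in> data_space T \<Longrightarrow> (\<lambda>g r. f g r - q g r) \<in> data_space T"
  by (simp add: data_space_def L2_diff)

lemma data_coeffs_diff:
  "f \<in> data_space T \<Longrightarrow> q \<in> data_space T \<Longrightarrow>
     data_coeffs T (\<lambda>g r. f g r - q g r) p = data_coeffs T f p - data_coeffs T q p"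
  by (simp add: data_coeffs_def data_space_def vec_eq_iff L2_inner_diff_left w_L2)

section \<open>Least-squares and best approximate solutions\<close>

locale tomography =
  fixes T s :: real and \<alpha> :: "'g::finite \<Rightarrow> plane" and h \<gamma> c :: "'l::finite \<Rightarrow> real"
    and \<sigma> :: "int \<times> int \<Rightarrow> nat \<Rightarrow> real"
    and u :: "int \<times> int \<Rightarrow> nat \<Rightarrow> complex ^ 'g" and v :: "int \<times> int \<Rightarrow> nat \<Rightarrow> complex ^ 'l"
  assumes T: "T > 0" and c: "\<And>l. c l > 0" and \<gamma>: "\<And>l. \<gamma> l > 0" and s: "s \<ge> 0"
    and svd: "\<And>p. singular_system (tomo_matrix T \<alpha> h \<gamma> c s p) (\<sigma> p) (u p) (v p)"
begin

text \<open>
  \<open>X\<close> and \<open>Y\<close> are the passage to coefficients for layers and data. Everything below compares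
  \<open>A p *v X \<phi> p\<close> with \<open>Y f p\<close>, one frequency \<open>p\<close> at a time.
\<close>
abbreviation "\<D> \<equiv> tomo_domain T \<gamma> c s"
abbreviation "op \<equiv> tomo_op \<alpha> h c"
abbreviation "A \<equiv> tomo_matrix T \<alpha> h \<gamma> c s"
abbreviation "X \<equiv> layer_coeffs T \<gamma> c s"
abbreviation "Y \<equiv> data_coeffs T"

definition best_coeffs :: "('g \<Rightarrow> plane \<Rightarrow> complex) \<Rightarrow> int \<times> int \<Rightarrow> complex ^ 'l" where
  "best_coeffs f p = pinv_coeffs (rank (A p)) (\<sigma> p) (u p) (v p) (Y f p)"

text \<open>
  The normal equation \<open>A\<^sup>H A x = A\<^sup>H f\<close> at frequency \<open>p\<close>, written in the singular bases.
\<close>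
definition normal_equation :: "('g \<Rightarrow> plane \<Rightarrow> complex) \<Rightarrow> ('l \<Rightarrow> plane \<Rightarrow> complex) \<Rightarrow> int \<times> int \<Rightarrow> bool" where
  "normal_equation f \<phi> p \<longleftrightarrow>
     (\<forall>n\<in>{1..rank (A p)}. complex_of_real (\<sigma> p n) * hdot (v p n) (X \<phi> p) = hdot (u p n) (Y f p))"

lemma norm_layer_coeffs_square:
  "(norm (X \<phi> p))\<^sup>2 = (\<Sum>l\<in>UNIV. (cmod (sobolev_coeff T (\<gamma> l) (c l) s (\<phi> l) p))\<^sup>2)"
  by (simp add: norm_vec_def L2_set_def sum_nonneg layer_coeffs_nth[OF T c \<gamma>])

lemma tomo_domain_norm_has_sum:
  assumes "\<phi> \<in> \<D>"
  shows "((\<lambda>p. (norm (X \<phi> p))\<^sup>2) has_sum (tomo_domain_norm T \<gamma> c s \<phi>)\<^sup>2) UNIV"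
proof -
  have "((\<lambda>p. (norm (X \<phi> p))\<^sup>2) has_sum
      (\<Sum>l\<in>UNIV. \<Sum>\<^sub>\<infinity>p\<in>UNIV. (cmod (sobolev_coeff T (\<gamma> l) (c l) s (\<phi> l) p))\<^sup>2)) UNIV"
    unfolding norm_layer_coeffs_square using assms
    by (intro has_sum_finite_sum has_sum_infsum) (auto simp: tomo_domain_def Hs_iff_sobolev_coeff)
  moreover have "(tomo_domain_norm T \<gamma> c s \<phi>)\<^sup>2 =
      (\<Sum>l\<in>UNIV. \<Sum>\<^sub>\<infinity>p\<in>UNIV. (cmod (sobolev_coeff T (\<gamma> l) (c l) s (\<phi> l) p))\<^sup>2)"
    by (simp add: tomo_domain_norm_def Hs_inner_self sum_nonneg infsum_nonneg)
  ultimately show ?thesis by simp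
qed

lemma tomo_domain_norm_nonneg: "tomo_domain_norm T \<gamma> c s \<phi> \<ge> 0"
  by (simp add: tomo_domain_norm_def Hs_inner_self sum_nonneg infsum_nonneg)

lemma op_data_space: "\<phi> \<in> \<D> \<Longrightarrow> op \<phi> \<in> data_space T"
  by (rule tomo_op_data_space[OF T c])

lemma Y_op: "\<phi> \<in> \<D> \<Longrightarrow> Y (op \<phi>) p = A p *v X \<phi> p"
  by (rule data_coeffs_tomo_op[OF T c \<gamma>])

lemma residual_has_sum:
  assumes "\<phi> \<in> \<D>" "f \<in> data_space T"
  shows "((\<lambda>p. (norm (A p *v X \<phi> p - Y f p))\<^sup>2) has_sum
           (data_norm T (\<lambda>g r. op \<phi> g r - f g r))\<^sup>2) UNIV"
  using data_norm_has_sum[OF T data_space_diff[OF op_data_space assms(2)]] assms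
  by (simp add: data_coeffs_diff op_data_space Y_op)

lemma tomo_domain_exists:
  assumes x: "(\<lambda>p. (norm (x p))\<^sup>2) summable_on UNIV"
  shows "\<exists>\<phi>\<in>\<D>. \<forall>p. X \<phi> p = x p"
proof -
  have "\<exists>f\<in>Hs T (\<gamma> l) (c l) s. \<forall>p. sobolev_coeff T (\<gamma> l) (c l) s f p = x p $ l" for l
  proof (rule Hs_with_coeffs_exists[OF T c \<gamma> s])
    show "(\<lambda>p. (cmod (x p $ l))\<^sup>2) summable_on UNIV"
      by (rule summable_on_comparison_test[OF x]) (auto intro!: power_mono Finite_Cartesian_Product.norm_nth_le)
  qed
  then obtain \<phi> where \<phi>: "\<And>l. \<phi> l \<in> Hs T (\<gamma> l) (c l) s"
      "\<And>l p. sobolev_coeff T (\<gamma> l) (c l) s (\<phi> l) p = x p $ l" by metis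
  have "\<phi> \<in> \<D>" using \<phi>(1) by (simp add: tomo_domain_def)
  moreover have "\<forall>p. X \<phi> p = x p" by (simp add: vec_eq_iff layer_coeffs_nth[OF T c \<gamma>] \<phi>(2))
  ultimately show ?thesis by blast
qed

lemma tomo_domain_update:
  assumes "\<phi> \<in> \<D>"
  obtains \<psi> where "\<psi> \<in> \<D>" "\<And>p. X \<psi> p = (if p = p0 then z else X \<phi> p)"
proof -
  have "(\<lambda>p. if p = p0 then (norm z)\<^sup>2 else (norm (X \<phi> p))\<^sup>2) summable_on UNIV"
    using has_sum_update[OF tomo_domain_norm_has_sum[OF assms]] by (rule has_sum_imp_summable)
  also have "(\<lambda>p. if p = p0 then (norm z)\<^sup>2 else (norm (X \<phi> p))\<^sup>2) =
      (\<lambda>p. (norm (if p = p0 then z else X \<phi> p))\<^sup>2)" by (rule ext) simp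
  finally obtain \<psi> where "\<psi> \<in> \<D>" "\<forall>p. X \<psi> p = (if p = p0 then z else X \<phi> p)"
    by (rule tomo_domain_exists[THEN bexE])
  then show ?thesis by (intro that[of \<psi>]) (assumption, rule spec)
qed

lemma residual_square:
  "(norm (A p *v x - Y f p))\<^sup>2 =
    (\<Sum>n=1..rank (A p). (cmod (complex_of_real (\<sigma> p n) * hdot (v p n) x - hdot (u p n) (Y f p)))\<^sup>2)
      + ((norm (Y f p))\<^sup>2 - (\<Sum>n=1..rank (A p). (cmod (hdot (u p n) (Y f p)))\<^sup>2))"
  by (rule singular_system_residual[OF svd])

lemma residual_pinv_coeffs:
  "(norm (A p *v best_coeffs f p - Y f p))\<^sup>2 = (norm (Y f p))\<^sup>2 - (\<Sum>n=1..rank (A p). (cmod (hdot (u p n) (Y f p)))\<^sup>2)"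
  unfolding residual_square by (simp add: best_coeffs_def hdot_pinv_coeffs[OF svd])

text \<open>
  The residual at \<open>p\<close> is a part independent of \<open>x\<close> plus the defect of the normal equation. If
  \<open>\<phi>\<close> is a least-squares solution, replacing its coefficients at \<open>p0\<close> alone by the minimising ones
  changes the total residual by the defect at \<open>p0\<close>, which therefore vanishes.
\<close>
lemma least_squares_iff:
  assumes f: "f \<in> data_space T"
  shows "least_squares_solution T \<alpha> h \<gamma> c s f \<phi> \<longleftrightarrow> \<phi> \<in> \<D> \<and> (\<forall>p. normal_equation f \<phi> p)"
proof (intro iffI conjI allI)
  assume ls: "least_squares_solution T \<alpha> h \<gamma> c s f \<phi>"
  then show \<phi>: "\<phi> \<in> \<D>" by (simp add: least_squares_solution_def)
  let ?res = "\<lambda>\<psi> p. (norm (A p *v X \<psi> p - Y f p))\<^sup>2"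
  let ?N = "\<lambda>\<psi>. (data_norm T (\<lambda>g r. op \<psi> g r - f g r))\<^sup>2"
  fix p0
  obtain \<psi> where \<psi>: "\<psi> \<in> \<D>" "\<And>p. X \<psi> p = (if p = p0 then best_coeffs f p0 else X \<phi> p)"
    using tomo_domain_update[OF \<phi>] by blast
  have "((\<lambda>p. if p = p0 then ?res \<psi> p0 else ?res \<phi> p) has_sum ?N \<psi>) UNIV"
    by (rule iffD1[OF has_sum_cong residual_has_sum[OF \<psi>(1) f]]) (simp add: \<psi>(2))
  moreover have "((\<lambda>p. if p = p0 then ?res \<psi> p0 else ?res \<phi> p) has_sum
      (?N \<phi> - ?res \<phi> p0 + ?res \<psi> p0)) UNIV"
    by (rule has_sum_update[OF residual_has_sum[OF \<phi> f]])
  ultimately have "?N \<psi> = ?N \<phi> - ?res \<phi> p0 + ?res \<psi> p0" by (rule has_sum_unique)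
  moreover have "?N \<phi> \<le> ?N \<psi>"
    using ls \<psi>(1) data_norm_nonneg[OF T data_space_diff[OF op_data_space[OF \<phi>] f]]
    by (intro power_mono) (auto simp: least_squares_solution_def)
  ultimately have "?res \<phi> p0 \<le> ?res \<psi> p0" by linarith
  also have "?res \<psi> p0 = (norm (A p0 *v best_coeffs f p0 - Y f p0))\<^sup>2" by (simp add: \<psi>(2))
  finally have "(\<Sum>n=1..rank (A p0). (cmod (complex_of_real (\<sigma> p0 n) * hdot (v p0 n) (X \<phi> p0)
      - hdot (u p0 n) (Y f p0)))\<^sup>2) \<le> 0"
    unfolding residual_pinv_coeffs residual_square[of p0 "X \<phi> p0"] by linarith
  then have "(\<Sum>n=1..rank (A p0). (cmod (complex_of_real (\<sigma> p0 n) * hdot (v p0 n) (X \<phi> p0)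
      - hdot (u p0 n) (Y f p0)))\<^sup>2) = 0"
    by (intro antisym sum_nonneg) auto
  then show "normal_equation f \<phi> p0"
    by (subst (asm) sum_nonneg_eq_0_iff) (auto simp: normal_equation_def)
next
  assume *: "\<phi> \<in> \<D> \<and> (\<forall>p. normal_equation f \<phi> p)"
  show "least_squares_solution T \<alpha> h \<gamma> c s f \<phi>"
    unfolding least_squares_solution_def
  proof (intro conjI ballI)
    show \<phi>: "\<phi> \<in> \<D>" using * by simp
    fix \<psi> assume \<psi>: "\<psi> \<in> \<D>"
    have "(data_norm T (\<lambda>g r. op \<phi> g r - f g r))\<^sup>2 \<le> (data_norm T (\<lambda>g r. op \<psi> g r - f g r))\<^sup>2"
    proof (rule has_sum_mono[OF residual_has_sum[OF \<phi> f] residual_has_sum[OF \<psi> f]])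
      fix p
      have "normal_equation f \<phi> p" using * by blast
      then have "(\<Sum>n=1..rank (A p). (cmod (complex_of_real (\<sigma> p n) * hdot (v p n) (X \<phi> p)
          - hdot (u p n) (Y f p)))\<^sup>2) = 0"
        by (intro sum.neutral) (simp add: normal_equation_def)
      moreover have "0 \<le> (\<Sum>n=1..rank (A p). (cmod (complex_of_real (\<sigma> p n) * hdot (v p n) (X \<psi> p)
          - hdot (u p n) (Y f p)))\<^sup>2)" by (intro sum_nonneg) simp
      ultimately show "(norm (A p *v X \<phi> p - Y f p))\<^sup>2 \<le> (norm (A p *v X \<psi> p - Y f p))\<^sup>2"
        unfolding residual_square by linarith
    qed
    then show "data_norm T (\<lambda>g r. op \<phi> g r - f g r) \<le> data_norm T (\<lambda>g r. op \<psi> g r - f g r)"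
      by (rule power2_le_imp_le) (rule data_norm_nonneg[OF T data_space_diff[OF op_data_space[OF \<psi>] f]])
  qed
qed

lemma normal_equation_pythagoras:
  assumes "normal_equation f \<phi> p"
  shows "(norm (X \<phi> p))\<^sup>2 = (norm (best_coeffs f p))\<^sup>2 + (norm (best_coeffs f p - X \<phi> p))\<^sup>2"
  using assms norm_solution_pythagoras[OF svd, of p "X \<phi> p" "Y f p"]
  unfolding best_coeffs_def normal_equation_def by blast

lemma normal_equation_if_coeffs_eq: "X \<phi> p = best_coeffs f p \<Longrightarrow> normal_equation f \<phi> p"
  by (simp add: normal_equation_def best_coeffs_def hdot_pinv_coeffs[OF svd])

text \<open>
  Replacing the coefficients of a least-squares solution at one frequency by the shortest solution of
  the normal equation there yields again a least-squares solution. A solution of minimal norm is thus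
  shortest at each frequency.
\<close>
lemma best_approximate_iff:
  assumes f: "f \<in> data_space T"
  shows "best_approximate_solution T \<alpha> h \<gamma> c s f \<phi> \<longleftrightarrow> \<phi> \<in> \<D> \<and> (\<forall>p. X \<phi> p = best_coeffs f p)"
proof (intro iffI conjI allI)
  let ?N = "\<lambda>\<psi>. (tomo_domain_norm T \<gamma> c s \<psi>)\<^sup>2"
  assume best: "best_approximate_solution T \<alpha> h \<gamma> c s f \<phi>"
  then have ls: "\<And>p. normal_equation f \<phi> p" and \<phi>': "\<phi> \<in> \<D>"
    unfolding best_approximate_solution_def least_squares_iff[OF f] by blast+
  then show \<phi>: "\<phi> \<in> \<D>" by simp
  fix p0
  obtain \<psi> where \<psi>: "\<psi> \<in> \<D>" "\<And>p. X \<psi> p = (if p = p0 then best_coeffs f p0 else X \<phi> p)"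
    using tomo_domain_update[OF \<phi>'] by blast
  have "normal_equation f \<psi> p" for p
    using ls[of p] normal_equation_if_coeffs_eq[of \<psi> p f] \<psi>(2)[of p]
    by (cases "p = p0") (simp_all add: normal_equation_def)
  then have "least_squares_solution T \<alpha> h \<gamma> c s f \<psi>" using \<psi>(1) by (simp add: least_squares_iff[OF f])
  then have le: "?N \<phi> \<le> ?N \<psi>"
    using best by (intro power_mono tomo_domain_norm_nonneg) (auto simp: best_approximate_solution_def)
  have "((\<lambda>p. if p = p0 then (norm (best_coeffs f p0))\<^sup>2 else (norm (X \<phi> p))\<^sup>2) has_sum ?N \<psi>) UNIV"
    by (rule iffD1[OF has_sum_cong tomo_domain_norm_has_sum[OF \<psi>(1)]]) (simp add: \<psi>(2))
  from has_sum_unique[OF this has_sum_update[OF tomo_domain_norm_has_sum[OF \<phi>']]]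
  have "?N \<psi> = ?N \<phi> - (norm (X \<phi> p0))\<^sup>2 + (norm (best_coeffs f p0))\<^sup>2" .
  then have "(norm (best_coeffs f p0 - X \<phi> p0))\<^sup>2 \<le> 0"
    using le normal_equation_pythagoras[OF ls[of p0]] by linarith
  then show "X \<phi> p0 = best_coeffs f p0" by simp
next
  assume *: "\<phi> \<in> \<D> \<and> (\<forall>p. X \<phi> p = best_coeffs f p)"
  show "best_approximate_solution T \<alpha> h \<gamma> c s f \<phi>"
    unfolding best_approximate_solution_def
  proof (intro conjI allI impI)
    show "least_squares_solution T \<alpha> h \<gamma> c s f \<phi>"
      using * normal_equation_if_coeffs_eq unfolding least_squares_iff[OF f] by blast
    fix \<psi> assume "least_squares_solution T \<alpha> h \<gamma> c s f \<psi>"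
    then have \<psi>: "\<psi> \<in> \<D>" "\<And>p. normal_equation f \<psi> p"
      unfolding least_squares_iff[OF f] by blast+
    have "(tomo_domain_norm T \<gamma> c s \<phi>)\<^sup>2 \<le> (tomo_domain_norm T \<gamma> c s \<psi>)\<^sup>2"
    proof (rule has_sum_mono[OF tomo_domain_norm_has_sum tomo_domain_norm_has_sum[OF \<psi>(1)]])
      show "\<phi> \<in> \<D>" using * by blast
      fix p
      have "X \<phi> p = best_coeffs f p" using * by blast
      then show "(norm (X \<phi> p))\<^sup>2 \<le> (norm (X \<psi> p))\<^sup>2"
        using normal_equation_pythagoras[OF \<psi>(2), of p] by simp
    qed
    then show "tomo_domain_norm T \<gamma> c s \<phi> \<le> tomo_domain_norm T \<gamma> c s \<psi>"
      by (rule power2_le_imp_le) (rule tomo_domain_norm_nonneg)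
  qed
qed

definition picard :: "('g \<Rightarrow> plane \<Rightarrow> complex) \<Rightarrow> bool" where
  "picard f \<longleftrightarrow> (\<lambda>p. \<Sum>n=1..rank (A p). (cmod (hdot (u p n) (Y f p)))\<^sup>2 / (\<sigma> p n)\<^sup>2) summable_on UNIV"

lemma picard_iff: "picard f \<longleftrightarrow> (\<lambda>p. (norm (best_coeffs f p))\<^sup>2) summable_on UNIV"
  by (simp add: picard_def best_coeffs_def norm_pinv_coeffs[OF svd])

lemma picard_iff_exists: "picard f \<longleftrightarrow> (\<exists>\<phi>. \<phi> \<in> \<D> \<and> (\<forall>p. X \<phi> p = best_coeffs f p))"
proof
  assume "picard f"
  then show "\<exists>\<phi>. \<phi> \<in> \<D> \<and> (\<forall>p. X \<phi> p = best_coeffs f p)"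
    using tomo_domain_exists[of "best_coeffs f"] unfolding picard_iff by blast
next
  assume "\<exists>\<phi>. \<phi> \<in> \<D> \<and> (\<forall>p. X \<phi> p = best_coeffs f p)"
  then obtain \<phi> where \<phi>: "\<phi> \<in> \<D>" "\<And>p. X \<phi> p = best_coeffs f p" by blast
  then show "picard f"
    using has_sum_imp_summable[OF tomo_domain_norm_has_sum[OF \<phi>(1)]] by (simp add: picard_iff)
qed

text \<open>
  By Pythagoras the coefficients of any least-squares solution dominate \<open>best_coeffs\<close>.
\<close>
lemma picard_if_normal_equation:
  assumes \<phi>: "\<phi> \<in> \<D>" and ne: "\<And>p. normal_equation f \<phi> p"
  shows "picard f"
  unfolding picard_iff
  by (rule summable_on_comparison_test[OF has_sum_imp_summable[OF tomo_domain_norm_has_sum[OF \<phi>]]])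
    (use normal_equation_pythagoras[OF ne] in auto)

text \<open>
  Testing \<open>q \<bottom> \<R>(A)\<close> with a \<open>\<psi>\<close> whose only nonzero coefficient vector is \<open>v p n\<close> at frequency \<open>p\<close>
  gives \<open>u\<^sub>n\<^sup>H q = 0\<close> there; so a decomposition \<open>f = A \<phi> + q\<close> is the same as a \<open>\<phi>\<close> that solves
  all normal equations.
\<close>
lemma pinv_domain_iff:
  assumes f: "f \<in> data_space T"
  shows "f \<in> pinv_domain T \<alpha> h \<gamma> c s \<longleftrightarrow> picard f"
proof
  assume "f \<in> pinv_domain T \<alpha> h \<gamma> c s"
  then obtain \<phi> q where \<phi>: "\<phi> \<in> \<D>" and q: "q \<in> data_space T"
      and orth: "\<And>\<psi>. \<psi> \<in> \<D> \<Longrightarrow> data_inner T (op \<psi>) q = 0"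
      and fq: "\<And>g. AE r in lebesgue_on (square T). f g r = op \<phi> g r + q g r"
    unfolding pinv_domain_def by blast
  have "normal_equation f \<phi> p" for p
    unfolding normal_equation_def
  proof
    fix n assume n: "n \<in> {1..rank (A p)}"
    have sn: "\<sigma> p n > 0" using svd[of p] n by (auto simp: singular_system_def)
    have "(\<lambda>p'. (norm (if p' = p then v p n else 0))\<^sup>2) summable_on UNIV"
      by (rule finite_nonzero_values_imp_summable_on) (auto intro: finite_subset[of _ "{p}"])
    then obtain \<psi> where \<psi>: "\<psi> \<in> \<D>" and X\<psi>: "\<forall>p'. X \<psi> p' = (if p' = p then v p n else 0)"
      by (rule tomo_domain_exists[THEN bexE])
    have "((\<lambda>p'. if p' = p then hdot (Y q p) (A p *v v p n) else 0) has_sum data_inner T (op \<psi>) q) UNIV"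
    proof (rule iffD1[OF has_sum_cong data_inner_has_sum[OF T op_data_space[OF \<psi>] q]])
      fix p'
      show "hdot (Y q p') (Y (op \<psi>) p') = (if p' = p then hdot (Y q p) (A p *v v p n) else 0)"
        unfolding Y_op[OF \<psi>] spec[OF X\<psi>, of p'] by (cases "p' = p") (simp_all add: hdot_def)
    qed
    then have "((\<lambda>p'. if p' = p then hdot (Y q p) (A p *v v p n) else 0) has_sum 0) UNIV"
      by (simp only: orth[OF \<psi>])
    moreover have "((\<lambda>p'. if p' = p then hdot (Y q p) (A p *v v p n) else 0) has_sum
        hdot (Y q p) (A p *v v p n)) UNIV"
      by (rule has_sum_finite_neutralI[of "{p}"]) auto
    ultimately have "hdot (Y q p) (A p *v v p n) = 0" using has_sum_unique by blast
    then have "hdot (Y q p) (u p n) = 0"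
      using sn by (simp add: singular_system_apply_v[OF svd n] hdot_scale_right)
    then have uq: "hdot (u p n) (Y q p) = 0" using hdot_cnj[of "Y q p" "u p n"] by simp
    have "Y f p = Y (op \<phi>) p + Y q p"
    proof (rule vec_eq_iff[THEN iffD2, rule_format])
      fix g
      have L: "f g \<in> L2 (square T)" "op \<phi> g \<in> L2 (square T)" "q g \<in> L2 (square T)"
        using f q op_data_space[OF \<phi>] by (auto simp: data_space_def)
      show "Y f p $ g = (Y (op \<phi>) p + Y q p) $ g"
        using L2_inner_cong_AE[OF L(1) L2_add[OF L(2,3)] w_L2 fq, of 1 p]
        by (simp add: data_coeffs_def L2_inner_add_left[OF L(2,3) w_L2])
    qed
    then have "hdot (u p n) (Y f p) = hdot (u p n) (A p *v X \<phi> p)"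
      by (simp add: hdot_add_right uq Y_op[OF \<phi>])
    also have "A p *v X \<phi> p = (\<Sum>m=1..rank (A p). (complex_of_real (\<sigma> p m) * hdot (v p m) (X \<phi> p)) *s u p m)"
      using svd[of p] by (simp add: singular_system_def)
    also have "hdot (u p n) \<dots> = complex_of_real (\<sigma> p n) * hdot (v p n) (X \<phi> p)"
      by (rule hdot_orthonormal_sum[OF singular_system_orthonormal(1)[OF svd] n])
    finally show "complex_of_real (\<sigma> p n) * hdot (v p n) (X \<phi> p) = hdot (u p n) (Y f p)" ..
  qed
  with \<phi> show "picard f" by (rule picard_if_normal_equation)
next
  assume "picard f"
  then obtain \<phi> where \<phi>: "\<phi> \<in> \<D>" "\<And>p. X \<phi> p = best_coeffs f p" unfolding picard_iff_exists by blast
  define q where "q = (\<lambda>g r. f g r - op \<phi> g r)"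
  have q: "q \<in> data_space T" unfolding q_def by (rule data_space_diff[OF f op_data_space[OF \<phi>(1)]])
  have Yq: "Y q p = Y f p - A p *v best_coeffs f p" for p
    unfolding q_def by (simp add: data_coeffs_diff[OF f op_data_space[OF \<phi>(1)]] Y_op[OF \<phi>(1)] \<phi>(2))
  have uq: "hdot (u p n) (Y q p) = 0" if n: "n \<in> {1..rank (A p)}" for p n
  proof -
    have "A p *v best_coeffs f p = (\<Sum>m=1..rank (A p). (complex_of_real (\<sigma> p m) * hdot (v p m) (best_coeffs f p)) *s u p m)"
      using svd[of p] by (simp add: singular_system_def)
    then have "hdot (u p n) (A p *v best_coeffs f p) = complex_of_real (\<sigma> p n) * hdot (v p n) (best_coeffs f p)"
      by (simp only: hdot_orthonormal_sum[OF singular_system_orthonormal(1)[OF svd] n])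
    also have "\<dots> = hdot (u p n) (Y f p)" unfolding best_coeffs_def by (rule hdot_pinv_coeffs[OF svd n])
    finally show ?thesis by (simp add: Yq hdot_diff_right)
  qed
  have "data_inner T (op \<psi>) q = 0" if \<psi>: "\<psi> \<in> \<D>" for \<psi>
  proof -
    have "hdot (Y q p) (Y (op \<psi>) p) = 0" for p
    proof -
      have "Y (op \<psi>) p = (\<Sum>m=1..rank (A p). (complex_of_real (\<sigma> p m) * hdot (v p m) (X \<psi> p)) *s u p m)"
        using svd[of p] by (simp add: singular_system_def Y_op[OF \<psi>])
      moreover have "hdot (Y q p) (u p m) = 0" if "m \<in> {1..rank (A p)}" for m
        using arg_cong[OF uq[OF that], where f=cnj] by (simp add: hdot_cnj)
      ultimately show ?thesis by (simp add: hdot_sum_right hdot_scale_right)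
    qed
    then have "((\<lambda>p::int \<times> int. 0) has_sum data_inner T (op \<psi>) q) UNIV"
      using data_inner_has_sum[OF T op_data_space[OF \<psi>] q] by simp
    from has_sum_unique[OF this has_sum_0_simp] show ?thesis .
  qed
  moreover have "\<forall>g. AE r in lebesgue_on (square T). f g r = op \<phi> g r + q g r" by (simp add: q_def)
  ultimately show "f \<in> pinv_domain T \<alpha> h \<gamma> c s"
    unfolding pinv_domain_def using f \<phi>(1) q by blast
qed

lemma series_iff:
  "(\<forall>l. Hs_has_sum T (\<gamma> l) (c l) s (\<lambda>p r. best_coeffs f p $ l * w_sob T (\<gamma> l) (c l) s p r) (\<phi> l)) \<longleftrightarrow>
     \<phi> \<in> \<D> \<and> (\<forall>p. X \<phi> p = best_coeffs f p)"
  unfolding Hs_has_sum_iff[OF T c \<gamma>] tomo_domain_def vec_eq_iff layer_coeffs_nth[OF T c \<gamma>] by blast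

lemma op_has_sum:
  assumes \<phi>: "\<phi> \<in> \<D>"
  shows "L2_has_sum (square T) (\<lambda>p r. (\<Sum>n=1..rank (A p).
      (complex_of_real (\<sigma> p n) * hdot (v p n) (X \<phi> p)) *s u p n) $ g * w T p r) (op \<phi> g)"
proof -
  have "op \<phi> g \<in> L2 (square T)" using op_data_space[OF \<phi>] by (simp add: data_space_def)
  from L2_has_sum_fourier[OF T this]
  have "L2_has_sum (square T) (\<lambda>p r. (A p *v X \<phi> p) $ g * w T p r) (op \<phi> g)"
    by (simp flip: Y_op[OF \<phi>] add: data_coeffs_def)
  moreover have "A p *v X \<phi> p = (\<Sum>n=1..rank (A p). (complex_of_real (\<sigma> p n) * hdot (v p n) (X \<phi> p)) *s u p n)" for p
    using svd[of p] by (simp add: singular_system_def)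
  ultimately show ?thesis by simp
qed

end

theorem theorem3p3:
  fixes \<alpha> :: "'g::finite \<Rightarrow> real \<times> real"
    and h \<gamma> c :: "'l::{finite, linorder} \<Rightarrow> real"
    and T s :: real
    and \<Omega>\<^sub>A :: "(real \<times> real) set"
    and \<sigma> :: "int \<times> int \<Rightarrow> nat \<Rightarrow> real"
    and u :: "int \<times> int \<Rightarrow> nat \<Rightarrow> complex ^ 'g"
    and v :: "int \<times> int \<Rightarrow> nat \<Rightarrow> complex ^ 'l::{finite, linorder}"
    and rk :: "int \<times> int \<Rightarrow> nat"
  assumes "\<And>l. 0 \<le> h l" and "strict_mono h"
    and "\<And>l. \<gamma> l > 0" and "(\<Sum>l\<in>UNIV. \<gamma> l) = 1"
    and "(\<forall>l. c l = 1) \<or> (\<exists>h\<^sub>L\<^sub>G\<^sub>S. \<forall>l. h l < h\<^sub>L\<^sub>G\<^sub>S \<and> c l = 1 - h l / h\<^sub>L\<^sub>G\<^sub>S)"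
    and "T > 0"
    and "\<And>g l. (\<lambda>r. r + h l *\<^sub>R \<alpha> g) ` \<Omega>\<^sub>A \<subseteq> square (c l * T)"
    and "s \<ge> 0"
    and "\<And>p. rk p = rank (tomo_matrix T \<alpha> h \<gamma> c s p)"
    and "\<And>p. singular_system (tomo_matrix T \<alpha> h \<gamma> c s p) (\<sigma> p) (u p) (v p)"
  shows
    "(\<forall>\<phi> \<in> tomo_domain T \<gamma> c s. \<forall>g.
        L2_has_sum (square T)
          (\<lambda>p r. (\<Sum>n=1..rk p.
              (complex_of_real (\<sigma> p n) * hdot (v p n) (layer_coeffs T \<gamma> c s \<phi> p)) *s u p n) $ g
            * w T p r)
          (tomo_op \<alpha> h c \<phi> g))
   \<and> (\<forall>f \<in> data_space T.
        let picard = (\<lambda>p. \<Sum>n=1..rk p.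
              (cmod (hdot (u p n) (data_coeffs T f p)))\<^sup>2 / (\<sigma> p n)\<^sup>2) summable_on UNIV;
            series_sums_to = (\<lambda>\<phi>. \<forall>l.
              Hs_has_sum T (\<gamma> l) (c l) s
                (\<lambda>p r. (\<Sum>n=1..rk p.
                    (hdot (u p n) (data_coeffs T f p) / complex_of_real (\<sigma> p n)) *s v p n) $ l
                  * w_sob T (\<gamma> l) (c l) s p r)
                (\<phi> l))
        in (\<forall>g. L2_has_sum (square T) (\<lambda>p r. data_coeffs T f p $ g * w T p r) (f g))
         \<and> (\<forall>\<phi>. best_approximate_solution T \<alpha> h \<gamma> c s f \<phi> \<longleftrightarrow> series_sums_to \<phi>)
         \<and> ((\<exists>\<phi>. best_approximate_solution T \<alpha> h \<gamma> c s f \<phi>) \<longleftrightarrow> picard)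
         \<and> (f \<in> pinv_domain T \<alpha> h \<gamma> c s \<longleftrightarrow> picard)
         \<and> ((\<exists>\<phi>. series_sums_to \<phi>) \<longleftrightarrow> picard))"
proof -
  have c: "c l > 0" for l
    using assms(5)
  proof
    assume "\<exists>h\<^sub>L\<^sub>G\<^sub>S. \<forall>l. h l < h\<^sub>L\<^sub>G\<^sub>S \<and> c l = 1 - h l / h\<^sub>L\<^sub>G\<^sub>S"
    then obtain H where "h l < H" "c l = 1 - h l / H" by blast
    moreover from this assms(1)[of l] have "h l / H < 1" by simp
    ultimately show ?thesis by simp
  qed simp
  interpret tomography T s \<alpha> h \<gamma> c \<sigma> u v
    by standard (use assms c in auto)
  have data: "L2_has_sum (square T) (\<lambda>p r. data_coeffs T f p $ g * w T p r) (f g)"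
    if "f \<in> data_space T" for f g
    using L2_has_sum_fourier[OF T, of "f g"] that by (simp add: data_space_def data_coeffs_def)
  show ?thesis
    unfolding assms(9) Let_def
  proof (intro conjI ballI, goal_cases)
    case (1 \<phi>)
    then show ?case by (blast intro: op_has_sum)
  next
    case (2 f)
    then show ?case by (blast intro: data)
  next
    case (3 f)
    then show ?case
      by (simp only: best_approximate_iff series_iff[unfolded best_coeffs_def pinv_coeffs_def] best_coeffs_def pinv_coeffs_def) simp
  next
    case (4 f)
    then show ?case
      unfolding picard_iff_exists[unfolded picard_def] using best_approximate_iff by blast
  next
    case (5 f)
    then show ?case by (simp only: pinv_domain_iff picard_def)
  next
    case (6 f)
    show ?case
      by (simp only: series_iff[unfolded best_coeffs_def pinv_coeffs_def] picard_iff_exists[unfolded picard_def best_coeffs_def pinv_coeffs_def])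
  qed
qed

end
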